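(* Fix $t>0$ and let $\{\mathbf{z}^k\}$ be the sequence generated by the inexact damped-step generalized Newton scheme (DGN) $$\left\{\begin{array}{ll}\tilde{\mathbf{z}}^{k+1}&\approx\bar{\mathbf{z}}^{k+1}:=\mathcal{P}_{\mathbf{z}^k}\big(\mathbf{z}^k-\nabla^2F(\mathbf{z}^k)^{-1}\nabla F(\mathbf{z}^k);t\big),\\ \alpha_k&:=\frac{1}{1+\tilde\lambda_t(\mathbf{z}^k)}\ \text{ with }\ \tilde\lambda_t(\mathbf{z}^k):=\|\tilde{\mathbf{z}}^{k+1}-\mathbf{z}^k\|_{\mathbf{z}^k},\\ \mathbf{z}^{k+1}&:=(1-\alpha_k)\mathbf{z}^k+\alpha_k\tilde{\mathbf{z}}^{k+1},\end{array}\right.$$ where $\tilde{\mathbf{z}}^{k+1}$ is a $\delta_k$-approximation to $\bar{\mathbf{z}}^{k+1}$ (at $\mathbf{z}^k$ and $t$). Then: (a) If $\delta_k\le\frac{\tilde\lambda_t(\mathbf{z}^k)^2}{1+\tilde\lambda_t(\mathbf{z}^k)}$ for all $k$, then $$\tilde\lambda_t(\mathbf{z}^{k+1})\le\left(\frac{2\tilde\lambda_t(\mathbf{z}^k)^2+4\tilde\lambda_t(\mathbf{z}^k)+3}{1-\tilde\lambda_t(\mathbf{z}^k)^2\big(2\tilde\lambda_t(\mathbf{z}^k)^2+4\tilde\lambda_t(\mathbf{z}^k)+3\big)}\right)\tilde\lambda_t(\mathbf{z}^k)^2.$$ For any $\beta\in(0,0.21027]$, the sequence $\{\mathbf{z}^k\}$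 generated by (DGN) starting from any $\mathbf{z}^0\in\Omega_t(\beta)$ belongs to $\Omega_t(\beta)$. (b) If $\beta\in(0,0.21027]$, then the sequence $\{\tilde\lambda_t(\mathbf{z}^k)\}$ generated by (DGN) starting from any $\mathbf{z}^0\in\mathcal{Q}_t(\beta)$ also converges quadratically to zero. (c) Let $\beta\in(0,0.21027]$, $\bar c:=\frac{2\beta^2+4\beta+3}{1-\beta^2(2\beta^2+4\beta+3)}$, let $\varepsilon>0$ be a given tolerance, and $\mathbf{z}^0\in\mathcal{Q}_t(\beta)$. If $t:=(1-2\epsilon^2)\big(\sqrt\nu(1+\epsilon)+\epsilon+3\epsilon^2\big)^{-1}\varepsilon$ for a sufficiently small $\epsilon\in(0,\beta)$, and $\delta_k:=(1+\beta_k)^{-1}\beta_k^2$ with $\beta_k:=\bar c^{\,2^k-1}\beta^{2^k}$, then after at most $k:=\mathcal{O}(\ln(\ln(1/\epsilon)))$ iterations, $\mathbf{z}^k$ is an $\varepsilon$-solution of $0\in\mathcal{A}(\mathbf{z})+\mathcal{N}_{\mathcal{Z}}(\mathbf{z})$.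
   Context: Setting. $\mathcal{Z}\subseteq\mathbb{R}^p$ is nonempty, closed, convex and equipped with a $\nu$-self-concordant barrier $F$; $\mathcal{A}:\mathbb{R}^p\rightrightarrows2^{\mathbb{R}^p}$ is maximally monotone, $\mathrm{int}(\mathcal{Z})\cap\mathrm{dom}(\mathcal{A})\ne\emptyset$, $\mathrm{dom}(\mathcal{A})$ is open or closed; the solution set of $0\in\mathcal{A}(\mathbf{z})+\mathcal{N}_{\mathcal{Z}}(\mathbf{z})$ is nonempty ($\mathcal{N}_{\mathcal{Z}}$ is the normal cone). It is also assumed throughout that for any nonzero $\boldsymbol\omega$ in the horizon cone of $\mathrm{int}(\mathcal{Z})\cap\mathrm{dom}(\mathcal{A})$ there are $\hat{\mathbf{z}}\in\mathrm{int}(\mathcal{Z})\cap\mathrm{dom}(\mathcal{A})$ and $\hat{\mathbf{a}}\in\mathcal{A}(\hat{\mathbf{z}})$ with $\langle\hat{\mathbf{a}},\boldsymbol\omega\rangle>0$, where the horizon cone of a convex set $C$ is the set of $\boldsymbol\omega$ with $\mathbf{z}+\tau\boldsymbol\omega\in\mathrm{cl}(C)$ for all $\mathbf{z}\in C$, $\tau>0$. Self-concordance. $F$ is standard self-concordant if each restriction $\varphi(\tau)=F(\mathbf{z}+\tau\mathbf{v})$ is $\mathcal{C}^3$, convex and satisfies $|\varphi'''|\le2(\varphi'')^{3/2}$; it is a $\nu$-self-concordant barrier for $\mathcal{Z}$ if in addition $\mathrm{dom}(F)=\mathrm{int}(\mathcal{Z})$, $\sup_{\mathbf{u}}\{2\langle\nabla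 F(\mathbf{z}),\mathbf{u}\rangle-\|\mathbf{u}\|_{\mathbf{z}}^2\}\le\nu$ for all $\mathbf{z}\in\mathrm{int}(\mathcal{Z})$, and $F(\mathbf{z})\to+\infty$ at the boundary of $\mathcal{Z}$. $\nabla^2F(\mathbf{z})\succ0$ on $\mathrm{int}(\mathcal{Z})$. Local norms: $\|\mathbf{u}\|_{\mathbf{z}}=\langle\nabla^2F(\mathbf{z})\mathbf{u},\mathbf{u}\rangle^{1/2}$, $\|\mathbf{v}\|^*_{\mathbf{z}}=\langle\nabla^2F(\mathbf{z})^{-1}\mathbf{v},\mathbf{v}\rangle^{1/2}$. $\mathrm{dist}_{\mathbf{z}}(\boldsymbol{0},S)=\min\{\|\mathbf{e}\|^*_{\mathbf{z}}\mid\mathbf{e}\in S\}$. Scaled resolvent: $\mathcal{P}_{\hat{\mathbf{z}}}(\cdot;t):=(\mathbb{I}+t^{-1}\nabla^2F(\hat{\mathbf{z}})^{-1}\mathcal{A})^{-1}(\cdot)$ for $\hat{\mathbf{z}}\in\mathrm{int}(\mathcal{Z})$, $t>0$ (single-valued, defined on $\mathbb{R}^p$). Generalized Newton decrement: $\lambda_t(\mathbf{z}):=\|\mathbf{z}-\mathcal{P}_{\mathbf{z}}(\mathbf{z}-\nabla^2F(\mathbf{z})^{-1}\nabla F(\mathbf{z});t)\|_{\mathbf{z}}$. Inexactness: for $\delta\in[0,1)$, $\mathbf{z}_+$ is a $\delta$-approximation (at $\mathbf{z}$ and $t$) to $\bar{\mathbf{z}}_+:=\mathcal{P}_{\mathbf{z}}(\mathbf{z}-\nabla^2F(\mathbf{z})^{-1}\nabla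 F(\mathbf{z});t)$, written $\mathbf{z}_+\approx\bar{\mathbf{z}}_+$, if $\mathrm{dist}_{\mathbf{z}}\big(\boldsymbol{0},\,t[\nabla F(\mathbf{z})+\nabla^2F(\mathbf{z})(\mathbf{z}_+-\mathbf{z})]+\mathcal{A}(\mathbf{z}_+)\big)\le t\delta$. Neighborhood: $\Omega_t(\beta):=\{\mathbf{z}\in\mathrm{int}(\mathcal{Z})\mid\lambda_t(\mathbf{z})\le\beta\}$. If, for a given method, every sequence started in $\Omega_t(\beta)$ stays in $\Omega_t(\beta)$ and the corresponding decrements converge quadratically to zero, then $\Omega_t(\beta)$ is called a quadratic convergence region of the method and denoted $\mathcal{Q}_t(\beta)$. A point $\tilde{\mathbf{z}}\in\mathrm{int}(\mathcal{Z})$ is an $\varepsilon$-solution of $0\in\mathcal{A}(\mathbf{z})+\mathcal{N}_{\mathcal{Z}}(\mathbf{z})$ if $\mathrm{dist}_{\tilde{\mathbf{z}}}(\boldsymbol{0},\mathcal{A}(\tilde{\mathbf{z}}))\le\varepsilon$.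
   Formalization: In (c) the ε-solution is the inexact Newton point z̃^k, not the damped iterate z^k (false for z^k, e.g. A=∂(10|x|) on [-1,1]); in (a) the displayed bound is claimed only when its denominator is positive (otherwise its right side is negative or undefined). *)

theory Defs
  imports "HOL-Analysis.Analysis" "HOL-Library.Landau_Symbols"
begin

definition gradient :: "(real^'n \<Rightarrow> real) \<Rightarrow> real^'n \<Rightarrow> real^'n" where
  "gradient F z = (THE g. GDERIV F z :> g)"

definition hessian :: "(real^'n \<Rightarrow> real) \<Rightarrow> real^'n \<Rightarrow> real^'n^'n" where
  "hessian F z = matrix (frechet_derivative (gradient F) (at z))"

definition positive_definite :: "real^'n^'n \<Rightarrow> bool" where
  "positive_definite M \<longleftrightarrow> transpose M = M \<and> (\<forall>u. u \<noteq> 0 \<longrightarrow> (M *v u) \<bullet> u > 0)"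

definition local_norm :: "(real^'n \<Rightarrow> real) \<Rightarrow> real^'n \<Rightarrow> real^'n \<Rightarrow> real" where
  "local_norm F z u = sqrt ((hessian F z *v u) \<bullet> u)"

definition dual_local_norm :: "(real^'n \<Rightarrow> real) \<Rightarrow> real^'n \<Rightarrow> real^'n \<Rightarrow> real" where
  "dual_local_norm F z v = sqrt ((matrix_inv (hessian F z) *v v) \<bullet> v)"

text \<open>The distance from the origin to \<open>S\<close> in the dual local norm at \<open>z\<close>. It is extended-real valued so
  that the distance to the empty set is infinite; on nonempty closed sets the infimum is a minimum.\<close>

definition local_dist :: "(real^'n \<Rightarrow> real) \<Rightarrow> real^'n \<Rightarrow> (real^'n) set \<Rightarrow> ereal" where
  "local_dist F z S = (INF e\<in>S. ereal (dual_local_norm F z e))"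

text \<open>A function with domain \<open>S\<close> is represented by a total real function whose values outside \<open>S\<close> are
  irrelevant. Below, \<open>S\<close> is open and convex.\<close>

definition standard_self_concordant_on :: "(real^'n) set \<Rightarrow> (real^'n \<Rightarrow> real) \<Rightarrow> bool" where
  "standard_self_concordant_on S F \<longleftrightarrow>
    (\<forall>z\<in>S. \<forall>v. let I = {\<tau>. z + \<tau> *\<^sub>R v \<in> S}; \<phi> = (\<lambda>\<tau>. F (z + \<tau> *\<^sub>R v)) in
       convex_on I \<phi> \<and>
       (\<exists>\<phi>1 \<phi>2 \<phi>3 :: real \<Rightarrow> real.
          (\<forall>\<tau>\<in>I. (\<phi> has_real_derivative \<phi>1 \<tau>) (at \<tau>)
                \<and> (\<phi>1 has_real_derivative \<phi>2 \<tau>) (at \<tau>)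
                \<and> (\<phi>2 has_real_derivative \<phi>3 \<tau>) (at \<tau>)
                \<and> \<bar>\<phi>3 \<tau>\<bar> \<le> 2 * \<phi>2 \<tau> powr (3/2))
          \<and> continuous_on I \<phi>3))"

definition self_concordant_barrier ::
  "(real^'n) set \<Rightarrow> real \<Rightarrow> (real^'n \<Rightarrow> real) \<Rightarrow> bool" where
  "self_concordant_barrier Z \<nu> F \<longleftrightarrow>
     standard_self_concordant_on (interior Z) F \<and>
     (\<forall>z\<in>interior Z. \<forall>u. 2 * (gradient F z \<bullet> u) - (local_norm F z u)\<^sup>2 \<le> \<nu>) \<and>
     (\<forall>x\<in>frontier Z. filterlim F at_top (at x within interior Z))"

definition monotone_operator :: "(real^'n \<Rightarrow> (real^'n) set) \<Rightarrow> bool" where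
  "monotone_operator A \<longleftrightarrow> (\<forall>x y. \<forall>a\<in>A x. \<forall>b\<in>A y. (a - b) \<bullet> (x - y) \<ge> 0)"

definition maximally_monotone :: "(real^'n \<Rightarrow> (real^'n) set) \<Rightarrow> bool" where
  "maximally_monotone A \<longleftrightarrow> monotone_operator A \<and>
     (\<forall>B. monotone_operator B \<and> (\<forall>x. A x \<subseteq> B x) \<longrightarrow> B = A)"

definition op_dom :: "(real^'n \<Rightarrow> (real^'n) set) \<Rightarrow> (real^'n) set" where
  "op_dom A = {x. A x \<noteq> {}}"

definition normal_cone :: "(real^'n) set \<Rightarrow> real^'n \<Rightarrow> (real^'n) set" where
  "normal_cone Z z = (if z \<in> Z then {w. \<forall>y\<in>Z. w \<bullet> (y - z) \<le> 0} else {})"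

definition inclusion_solutions ::
  "(real^'n) set \<Rightarrow> (real^'n \<Rightarrow> (real^'n) set) \<Rightarrow> (real^'n) set" where
  "inclusion_solutions Z A = {z. 0 \<in> {a + w | a w. a \<in> A z \<and> w \<in> normal_cone Z z}}"

definition horizon_cone :: "(real^'n) set \<Rightarrow> (real^'n) set" where
  "horizon_cone C = {\<omega>. \<forall>z\<in>C. \<forall>\<tau>>0. z + \<tau> *\<^sub>R \<omega> \<in> closure C}"

definition eps_solution ::
  "(real^'n) set \<Rightarrow> (real^'n \<Rightarrow> real) \<Rightarrow> (real^'n \<Rightarrow> (real^'n) set) \<Rightarrow> real \<Rightarrow> real^'n \<Rightarrow> bool" where
  "eps_solution Z F A \<epsilon> z \<longleftrightarrow> z \<in> interior Z \<and> local_dist F z (A z) \<le> ereal \<epsilon>"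

text \<open>The resolvent is the inverse of the relation \<open>w \<mapsto> w + t\<^sup>-\<^sup>1 \<nabla>\<^sup>2F(zh)\<^sup>-\<^sup>1 A(w)\<close>, which is
  single-valued and everywhere defined for maximally monotone \<open>A\<close>.\<close>

definition scaled_resolvent ::
  "(real^'n \<Rightarrow> real) \<Rightarrow> (real^'n \<Rightarrow> (real^'n) set) \<Rightarrow> real \<Rightarrow> real^'n \<Rightarrow> real^'n \<Rightarrow> real^'n" where
  "scaled_resolvent F A t zh x =
     (THE w. \<exists>a\<in>A w. x = w + (1 / t) *\<^sub>R (matrix_inv (hessian F zh) *v a))"

definition newton_point ::
  "(real^'n \<Rightarrow> real) \<Rightarrow> (real^'n \<Rightarrow> (real^'n) set) \<Rightarrow> real \<Rightarrow> real^'n \<Rightarrow> real^'n" where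
  "newton_point F A t z =
     scaled_resolvent F A t z (z - matrix_inv (hessian F z) *v gradient F z)"

definition newton_decrement ::
  "(real^'n \<Rightarrow> real) \<Rightarrow> (real^'n \<Rightarrow> (real^'n) set) \<Rightarrow> real \<Rightarrow> real^'n \<Rightarrow> real" where
  "newton_decrement F A t z = local_norm F z (z - newton_point F A t z)"

definition newton_neighborhood ::
  "(real^'n) set \<Rightarrow> (real^'n \<Rightarrow> real) \<Rightarrow> (real^'n \<Rightarrow> (real^'n) set) \<Rightarrow> real \<Rightarrow> real \<Rightarrow> (real^'n) set" where
  "newton_neighborhood Z F A t \<beta> = {z \<in> interior Z. newton_decrement F A t z \<le> \<beta>}"

text \<open>\<open>zp\<close> is a \<open>\<delta>\<close>-approximation, at \<open>z\<close> and \<open>t\<close>, to \<open>newton_point F A t z\<close>. The criterion is a residual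
  bound: the exact point is the one for which the set below contains the origin.\<close>

definition newton_approx ::
  "(real^'n \<Rightarrow> real) \<Rightarrow> (real^'n \<Rightarrow> (real^'n) set) \<Rightarrow> real \<Rightarrow> real \<Rightarrow> real^'n \<Rightarrow> real^'n \<Rightarrow> bool" where
  "newton_approx F A t \<delta> z zp \<longleftrightarrow> 0 \<le> \<delta> \<and> \<delta> < 1 \<and>
     local_dist F z {t *\<^sub>R (gradient F z + hessian F z *v (zp - z)) + a | a. a \<in> A zp}
       \<le> ereal (t * \<delta>)"

text \<open>\<open>zt (Suc k)\<close> is the inexact Newton point computed from \<open>z k\<close>; \<open>zt 0\<close> is never used.\<close>

definition inexact_decrement ::
  "(real^'n \<Rightarrow> real) \<Rightarrow> (nat \<Rightarrow> real^'n) \<Rightarrow> (nat \<Rightarrow> real^'n) \<Rightarrow> nat \<Rightarrow> real" where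
  "inexact_decrement F z zt k = local_norm F (z k) (zt (Suc k) - z k)"

definition dgn_sequence ::
  "(real^'n) set \<Rightarrow> (real^'n \<Rightarrow> real) \<Rightarrow> (real^'n \<Rightarrow> (real^'n) set) \<Rightarrow> real \<Rightarrow> (nat \<Rightarrow> real)
     \<Rightarrow> (nat \<Rightarrow> real^'n) \<Rightarrow> (nat \<Rightarrow> real^'n) \<Rightarrow> bool" where
  "dgn_sequence Z F A t \<delta> z zt \<longleftrightarrow> z 0 \<in> interior Z \<and>
     (\<forall>k. newton_approx F A t (\<delta> k) (z k) (zt (Suc k)) \<and>
          (let \<alpha> = 1 / (1 + inexact_decrement F z zt k)
           in z (Suc k) = (1 - \<alpha>) *\<^sub>R z k + \<alpha> *\<^sub>R zt (Suc k)))"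

definition adaptive_tolerance ::
  "(real^'n \<Rightarrow> real) \<Rightarrow> (nat \<Rightarrow> real) \<Rightarrow> (nat \<Rightarrow> real^'n) \<Rightarrow> (nat \<Rightarrow> real^'n) \<Rightarrow> bool" where
  "adaptive_tolerance F \<delta> z zt \<longleftrightarrow>
     (\<forall>k. \<delta> k \<le> (inexact_decrement F z zt k)\<^sup>2 / (1 + inexact_decrement F z zt k))"

definition converges_quadratically :: "(nat \<Rightarrow> real) \<Rightarrow> bool" where
  "converges_quadratically s \<longleftrightarrow> s \<longlonglongrightarrow> 0 \<and> (\<exists>C. \<forall>k. \<bar>s (Suc k)\<bar> \<le> C * (s k)\<^sup>2)"

text \<open>A method is given by the set \<open>M\<close> of the sequences it can generate; \<open>dec\<close> is the decrement.\<close>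

definition quadratic_convergence_region ::
  "(nat \<Rightarrow> real^'n) set \<Rightarrow> (real^'n \<Rightarrow> real) \<Rightarrow> (real^'n) set \<Rightarrow> bool" where
  "quadratic_convergence_region M dec \<Omega> \<longleftrightarrow>
     (\<forall>z\<in>M. z 0 \<in> \<Omega> \<longrightarrow> (\<forall>k. z k \<in> \<Omega>) \<and> converges_quadratically (\<lambda>k. dec (z k)))"

end

theory Submission
  imports Defs "HOL-Real_Asymp.Real_Asymp"
begin

text \<open>Everything follows from one estimate for a single damped step. Let the step start at \<open>z\<close>, with
  gradient \<open>g\<close> and Hessian \<open>H\<close> there, let \<open>z + d\<close> be the inexact Newton point and \<open>c\<close> its residual,
  so that \<open>t (c - g - H d) \<in> A (z + d)\<close>. Put \<open>l = \<parallel>d\<parallel>\<^sub>z\<close> and \<open>s = d / (1 + l)\<close>; the next iterate is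
  \<open>z\<^sub>+ = z + s\<close>, and its decrement is the norm of \<open>v = w - z\<^sub>+\<close>, where \<open>w\<close> is the exact Newton
  point of \<open>z\<^sub>+\<close>. Monotonicity of \<open>A\<close> between \<open>z + d\<close> and \<open>w\<close> says that
  \<open>\<langle>q + H\<^sub>+ v, l s - v\<rangle> \<ge> 0\<close> with \<open>q = c + (g\<^sub>+ - g - H s) - l H s\<close>. Hence \<open>v\<close> lies in the ball
  (in the metric \<open>H\<^sub>+\<close>) with diameter from \<open>l s\<close> to \<open>- H\<^sub>+\<^sup>-\<^sup>1 q\<close>. The step is short,
  \<open>\<parallel>s\<parallel>\<^sub>z = l / (1 + l) < 1\<close>, so \<open>H\<^sub>+\<close> lies between \<open>(1 - \<parallel>s\<parallel>\<^sub>z)\<^sup>2 H\<close> and \<open>H / (1 - \<parallel>s\<parallel>\<^sub>z)\<^sup>2\<close>,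
  and every term has a bound in \<open>l\<close> and in the tolerance \<open>\<delta>\<close>: the new decrement is at most
  \<open>l\<^sup>2 (2 + 2 l + l\<^sup>2) + (1 + l) \<delta>\<close> (\<open>damped_step\<close>). For \<open>\<delta> \<le> l\<^sup>2 / (1 + l)\<close> this is at most
  \<open>p = l\<^sup>2 (2 l\<^sup>2 + 4 l + 3)\<close>, and the inexact decrement, which exceeds the exact one by at most the next
  tolerance, is at most \<open>p / (1 - p)\<close> if \<open>p < 1\<close>.

  Invariance of the neighborhoods needs more, because they are defined by the exact decrement \<open>\<lambda>\<close>, while
  \<open>l\<close> can be as large as \<open>\<lambda> / (1 - \<lambda>)\<close>; for \<open>\<lambda> = 0.21027\<close> the bound above is then larger than \<open>\<lambda>\<close>.
  However, \<open>l\<close> can exceed \<open>\<lambda>\<close> by more than \<open>\<delta> / 2\<close> only if \<open>\<langle>c, d\<rangle> > 0\<close>, and then \<open>c\<close> and the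
  term \<open>- l H s\<close> of \<open>q\<close> partly cancel. Distinguishing the sign of \<open>\<langle>c, d\<rangle>\<close> and using the
  Pythagorean bound \<open>\<parallel>v\<parallel>\<^sup>2 \<le> \<parallel>l s\<parallel>\<^sup>2 + \<parallel>q\<parallel>\<^sup>2\<close> shows that from \<open>\<lambda> \<le> 0.21027\<close> the
  decrement shrinks at least by the factor \<open>0.9\<close> in each step (\<open>decrement_contraction\<close>), which gives invariance
  and convergence.

  Two ingredients carry this argument. The first is the comparison of Hessians (\<open>Hessian_comparison\<close>).
  Self-concordance bounds third derivatives only along lines, whereas the change of \<open>\<langle>H u, u\<rangle>\<close> in
  a direction \<open>w\<close> is a mixed third derivative, and no such derivative is known to exist. Two facts help.
  A symmetric trilinear form \<open>T\<close> satisfies \<open>T(u, u, w) = \<Sum> c\<^sub>j T(v\<^sub>j, v\<^sub>j, v\<^sub>j)\<close> with three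
  unit vectors \<open>v\<^sub>j\<close> and convex weights \<open>c\<^sub>j\<close>, for unit vectors \<open>u\<close> and \<open>w\<close> (\<open>trisection_nodes\<close>). And the
  integral of the Hessian form over a small parallelogram has derivatives which do form a symmetric
  trilinear form (\<open>edge_Lipschitz\<close>). Shrinking the parallelogram gives the sharp local Lipschitz constant
  of the Hessian form (\<open>form_local_Lipschitz\<close>), and integrating it along a segment gives the comparison.
  The second ingredient is the existence of the exact Newton point, which is Minty's theorem for the metric
  \<open>H\<close> (\<open>scaled_Minty\<close>); it follows from the intersection theorem for balls behind
  Kirszbraun's theorem and from compactness.

  In the last part the tolerances \<open>\<delta>\<^sub>k\<close> come from the fixed sequence \<open>\<beta>\<^sub>k\<close>. With \<open>y\<^sub>k = \<lambda>\<^sub>k + \<beta>\<^sub>k\<close>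
  the step estimate first gives geometric decay of \<open>y\<^sub>k\<close>, with a rate that depends on \<open>\<beta>\<close> only, and then
  \<open>10 y\<^sub>k\<^sub>+\<^sub>1 \<le> (10 y\<^sub>k)\<^sup>2\<close> (\<open>scheduled_decrements_vanish\<close>). So \<open>y\<^sub>k \<le> e / 10\<close> after
  \<open>O(ln (ln (1 / e)))\<close> steps, and then the element \<open>t (c - g - H d)\<close> of \<open>A (z + d)\<close> is short enough, because
  the dual norm of \<open>g\<close> is at most \<open>\<surd>\<nu>\<close>.\<close>

section \<open>The norms of a positive definite matrix\<close>

text \<open>The local norms depend on the point only through the Hessian. Norms of a fixed matrix make it possible
  to compare Hessians at different points without carrying the barrier along.\<close>

definition qnorm :: "real^'n^'n \<Rightarrow> real^'n \<Rightarrow> real" where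
  "qnorm M u = sqrt ((M *v u) \<bullet> u)"

definition dnorm :: "real^'n^'n \<Rightarrow> real^'n \<Rightarrow> real" where
  "dnorm M c = sqrt ((matrix_inv M *v c) \<bullet> c)"

lemma local_norm_qnorm: "local_norm F z = qnorm (hessian F z)"
  by (rule ext) (simp add: local_norm_def qnorm_def)

lemma dual_local_norm_dnorm: "dual_local_norm F z = dnorm (hessian F z)"
  by (rule ext) (simp add: dual_local_norm_def dnorm_def)

lemma symmetric_inner:
  fixes M :: "real^'n^'n"
  assumes "transpose M = M"
  shows "(M *v u) \<bullet> v = (M *v v) \<bullet> u"
  by (metis assms dot_lmul_matrix inner_commute transpose_matrix_vector)

lemma pd_sym: "positive_definite M \<Longrightarrow> (M *v u) \<bullet> v = (M *v v) \<bullet> u"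
  unfolding positive_definite_def by (blast intro: symmetric_inner)

lemma pd_nonneg: "positive_definite M \<Longrightarrow> 0 \<le> (M *v u) \<bullet> u"
  unfolding positive_definite_def by (cases "u = 0") (auto intro: less_imp_le)

lemma pd_pos: "positive_definite M \<Longrightarrow> u \<noteq> 0 \<Longrightarrow> 0 < (M *v u) \<bullet> u"
  unfolding positive_definite_def by blast

lemma qnorm_sq: "positive_definite M \<Longrightarrow> (qnorm M u)\<^sup>2 = (M *v u) \<bullet> u"
  by (simp add: qnorm_def pd_nonneg)

lemma qnorm_nonneg [simp]: "positive_definite M \<Longrightarrow> 0 \<le> qnorm M u"
  by (simp add: qnorm_def pd_nonneg)

lemma qnorm_pos: "positive_definite M \<Longrightarrow> u \<noteq> 0 \<Longrightarrow> 0 < qnorm M u"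
  by (simp add: qnorm_def pd_pos)

lemma qnorm_zero [simp]: "qnorm M 0 = 0"
  by (simp add: qnorm_def)

lemma qnorm_scaleR: "qnorm M (x *\<^sub>R u) = \<bar>x\<bar> * qnorm M u"
proof -
  have "(M *v (x *\<^sub>R u)) \<bullet> (x *\<^sub>R u) = x\<^sup>2 * ((M *v u) \<bullet> u)"
    by (simp add: power2_eq_square scalar_mult_eq_scaleR matrix_vector_mult_scaleR)
  then show ?thesis by (simp add: qnorm_def real_sqrt_mult)
qed

lemma qnorm_minus [simp]: "qnorm M (- u) = qnorm M u"
  using qnorm_scaleR[of M "-1" u] by simp

lemma qnorm_minus_commute: "qnorm M (u - v) = qnorm M (v - u)"
  using qnorm_minus[of M "u - v"] by simp

lemma form_add:
  fixes M :: "real^'n^'n"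
  assumes "transpose M = M"
  shows "(M *v (u + v)) \<bullet> (u + v) = (M *v u) \<bullet> u + 2 * ((M *v u) \<bullet> v) + (M *v v) \<bullet> v"
  using symmetric_inner[OF assms, of u v]
  by (simp add: matrix_vector_right_distrib inner_add_left inner_add_right)

text \<open>Polarization of \<open>D\<close> at \<open>u \<plusminus> w\<close> gives the bound with the arithmetic mean of
  \<open>\<parallel>u\<parallel>\<^sup>2\<close> and \<open>\<parallel>w\<parallel>\<^sup>2\<close>; rescaling both vectors to the same norm turns it into the product.
  For \<open>D = M\<close> this is the Cauchy-Schwarz inequality.\<close>

lemma form_bound_polarize:
  fixes D M :: "real^'n^'n"
  assumes M: "positive_definite M" and D: "transpose D = D"
    and b: "\<And>x. \<bar>(D *v x) \<bullet> x\<bar> \<le> \<kappa> * ((M *v x) \<bullet> x)"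
  shows "\<bar>(D *v u) \<bullet> w\<bar> \<le> \<kappa> * (qnorm M u * qnorm M w)"
proof (cases "u = 0 \<or> w = 0")
  case True then show ?thesis by auto
next
  case False
  define a b where "a = qnorm M u" and "b = qnorm M w"
  have ab: "a > 0" "b > 0" using False M by (auto simp: a_def b_def qnorm_pos)
  have M': "transpose M = M" using M by (simp add: positive_definite_def)
  define x y where "x = b *\<^sub>R u" and "y = a *\<^sub>R w"
  have par: "(N *v (x + y)) \<bullet> (x + y) - (N *v (x - y)) \<bullet> (x - y) = 4 * ((N *v x) \<bullet> y)"
       "(N *v (x + y)) \<bullet> (x + y) + (N *v (x - y)) \<bullet> (x - y)
          = 2 * ((N *v x) \<bullet> x) + 2 * ((N *v y) \<bullet> y)"
    if "transpose N = N" for N :: "real^'n^'n"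
    using symmetric_inner[OF that, of x y]
    by (simp_all add: algebra_simps inner_diff_right inner_diff_left matrix_vector_mult_diff_distrib
          matrix_vector_right_distrib inner_add_left inner_add_right)
  have xx: "(M *v x) \<bullet> x = a\<^sup>2 * b\<^sup>2" "(M *v y) \<bullet> y = a\<^sup>2 * b\<^sup>2"
    using qnorm_sq[OF M, of u] qnorm_sq[OF M, of w]
    by (simp_all add: x_def y_def matrix_vector_mult_scaleR power2_eq_square flip: a_def b_def)
  have "4 * \<bar>(D *v x) \<bullet> y\<bar> \<le> \<bar>(D *v (x + y)) \<bullet> (x + y)\<bar> + \<bar>(D *v (x - y)) \<bullet> (x - y)\<bar>"
    using par(1)[OF D] by linarith
  also have "\<dots> \<le> \<kappa> * ((M *v (x + y)) \<bullet> (x + y)) + \<kappa> * ((M *v (x - y)) \<bullet> (x - y))"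
    by (intro add_mono b)
  also have "\<dots> = \<kappa> * (4 * (a\<^sup>2 * b\<^sup>2))"
    using par(2)[OF M'] xx by (simp flip: distrib_left)
  finally have "\<bar>(D *v x) \<bullet> y\<bar> \<le> \<kappa> * (a\<^sup>2 * b\<^sup>2)" by simp
  moreover have "(D *v x) \<bullet> y = (a * b) * ((D *v u) \<bullet> w)"
    by (simp add: x_def y_def matrix_vector_mult_scaleR mult.commute)
  ultimately have "(a * b) * \<bar>(D *v u) \<bullet> w\<bar> \<le> (a * b) * (\<kappa> * (a * b))"
    using ab by (simp add: abs_mult power2_eq_square algebra_simps)
  then show ?thesis using ab by (simp add: a_def b_def)
qed

lemma qnorm_Cauchy_Schwarz:
  assumes "positive_definite M"
  shows "\<bar>(M *v u) \<bullet> w\<bar> \<le> qnorm M u * qnorm M w"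
  using form_bound_polarize[OF assms, of M 1 u w] assms pd_nonneg[OF assms]
  by (simp add: positive_definite_def)

lemma qnorm_sq_add:
  assumes "positive_definite M"
  shows "(qnorm M (u + v))\<^sup>2 = (qnorm M u)\<^sup>2 + 2 * ((M *v u) \<bullet> v) + (qnorm M v)\<^sup>2"
  using assms form_add[of M u v] by (simp add: qnorm_sq positive_definite_def)

lemma qnorm_sq_diff:
  assumes "positive_definite M"
  shows "(qnorm M (u - v))\<^sup>2 = (qnorm M u)\<^sup>2 - 2 * ((M *v u) \<bullet> v) + (qnorm M v)\<^sup>2"
  using qnorm_sq_add[OF assms, of u "- v"] by simp

lemma qnorm_triangle:
  assumes "positive_definite M"
  shows "qnorm M (u + v) \<le> qnorm M u + qnorm M v"
proof (rule power2_le_imp_le)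
  show "(qnorm M (u + v))\<^sup>2 \<le> (qnorm M u + qnorm M v)\<^sup>2"
    using qnorm_sq_add[OF assms, of u v] qnorm_Cauchy_Schwarz[OF assms, of u v]
    by (simp add: power2_sum)
qed (use assms in auto)

lemma qnorm_triangle_diff:
  assumes "positive_definite M"
  shows "qnorm M (u - v) \<le> qnorm M u + qnorm M v"
  using qnorm_triangle[OF assms, of u "- v"] by simp

lemma pd_inv:
  fixes M :: "real^'n^'n"
  assumes "positive_definite M"
  shows "M *v (matrix_inv M *v c) = c" "matrix_inv M *v (M *v c) = c"
proof -
  have "\<exists>B. B ** M = mat 1"
    unfolding matrix_left_invertible_ker
    using pd_pos[OF assms] by (metis inner_zero_left less_irrefl)
  then have "invertible M" by (simp add: invertible_left_inverse)
  then have "M ** matrix_inv M = mat 1 \<and> matrix_inv M ** M = mat 1"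
    unfolding matrix_inv_def invertible_def by (rule someI_ex)
  then show "M *v (matrix_inv M *v c) = c" "matrix_inv M *v (M *v c) = c"
    by (simp_all add: matrix_vector_mul_assoc)
qed

lemma dnorm_eq_qnorm: "positive_definite M \<Longrightarrow> dnorm M c = qnorm M (matrix_inv M *v c)"
  by (simp add: dnorm_def qnorm_def pd_inv inner_commute)

lemma dnorm_image: "positive_definite M \<Longrightarrow> dnorm M (M *v u) = qnorm M u"
  by (simp add: dnorm_eq_qnorm pd_inv)

lemma dnorm_nonneg [simp]: "positive_definite M \<Longrightarrow> 0 \<le> dnorm M c"
  by (simp add: dnorm_eq_qnorm)

lemma dnorm_triangle:
  "positive_definite M \<Longrightarrow> dnorm M (c + d) \<le> dnorm M c + dnorm M d"
  by (simp add: dnorm_eq_qnorm matrix_vector_right_distrib qnorm_triangle)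

lemma dnorm_triangle_diff:
  "positive_definite M \<Longrightarrow> dnorm M (c - d) \<le> dnorm M c + dnorm M d"
  by (simp add: dnorm_eq_qnorm matrix_vector_mult_diff_distrib qnorm_triangle_diff)

lemma dnorm_scaleR: "positive_definite M \<Longrightarrow> dnorm M (x *\<^sub>R c) = \<bar>x\<bar> * dnorm M c"
  by (simp add: dnorm_eq_qnorm matrix_vector_mult_scaleR qnorm_scaleR)

lemma inner_le_dnorm:
  assumes "positive_definite M"
  shows "\<bar>c \<bullet> w\<bar> \<le> dnorm M c * qnorm M w"
  using qnorm_Cauchy_Schwarz[OF assms, of "matrix_inv M *v c" w] assms
  by (simp add: dnorm_eq_qnorm pd_inv)

lemma dnorm_sq: "positive_definite M \<Longrightarrow> (dnorm M c)\<^sup>2 = c \<bullet> (matrix_inv M *v c)"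
  by (simp add: dnorm_eq_qnorm qnorm_sq pd_inv)

text \<open>The supremum that defines the dual norm is attained at \<open>M\<^sup>-\<^sup>1 c\<close>.\<close>

lemma dnorm_leI:
  assumes M: "positive_definite M" and "0 \<le> K"
    and b: "\<And>w. c \<bullet> w \<le> K * qnorm M w"
  shows "dnorm M c \<le> K"
proof (rule ccontr)
  assume "\<not> ?thesis"
  then have *: "K < dnorm M c" by simp
  have "dnorm M c * dnorm M c \<le> K * dnorm M c"
    using b[of "matrix_inv M *v c"] dnorm_sq[OF M, of c] M
    by (simp add: dnorm_eq_qnorm power2_eq_square)
  then show False using * \<open>0 \<le> K\<close> by (simp add: mult_le_cancel_right)
qed

lemma dnorm_compare:
  assumes M: "positive_definite M" and N: "positive_definite N" and k: "0 \<le> \<kappa>"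
    and le: "\<And>w. qnorm M w \<le> \<kappa> * qnorm N w"
  shows "dnorm N c \<le> \<kappa> * dnorm M c"
proof (rule dnorm_leI[OF N])
  show "0 \<le> \<kappa> * dnorm M c" using M k by simp
  fix w
  have "c \<bullet> w \<le> dnorm M c * qnorm M w" using inner_le_dnorm[OF M, of c w] by linarith
  also have "\<dots> \<le> dnorm M c * (\<kappa> * qnorm N w)" using M le by (intro mult_left_mono) auto
  finally show "c \<bullet> w \<le> \<kappa> * dnorm M c * qnorm N w" by (simp add: algebra_simps)
qed

section \<open>Solvability of the resolvent equation\<close>

lemma continuous_on_qnorm: "continuous_on S (\<lambda>x. qnorm M (x - c))"
proof -
  have "continuous_on S (\<lambda>x. M *v (x - c))"
    by (rule continuous_on_compose2[OF matrix_vector_mult_linear_continuous_on[of UNIV]])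
       (auto intro!: continuous_intros)
  then show ?thesis unfolding qnorm_def by (intro continuous_intros)
qed

lemma qnorm_ge_norm:
  fixes M :: "real^'n^'n"
  assumes M: "positive_definite M"
  obtains m where "m > 0" "\<And>x. m * norm x \<le> qnorm M x"
proof -
  have "\<exists>y\<in>sphere (0::real^'n) 1. \<forall>x\<in>sphere 0 1. qnorm M y \<le> qnorm M x"
    using continuous_on_qnorm[of "sphere 0 1" M 0] by (intro continuous_attains_inf) auto
  then obtain y where y: "norm y = 1" "\<And>x. norm x = 1 \<Longrightarrow> qnorm M y \<le> qnorm M x" by auto
  show ?thesis
  proof
    show "0 < qnorm M y" using y(1) by (intro qnorm_pos[OF M]) auto
    fix x
    show "qnorm M y * norm x \<le> qnorm M x"
    proof (cases "x = 0")
      case False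
      have "qnorm M y \<le> qnorm M ((1 / norm x) *\<^sub>R x)" using False by (intro y(2)) auto
      then show ?thesis using False by (simp add: qnorm_scaleR field_simps)
    qed simp
  qed
qed

lemma qnorm_ball_compact:
  fixes M :: "real^'n^'n"
  assumes M: "positive_definite M"
  shows "compact {x. qnorm M (x - c) \<le> R}"
proof -
  obtain m where m: "m > 0" "\<And>x. m * norm x \<le> qnorm M x" using qnorm_ge_norm[OF M] by blast
  have "closed {x. qnorm M (x - c) \<le> R}"
    by (intro closed_Collect_le continuous_on_qnorm continuous_on_const)
  moreover have "bounded {x. qnorm M (x - c) \<le> R}"
  proof (rule boundedI)
    fix x assume "x \<in> {x. qnorm M (x - c) \<le> R}"
    then have "m * norm (x - c) \<le> R" using m(2)[of "x - c"] by simp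
    then have "norm (x - c) \<le> R / m" using m(1) by (simp add: field_simps)
    then show "norm x \<le> R / m + norm c" using norm_triangle_sub[of x c] by simp
  qed
  ultimately show ?thesis by (simp add: compact_eq_bounded_closed)
qed

text \<open>The variance identity: it expresses the mean squared distance between two independent samples by the
  second moment and the mean.\<close>

lemma weighted_pair_distances:
  fixes M :: "real^'n^'n" and d :: "'i \<Rightarrow> real^'n"
  assumes M: "positive_definite M" and l: "sum l I = 1"
  shows "(\<Sum>i\<in>I. \<Sum>j\<in>I. l i * l j * (qnorm M (d i - d j))\<^sup>2)
           = 2 * (\<Sum>i\<in>I. l i * (qnorm M (d i))\<^sup>2) - 2 * (qnorm M (\<Sum>i\<in>I. l i *\<^sub>R d i))\<^sup>2"
proof -
  have a: "(\<Sum>i\<in>I. \<Sum>j\<in>I. l i * l j * f i) = (\<Sum>i\<in>I. l i * f i)" for f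
  proof -
    have "(\<Sum>i\<in>I. \<Sum>j\<in>I. l i * l j * f i) = (\<Sum>i\<in>I. l i * f i * (\<Sum>j\<in>I. l j))"
      by (simp add: sum_distrib_left algebra_simps)
    then show ?thesis by (simp add: l)
  qed
  have b: "(\<Sum>i\<in>I. \<Sum>j\<in>I. l i * l j * f j) = (\<Sum>i\<in>I. l i * f i)" for f
    by (subst sum.swap) (use a[of f] in \<open>simp add: mult.commute mult.left_commute\<close>)
  have c: "(\<Sum>i\<in>I. \<Sum>j\<in>I. l i * l j * ((M *v d i) \<bullet> d j)) = (qnorm M (\<Sum>i\<in>I. l i *\<^sub>R d i))\<^sup>2"
    by (simp add: qnorm_sq[OF M] linear_sum[OF matrix_vector_mul_linear] inner_sum_left inner_sum_right
        matrix_vector_mult_scaleR sum_distrib_left mult.assoc)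
       (intro sum.cong refl, simp add: pd_sym[OF M])
  have "(\<Sum>i\<in>I. \<Sum>j\<in>I. l i * l j * (qnorm M (d i - d j))\<^sup>2)
      = (\<Sum>i\<in>I. \<Sum>j\<in>I. l i * l j * (qnorm M (d i))\<^sup>2 + l i * l j * (qnorm M (d j))\<^sup>2
            - 2 * (l i * l j * ((M *v d i) \<bullet> d j)))"
    by (intro sum.cong refl) (simp add: qnorm_sq_diff[OF M] algebra_simps)
  also have "\<dots> = (\<Sum>i\<in>I. l i * (qnorm M (d i))\<^sup>2) + (\<Sum>i\<in>I. l i * (qnorm M (d i))\<^sup>2)
            - 2 * (qnorm M (\<Sum>i\<in>I. l i *\<^sub>R d i))\<^sup>2"
    by (simp add: sum_subtractf sum.distrib a b c flip: sum_distrib_left)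
  finally show ?thesis by simp
qed

lemma continuous_on_Max_finite:
  fixes g :: "'i \<Rightarrow> 'a::topological_space \<Rightarrow> real"
  assumes "finite I" "I \<noteq> {}" "\<And>i. i \<in> I \<Longrightarrow> continuous_on S (g i)"
  shows "continuous_on S (\<lambda>x. Max ((\<lambda>i. g i x) ` I))"
  using assms
proof (induction I rule: finite_ne_induct)
  case (insert i I)
  have "(\<lambda>x. Max ((\<lambda>i. g i x) ` insert i I)) = (\<lambda>x. max (g i x) (Max ((\<lambda>i. g i x) ` I)))"
    using insert.hyps by (intro ext) simp
  then show ?case using insert by (auto intro!: continuous_on_max)
qed auto

text \<open>The intersection property of balls behind Kirszbraun's theorem: replacing centres \<open>p\<close> of balls through
  the origin by centres \<open>c\<close> that are closer together keeps a common point. A point \<open>x\<close> that minimizes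
  the largest value \<open>f(x)\<close> of \<open>\<parallel>x - c\<parallel>\<^sup>2 - \<parallel>p\<parallel>\<^sup>2\<close> has \<open>0\<close> in the convex hull of the differences
  \<open>x - c\<close> over the active balls, since otherwise a small step would decrease the maximum. With the weights of that
  convex combination, the mean squared distance of the active \<open>c\<close> is twice the mean of
  \<open>\<parallel>p\<parallel>\<^sup>2 + f(x)\<close>, and that of the \<open>p\<close> is at most twice the mean of \<open>\<parallel>p\<parallel>\<^sup>2\<close>; so \<open>f(x) \<le> 0\<close>.\<close>

lemma finite_balls_intersect:
  fixes M :: "real^'n^'n" and G :: "((real^'n) \<times> (real^'n)) set"
  assumes M: "positive_definite M" and fin: "finite G"
    and mono: "\<And>c p c' p'. (c, p) \<in> G \<Longrightarrow> (c', p') \<in> G \<Longrightarrow> qnorm M (c - c') \<le> qnorm M (p - p')"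
  shows "\<exists>x. \<forall>(c, p)\<in>G. qnorm M (x - c) \<le> qnorm M p"
proof (cases "G = {}")
  case False
  define g where "g i x = (qnorm M (x - fst i))\<^sup>2 - (qnorm M (snd i))\<^sup>2"
    for i :: "(real^'n) \<times> (real^'n)" and x
  define f where "f x = Max ((\<lambda>i. g i x) ` G)" for x
  have gcont: "continuous_on UNIV (g i)" for i
    unfolding g_def by (intro continuous_intros continuous_on_qnorm)
  have fcont: "continuous_on UNIV f"
    unfolding f_def by (rule continuous_on_Max_finite[OF fin False gcont])
  have gf: "g i x \<le> f x" if "i \<in> G" for i x
    unfolding f_def using fin that by auto
  obtain i0 where i0: "i0 \<in> G" using False by blast
  define R where "R = sqrt (\<bar>f 0\<bar> + (qnorm M (snd i0))\<^sup>2)"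
  have inR: "qnorm M (x - fst i0) \<le> R" if "f x \<le> f 0" for x
  proof -
    have "(qnorm M (x - fst i0))\<^sup>2 \<le> \<bar>f 0\<bar> + (qnorm M (snd i0))\<^sup>2"
      using gf[OF i0, of x] that by (simp add: g_def)
    then show ?thesis unfolding R_def by (rule real_le_rsqrt)
  qed
  have "\<exists>x\<in>{x. qnorm M (x - fst i0) \<le> R}. \<forall>y\<in>{x. qnorm M (x - fst i0) \<le> R}. f x \<le> f y"
    using inR[of 0] by (intro continuous_attains_inf qnorm_ball_compact[OF M])
       (auto intro: continuous_on_subset[OF fcont] exI[of _ 0])
  then obtain x where x: "qnorm M (x - fst i0) \<le> R"
    and xmin': "\<And>y. qnorm M (y - fst i0) \<le> R \<Longrightarrow> f x \<le> f y" by auto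
  have xmin: "f x \<le> f y" for y
  proof (cases "f y \<le> f 0")
    case False
    then show ?thesis using xmin'[OF inR[of 0]] by simp
  qed (auto intro: xmin' inR)
  define Act where "Act = {i \<in> G. g i x = f x}"
  have "0 \<in> convex hull ((\<lambda>i. x - fst i) ` Act)"
  proof (rule ccontr)
    assume "\<not> ?thesis"
    moreover have "finite ((\<lambda>i. x - fst i) ` Act)" using fin by (simp add: Act_def)
    ultimately obtain a b where ab: "b > 0" "\<And>y. y \<in> convex hull ((\<lambda>i. x - fst i) ` Act) \<Longrightarrow> a \<bullet> y > b"
      using separating_hyperplane_closed_0[OF convex_convex_hull, of "(\<lambda>i. x - fst i) ` Act"]
      by (metis compact_imp_closed finite_imp_compact_convex_hull)
    \<comment> \<open>a step along \<open>- d\<close> decreases every active term, because \<open>\<langle>M d, x - c\<rangle> = \<langle>a, x - c\<rangle> > b\<close>\<close>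
    define d where "d = matrix_inv M *v a"
    have gline: "g i (x - t *\<^sub>R d) = g i x - t * (2 * (a \<bullet> (x - fst i)) - t * (qnorm M d)\<^sup>2)" for i t
    proof -
      have "x - t *\<^sub>R d - fst i = (x - fst i) - t *\<^sub>R d" by simp
      moreover have "(M *v (x - fst i)) \<bullet> d = a \<bullet> (x - fst i)"
        using pd_sym[OF M, of "x - fst i" d] pd_inv[OF M] by (simp add: d_def)
      ultimately show ?thesis
        by (simp only: g_def qnorm_sq_diff[OF M] qnorm_scaleR inner_scaleR_right)
           (simp add: power2_eq_square algebra_simps)
    qed
    have "\<forall>\<^sub>F t in at_right 0. g i (x - t *\<^sub>R d) < f x" if i: "i \<in> G" for i
    proof (cases "i \<in> Act")
      case True
      then have "a \<bullet> (x - fst i) > b" by (intro ab(2) hull_inc) auto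
      then have "((\<lambda>t. 2 * (a \<bullet> (x - fst i)) - t * (qnorm M d)\<^sup>2) \<longlongrightarrow> 2 * (a \<bullet> (x - fst i)) - 0 * (qnorm M d)\<^sup>2)
          (at_right 0)" "2 * (a \<bullet> (x - fst i)) - 0 * (qnorm M d)\<^sup>2 > 0"
        using ab(1) by (intro tendsto_intros, simp)
      then have "\<forall>\<^sub>F t in at_right 0. 2 * (a \<bullet> (x - fst i)) - t * (qnorm M d)\<^sup>2 > 0"
        by (rule order_tendstoD(1))
      moreover have "\<forall>\<^sub>F t in at_right 0. (t::real) > 0" by (rule eventually_at_right_less)
      ultimately show ?thesis
        by eventually_elim (use True in \<open>simp add: gline Act_def\<close>)
    next
      case False
      then have "g i x < f x" using gf[OF i, of x] i by (force simp: Act_def)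
      moreover have "((\<lambda>t. g i x - t * (2 * (a \<bullet> (x - fst i)) - t * (qnorm M d)\<^sup>2)) \<longlongrightarrow>
          g i x - 0 * (2 * (a \<bullet> (x - fst i)) - 0 * (qnorm M d)\<^sup>2)) (at_right 0)"
        by (intro tendsto_intros)
      ultimately show ?thesis unfolding gline by (intro order_tendstoD(2)) auto
    qed
    then have "\<forall>\<^sub>F t in at_right 0. \<forall>i\<in>G. g i (x - t *\<^sub>R d) < f x"
      using fin by (simp add: eventually_ball_finite)
    then obtain t where "\<forall>i\<in>G. g i (x - t *\<^sub>R d) < f x"
      using eventually_happens[of _ "at_right (0::real)"] by auto
    then have "f (x - t *\<^sub>R d) < f x" unfolding f_def[of "x - t *\<^sub>R d"]
      using fin False by (subst Max_less_iff) auto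
    then show False using xmin[of "x - t *\<^sub>R d"] by simp
  qed
  then obtain k l X where l: "\<forall>i\<in>{1::nat..k}. 0 \<le> l i \<and> X i \<in> (\<lambda>i. x - fst i) ` Act"
      "sum l {1..k} = 1" "(\<Sum>i = 1..k. l i *\<^sub>R X i) = 0"
    unfolding convex_hull_indexed by auto
  then have "\<forall>i\<in>{1..k}. \<exists>q. q \<in> Act \<and> X i = x - fst q" by blast
  then obtain q where q: "\<And>i. i \<in> {1..k} \<Longrightarrow> q i \<in> Act \<and> X i = x - fst (q i)" by metis
  let ?I = "{1..k}"
  have act: "(qnorm M (X i))\<^sup>2 = (qnorm M (snd (q i)))\<^sup>2 + f x" if "i \<in> ?I" for i
    using q[OF that] by (auto simp: Act_def g_def)
  have "(\<Sum>i\<in>?I. \<Sum>j\<in>?I. l i * l j * (qnorm M (X i - X j))\<^sup>2)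
     \<le> (\<Sum>i\<in>?I. \<Sum>j\<in>?I. l i * l j * (qnorm M (snd (q i) - snd (q j)))\<^sup>2)"
  proof (intro sum_mono mult_left_mono power_mono)
    fix i j assume ij: "i \<in> ?I" "j \<in> ?I"
    have "qnorm M (fst (q j) - fst (q i)) \<le> qnorm M (snd (q j) - snd (q i))"
      using q[OF ij(1)] q[OF ij(2)] by (intro mono) (auto simp: Act_def)
    then show "qnorm M (X i - X j) \<le> qnorm M (snd (q i) - snd (q j))"
      using q[OF ij(1)] q[OF ij(2)] by (simp add: qnorm_minus_commute)
    show "0 \<le> l i * l j" using l(1) ij by auto
  qed (use M in auto)
  then have "2 * (\<Sum>i\<in>?I. l i * (qnorm M (X i))\<^sup>2)
      \<le> 2 * (\<Sum>i\<in>?I. l i * (qnorm M (snd (q i)))\<^sup>2)"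
    unfolding weighted_pair_distances[OF M l(2)] l(3)
    using zero_le_power2[of "qnorm M (\<Sum>i = 1..k. l i *\<^sub>R snd (q i))"]
    unfolding qnorm_zero zero_power2 mult_zero_right diff_zero by linarith
  moreover have "(\<Sum>i\<in>?I. l i * (qnorm M (X i))\<^sup>2)
      = (\<Sum>i\<in>?I. l i * (qnorm M (snd (q i)))\<^sup>2 + l i * f x)"
    by (intro sum.cong refl) (simp add: act distrib_left)
  moreover have "\<dots> = (\<Sum>i\<in>?I. l i * (qnorm M (snd (q i)))\<^sup>2) + f x"
    using l(2) by (simp add: sum.distrib flip: sum_distrib_right)
  ultimately have "f x \<le> 0" by simp
  then have "\<forall>i\<in>G. g i x \<le> 0" using gf by (meson order_trans)
  then have "\<forall>i\<in>G. qnorm M (x - fst i) \<le> qnorm M (snd i)"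
    using M by (auto simp: g_def intro: power2_le_imp_le)
  then show ?thesis by (intro exI[of _ x]) auto
qed auto

text \<open>A pair that is monotonically related to the whole graph can be added to it, so by maximality it
  is already there.\<close>

lemma maximally_monotone_mem:
  assumes A: "maximally_monotone A" and rel: "\<And>y b. b \<in> A y \<Longrightarrow> (a - b) \<bullet> (x - y) \<ge> 0"
  shows "a \<in> A x"
proof -
  define B where "B y = (if y = x then insert a (A y) else A y)" for y
  have mA: "(b - c) \<bullet> (y - z) \<ge> 0" if "b \<in> A y" "c \<in> A z" for b c y z
    using A that unfolding maximally_monotone_def monotone_operator_def by blast
  have rel': "(b - a) \<bullet> (y - x) \<ge> 0" if "b \<in> A y" for y b
    using rel[OF that] by (metis inner_minus_left inner_minus_right minus_diff_eq minus_minus)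
  have "monotone_operator B"
    unfolding monotone_operator_def B_def using mA rel rel' by (auto split: if_splits)
  moreover have "\<forall>y. A y \<subseteq> B y" by (auto simp: B_def)
  ultimately have "B = A" using A unfolding maximally_monotone_def by blast
  then show ?thesis by (metis B_def insertI1)
qed

lemma maximally_monotone_closed:
  assumes A: "maximally_monotone A"
  shows "closed (A x)"
proof -
  have mA: "(b - c) \<bullet> (y - z) \<ge> 0" if "b \<in> A y" "c \<in> A z" for b c y z
    using A that unfolding maximally_monotone_def monotone_operator_def by blast
  have "A x = (\<Inter>y. \<Inter>b\<in>A y. {a. (a - b) \<bullet> (x - y) \<ge> 0})"
    by (intro equalityI subsetI) (auto intro: mA maximally_monotone_mem[OF A])
  also have "closed \<dots>"
    by (intro closed_INT ballI closed_Collect_le continuous_intros)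
  finally show ?thesis .
qed

text \<open>A solution \<open>w\<close> is a point for which \<open>(w, y - M w)\<close> is monotonically related to every pair \<open>(\<xi>, \<alpha>)\<close>
  of the graph. For one pair the points \<open>w\<close> with this property form a ball whose diameter joins \<open>\<xi>\<close> and
  \<open>M\<^sup>-\<^sup>1 (y - \<alpha>)\<close>. Monotonicity of \<open>A\<close> is the hypothesis of the intersection theorem for these balls,
  and compactness passes from finitely many pairs to all of them.\<close>

lemma scaled_Minty:
  fixes M :: "real^'n^'n"
  assumes A: "maximally_monotone A" and M: "positive_definite M"
  shows "\<exists>w. y - M *v w \<in> A w"
proof -
  define c where "c \<xi> \<alpha> = (1/2) *\<^sub>R (\<xi> - matrix_inv M *v (\<alpha> - y))" for \<xi> \<alpha>
  define p where "p \<xi> \<alpha> = (1/2) *\<^sub>R (\<xi> + matrix_inv M *v (\<alpha> - y))" for \<xi> \<alpha>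
  define ball where "ball \<xi> \<alpha> = {x. qnorm M (x - c \<xi> \<alpha>) \<le> qnorm M (p \<xi> \<alpha>)}" for \<xi> \<alpha>
  have mA: "(b - c) \<bullet> (y - z) \<ge> 0" if "b \<in> A y" "c \<in> A z" for b c y z
    using A that unfolding maximally_monotone_def monotone_operator_def by blast
  have prod: "(M *v u) \<bullet> v = (qnorm M ((1/2) *\<^sub>R (u + v)))\<^sup>2 - (qnorm M ((1/2) *\<^sub>R (u - v)))\<^sup>2" for u v
    unfolding qnorm_scaleR power_mult_distrib qnorm_sq_add[OF M] qnorm_sq_diff[OF M]
    by (simp add: power2_eq_square field_simps)
  let ?G = "{(\<xi>, \<alpha>). \<alpha> \<in> A \<xi>}"
  have ballI: "(\<alpha> - (y - M *v x)) \<bullet> (\<xi> - x) \<ge> 0" if "x \<in> ball \<xi> \<alpha>" for x \<xi> \<alpha>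
  proof -
    let ?u = "matrix_inv M *v (\<alpha> - y) + x" and ?v = "\<xi> - x"
    have "(\<alpha> - (y - M *v x)) \<bullet> (\<xi> - x) = (M *v ?u) \<bullet> ?v"
      by (simp add: matrix_vector_right_distrib pd_inv[OF M] algebra_simps)
    also have "\<dots> = (qnorm M (p \<xi> \<alpha>))\<^sup>2 - (qnorm M (x - c \<xi> \<alpha>))\<^sup>2"
    proof -
      have "(1/2) *\<^sub>R (?u + ?v) = p \<xi> \<alpha>" by (simp add: p_def algebra_simps)
      moreover have "(1/2) *\<^sub>R (?u - ?v) = x - c \<xi> \<alpha>"
        by (simp add: c_def vec_eq_iff field_simps)
      ultimately show ?thesis using prod[of ?u ?v] by simp
    qed
    also have "\<dots> \<ge> 0" using that M by (auto simp: ball_def intro: power_mono)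
    finally show ?thesis .
  qed
  have fip: "\<exists>x. \<forall>(\<xi>, \<alpha>)\<in>H. x \<in> ball \<xi> \<alpha>" if finH: "finite H" and subH: "H \<subseteq> ?G" for H
  proof -
    have "\<exists>x. \<forall>(c', p')\<in>(\<lambda>(\<xi>, \<alpha>). (c \<xi> \<alpha>, p \<xi> \<alpha>)) ` H. qnorm M (x - c') \<le> qnorm M p'"
    proof (rule finite_balls_intersect[OF M])
      fix c1 p1 c2 p2
      assume "(c1, p1) \<in> (\<lambda>(\<xi>, \<alpha>). (c \<xi> \<alpha>, p \<xi> \<alpha>)) ` H" "(c2, p2) \<in> (\<lambda>(\<xi>, \<alpha>). (c \<xi> \<alpha>, p \<xi> \<alpha>)) ` H"
      then obtain x1 a1 x2 a2 where e: "a1 \<in> A x1" "a2 \<in> A x2" "c1 = c x1 a1" "c2 = c x2 a2"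
          "p1 = p x1 a1" "p2 = p x2 a2" using subsetD[OF subH]
          by (auto; metis (no_types, lifting) case_prodD mem_Collect_eq)
      let ?u = "matrix_inv M *v (a1 - a2)" and ?v = "x1 - x2"
      have "0 \<le> (M *v ?u) \<bullet> ?v" using mA[OF e(1,2)] pd_inv[OF M] by simp
      also have "\<dots> = (qnorm M (p1 - p2))\<^sup>2 - (qnorm M (c2 - c1))\<^sup>2"
      proof -
        have "(1/2) *\<^sub>R (?u + ?v) = p1 - p2"
          unfolding e p_def by (simp add: algebra_simps matrix_vector_mult_diff_distrib)
        moreover have "(1/2) *\<^sub>R (?u - ?v) = c2 - c1"
          unfolding e c_def by (simp add: algebra_simps matrix_vector_mult_diff_distrib)
        ultimately show ?thesis using prod[of ?u ?v] by simp
      qed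
      finally have "(qnorm M (c2 - c1))\<^sup>2 \<le> (qnorm M (p1 - p2))\<^sup>2" by simp
      then show "qnorm M (c1 - c2) \<le> qnorm M (p1 - p2)"
        unfolding qnorm_minus_commute[of M c1 c2] by (rule power2_le_imp_le[OF _ qnorm_nonneg[OF M]])
    qed (use finH in auto)
    then show ?thesis by (auto simp: ball_def)
  qed
  have "\<exists>x. \<forall>(\<xi>, \<alpha>)\<in>?G. x \<in> ball \<xi> \<alpha>"
  proof (cases "?G = {}")
    case False
    then obtain x0 a0 where x0: "a0 \<in> A x0" by auto
    have "ball x0 a0 \<inter> (\<Inter>(\<xi>, \<alpha>)\<in>?G. ball \<xi> \<alpha>) \<noteq> {}"
    proof (rule compact_imp_fip_image)
      show "compact (ball x0 a0)" unfolding ball_def by (rule qnorm_ball_compact[OF M])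
      show "closed (case i of (\<xi>, \<alpha>) \<Rightarrow> ball \<xi> \<alpha>)" if "i \<in> ?G" for i
        by (cases i) (simp add: ball_def qnorm_ball_compact[OF M] compact_imp_closed)
      fix H assume "finite H" "H \<subseteq> ?G"
      then have "\<exists>x. \<forall>(\<xi>, \<alpha>)\<in>insert (x0, a0) H. x \<in> ball \<xi> \<alpha>" using x0 by (intro fip) auto
      then show "ball x0 a0 \<inter> (\<Inter>i\<in>H. case i of (\<xi>, \<alpha>) \<Rightarrow> ball \<xi> \<alpha>) \<noteq> {}" by fastforce
    qed
    then show ?thesis by blast
  qed auto
  then obtain x where x: "\<And>\<xi> \<alpha>. \<alpha> \<in> A \<xi> \<Longrightarrow> x \<in> ball \<xi> \<alpha>" by auto
  have "y - M *v x \<in> A x"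
  proof (rule maximally_monotone_mem[OF A])
    fix \<xi> \<alpha> assume "\<alpha> \<in> A \<xi>"
    then have "(\<alpha> - (y - M *v x)) \<bullet> (\<xi> - x) \<ge> 0" by (intro ballI x)
    then show "((y - M *v x) - \<alpha>) \<bullet> (x - \<xi>) \<ge> 0"
      by (metis inner_minus_left inner_minus_right minus_diff_eq minus_minus)
  qed
  then show ?thesis by blast
qed

section \<open>Self-concordance along lines\<close>

lemma convex_line_preimage:
  fixes S :: "'a::real_vector set"
  assumes "convex S"
  shows "convex {\<tau>. x + \<tau> *\<^sub>R v \<in> S}"
proof -
  have "{\<tau>. x + \<tau> *\<^sub>R v \<in> S} = (\<lambda>\<tau>. \<tau> *\<^sub>R v) -` ((\<lambda>y. y - x) ` S)"
    by (auto simp: image_iff algebra_simps intro!: bexI[of _ "x + _"])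
  moreover have "convex \<dots>"
    by (intro convex_linear_vimage) (auto intro!: linearI convex_translation_subtract assms simp: scaleR_add_left)
  ultimately show ?thesis by simp
qed

lemma has_derivative_along_line:
  assumes "(f has_derivative f') (at (x + \<tau> *\<^sub>R v))"
  shows "((\<lambda>\<tau>. f (x + \<tau> *\<^sub>R v)) has_real_derivative f' v) (at \<tau> within T)"
proof -
  have "((\<lambda>\<tau>. x + \<tau> *\<^sub>R v) has_derivative (\<lambda>h. h *\<^sub>R v)) (at \<tau> within T)"
    by (auto intro!: derivative_eq_intros)
  from has_derivative_compose[OF this assms]
  show ?thesis unfolding has_field_derivative_def
    by (rule has_derivative_eq_rhs)
       (simp add: fun_eq_iff linear_scale[OF has_derivative_linear[OF assms]])
qed

text \<open>The part of a self-concordant barrier that the proof works with, on its open convex domain. The third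
  derivative is required only in the direction of the line on which it is taken, as in the definition of
  self-concordance; mixed third derivatives need not be given.\<close>

locale self_concordant =
  fixes S :: "(real^'n) set" and F :: "real^'n \<Rightarrow> real"
    and g :: "real^'n \<Rightarrow> real^'n" and H :: "real^'n \<Rightarrow> real^'n^'n"
  assumes open_S: "open S" and convex_S: "convex S"
    and F_deriv: "x \<in> S \<Longrightarrow> (F has_derivative (\<lambda>h. g x \<bullet> h)) (at x)"
    and g_deriv: "x \<in> S \<Longrightarrow> (g has_derivative (\<lambda>h. H x *v h)) (at x)"
    and H_pd: "x \<in> S \<Longrightarrow> positive_definite (H x)"
    and third: "x \<in> S \<Longrightarrow> \<exists>T. ((\<lambda>\<tau>. (H (x + \<tau> *\<^sub>R v) *v v) \<bullet> v) has_real_derivative T) (at 0)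
                  \<and> \<bar>T\<bar> \<le> 2 * qnorm (H x) v ^ 3"
    and barrier_S: "x \<in> closure S \<Longrightarrow> x \<notin> S \<Longrightarrow> filterlim F at_top (at x within S)"
begin

lemma line_convex: "convex {\<tau>. x + \<tau> *\<^sub>R v \<in> S}"
  by (rule convex_line_preimage[OF convex_S])

lemma line_in_S:
  assumes "x \<in> S" "x + \<tau> *\<^sub>R v \<in> S" "0 \<le> \<sigma>" "\<sigma> \<le> \<tau>"
  shows "x + \<sigma> *\<^sub>R v \<in> S"
proof -
  have "{0..\<tau>} \<subseteq> {\<tau>. x + \<tau> *\<^sub>R v \<in> S}"
    using line_convex[of x v] assms atMostAtLeast_subset_convex[of _ 0 \<tau>]
    by (cases "\<tau> = 0") auto
  then show ?thesis using assms(3,4) by auto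
qed

lemma line_F_deriv:
  assumes "x + \<tau> *\<^sub>R v \<in> S"
  shows "((\<lambda>\<tau>. F (x + \<tau> *\<^sub>R v)) has_real_derivative g (x + \<tau> *\<^sub>R v) \<bullet> v) (at \<tau> within T)"
  by (rule has_derivative_along_line[OF F_deriv[OF assms]])

lemma line_g_deriv:
  assumes "x + \<tau> *\<^sub>R v \<in> S"
  shows "((\<lambda>\<tau>. g (x + \<tau> *\<^sub>R v) \<bullet> u) has_real_derivative (H (x + \<tau> *\<^sub>R v) *v v) \<bullet> u) (at \<tau> within T)"
  by (rule has_derivative_along_line[OF has_derivative_inner_left[OF g_deriv[OF assms]]])

lemma line_third:
  assumes "x + \<tau> *\<^sub>R v \<in> S"
  shows "\<exists>T. ((\<lambda>\<tau>. (H (x + \<tau> *\<^sub>R v) *v v) \<bullet> v) has_real_derivative T) (at \<tau>)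
           \<and> \<bar>T\<bar> \<le> 2 * qnorm (H (x + \<tau> *\<^sub>R v)) v ^ 3"
proof -
  obtain T where T: "((\<lambda>\<sigma>. (H (x + \<tau> *\<^sub>R v + \<sigma> *\<^sub>R v) *v v) \<bullet> v) has_real_derivative T) (at 0)"
     "\<bar>T\<bar> \<le> 2 * qnorm (H (x + \<tau> *\<^sub>R v)) v ^ 3" using third[OF assms] by blast
  have "((\<lambda>\<tau>. (H (x + \<tau> *\<^sub>R v) *v v) \<bullet> v) has_real_derivative T) (at (0 + \<tau>))"
    by (subst DERIV_shift) (use T(1) in \<open>simp add: algebra_simps\<close>)
  then show ?thesis using T(2) by auto
qed

text \<open>If \<open>q\<close> is the second derivative along the line, then \<open>q\<^sup>-\<^sup>1\<^sup>/\<^sup>2\<close> has derivative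
  \<open>- q' / (2 q\<^sup>3\<^sup>/\<^sup>2)\<close>, and self-concordance is the bound \<open>1\<close> for its absolute value.\<close>

lemma inverse_local_norm_deriv:
  assumes S: "x + \<tau> *\<^sub>R v \<in> S" and v: "v \<noteq> 0"
  shows "\<exists>D. ((\<lambda>\<tau>. 1 / qnorm (H (x + \<tau> *\<^sub>R v)) v) has_real_derivative D) (at \<tau>) \<and> \<bar>D\<bar> \<le> 1"
proof -
  let ?Q = "\<lambda>\<tau>. (H (x + \<tau> *\<^sub>R v) *v v) \<bullet> v" and ?n = "qnorm (H (x + \<tau> *\<^sub>R v)) v"
  obtain T where T: "(?Q has_real_derivative T) (at \<tau>)" "\<bar>T\<bar> \<le> 2 * ?n ^ 3"
    using line_third[OF S] by blast
  have n: "?n > 0" using qnorm_pos[OF H_pd[OF S] v] .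
  have Q: "?Q \<tau> > 0" using pd_pos[OF H_pd[OF S] v] .
  have "((\<lambda>\<tau>. 1 / sqrt (?Q \<tau>)) has_real_derivative - (T / (2 * ?n)) / ?n\<^sup>2) (at \<tau>)"
    using Q n by (auto intro!: derivative_eq_intros T(1) simp: qnorm_def power2_eq_square divide_simps)
  moreover have "\<bar>- (T / (2 * ?n)) / ?n\<^sup>2\<bar> \<le> 1"
    using T(2) n by (simp add: abs_mult divide_simps power2_eq_square power3_eq_cube abs_if mult_ac split: if_splits)
  ultimately show ?thesis unfolding qnorm_def by blast
qed

lemma inverse_local_norm_Lipschitz:
  assumes "x \<in> S" "x + \<tau> *\<^sub>R v \<in> S" "v \<noteq> 0"
  shows "\<bar>1 / qnorm (H (x + \<tau> *\<^sub>R v)) v - 1 / qnorm (H x) v\<bar> \<le> \<bar>\<tau>\<bar>"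
proof -
  let ?I = "{\<tau>. x + \<tau> *\<^sub>R v \<in> S}"
  have "\<forall>\<tau>\<in>?I. \<exists>D. ((\<lambda>\<tau>. 1 / qnorm (H (x + \<tau> *\<^sub>R v)) v) has_real_derivative D) (at \<tau>) \<and> \<bar>D\<bar> \<le> 1"
    using inverse_local_norm_deriv assms(3) by auto
  then obtain D where D: "\<And>\<tau>. \<tau> \<in> ?I \<Longrightarrow> ((\<lambda>\<tau>. 1 / qnorm (H (x + \<tau> *\<^sub>R v)) v) has_real_derivative D \<tau>) (at \<tau>) \<and> \<bar>D \<tau>\<bar> \<le> 1"
    by metis
  have "norm (1 / qnorm (H (x + \<tau> *\<^sub>R v)) v - 1 / qnorm (H (x + 0 *\<^sub>R v)) v) \<le> 1 * norm (\<tau> - 0)"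
    by (rule field_differentiable_bound[OF line_convex[of x v], where f' = D])
       (use D assms in \<open>auto intro: has_field_derivative_at_within\<close>)
  then show ?thesis by simp
qed

lemma local_norm_along_line:
  assumes "x \<in> S" "x + \<tau> *\<^sub>R v \<in> S" "0 \<le> \<tau>"
  shows "\<tau> * qnorm (H x) v < 1 \<Longrightarrow> qnorm (H (x + \<tau> *\<^sub>R v)) v \<le> qnorm (H x) v / (1 - \<tau> * qnorm (H x) v)"
    and "qnorm (H x) v / (1 + \<tau> * qnorm (H x) v) \<le> qnorm (H (x + \<tau> *\<^sub>R v)) v"
proof -
  let ?n = "qnorm (H x) v" and ?m = "qnorm (H (x + \<tau> *\<^sub>R v)) v"
  have "(\<tau> * ?n < 1 \<longrightarrow> ?m \<le> ?n / (1 - \<tau> * ?n)) \<and> ?n / (1 + \<tau> * ?n) \<le> ?m"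
  proof (cases "v = 0")
    case False
    have n: "?n > 0" "?m > 0" using False H_pd assms by (auto intro: qnorm_pos)
    have L: "\<bar>1 / ?m - 1 / ?n\<bar> \<le> \<tau>" using inverse_local_norm_Lipschitz[OF assms(1,2) False] assms(3) by simp
    then have "1 / ?m \<le> 1 / ?n + \<tau>" "1 / ?n \<le> 1 / ?m + \<tau>" by linarith+
    then have a: "?n \<le> ?m + \<tau> * ?n * ?m" "?m \<le> ?n + \<tau> * ?n * ?m"
      using n by (auto simp: field_simps)
    have "1 + \<tau> * ?n > 0" using n assms(3) by (simp add: add_pos_nonneg)
    then show ?thesis using a n by (auto simp: field_simps)
  qed simp
  then show "\<tau> * ?n < 1 \<Longrightarrow> ?m \<le> ?n / (1 - \<tau> * ?n)" "?n / (1 + \<tau> * ?n) \<le> ?m" by auto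
qed

lemma gradient_continuous: "continuous_on S g"
  by (intro continuous_at_imp_continuous_on ballI has_derivative_continuous[OF g_deriv])

text \<open>Until the segment from \<open>x\<close> to \<open>x + v\<close> leaves the domain, the second derivative of \<open>F\<close> along it stays below
  \<open>(n / (1 - n))\<^sup>2\<close> with \<open>n = \<parallel>v\<parallel>\<^sub>x < 1\<close>. So \<open>F\<close> stays bounded, which is impossible near a boundary point.\<close>

lemma Dikin_ellipsoid:
  assumes x: "x \<in> S" and lt: "qnorm (H x) v < 1"
  shows "x + v \<in> S"
proof (rule ccontr)
  assume out: "x + v \<notin> S"
  define B where "B = {\<tau>\<in>{0..1::real}. x + \<tau> *\<^sub>R v \<notin> S}"
  define n where "n = qnorm (H x) v"
  have B1: "1 \<in> B" using out by (simp add: B_def)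
  have vne: "v \<noteq> 0" using out x by auto
  have n: "0 < n" "n < 1" using lt qnorm_pos[OF H_pd[OF x] vne] by (auto simp: n_def)
  have "closed ({0..1::real} \<inter> (\<lambda>\<tau>. x + \<tau> *\<^sub>R v) -` (- S))"
    using open_S by (intro continuous_closed_preimage continuous_intros) auto
  also have "{0..1::real} \<inter> (\<lambda>\<tau>. x + \<tau> *\<^sub>R v) -` (- S) = B" by (auto simp: B_def)
  finally have clB: "closed B" .
  have bdd: "bdd_below B" by (rule bdd_belowI[of _ 0]) (auto simp: B_def)
  define s where "s = Inf B"
  have sB: "s \<in> B" unfolding s_def using B1 bdd clB by (intro closed_contains_Inf) auto
  have s: "0 < s" "s \<le> 1" "x + s *\<^sub>R v \<notin> S"
    using sB x by (auto simp: B_def less_le)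
  have inS: "x + \<tau> *\<^sub>R v \<in> S" if "0 \<le> \<tau>" "\<tau> < s" for \<tau>
  proof (rule ccontr)
    assume "\<not> ?thesis"
    then have "\<tau> \<in> B" using that s by (auto simp: B_def)
    then show False using cInf_lower[OF _ bdd] that by (force simp: s_def)
  qed
  define M where "M = (n / (1 - n))\<^sup>2"
  have Qb: "(H (x + \<tau> *\<^sub>R v) *v v) \<bullet> v \<le> M" if t: "0 \<le> \<tau>" "\<tau> < s" for \<tau>
  proof -
    have tn: "\<tau> * n \<le> n" using t s n mult_left_le_one_le[of n \<tau>] by auto
    then have tn: "\<tau> * n \<le> n" "\<tau> * n < 1" using n by linarith+
    have "qnorm (H (x + \<tau> *\<^sub>R v)) v \<le> n / (1 - \<tau> * n)"
      using local_norm_along_line(1)[OF x inS[OF t] t(1)] tn by (simp add: n_def)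
    also have "\<dots> \<le> n / (1 - n)" using tn n by (intro divide_left_mono mult_pos_pos) auto
    finally have "(qnorm (H (x + \<tau> *\<^sub>R v)) v)\<^sup>2 \<le> M"
      unfolding M_def using H_pd[OF inS[OF t]] by (intro power_mono) auto
    then show ?thesis using H_pd[OF inS[OF t]] by (simp add: qnorm_sq)
  qed
  have gb: "g (x + \<tau> *\<^sub>R v) \<bullet> v \<le> g x \<bullet> v + M" if t: "0 \<le> \<tau>" "\<tau> < s" for \<tau>
  proof (cases "\<tau> = 0")
    case False
    have "\<exists>z::real. 0 < z \<and> z < \<tau> \<and> g (x + \<tau> *\<^sub>R v) \<bullet> v - g (x + 0 *\<^sub>R v) \<bullet> v
        = (\<tau> - 0) * ((H (x + z *\<^sub>R v) *v v) \<bullet> v)"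
      using False t by (intro MVT2 line_g_deriv inS) auto
    then obtain z where z: "0 < z" "z < \<tau>"
      "g (x + \<tau> *\<^sub>R v) \<bullet> v - g x \<bullet> v = \<tau> * ((H (x + z *\<^sub>R v) *v v) \<bullet> v)" by auto
    have "\<tau> * ((H (x + z *\<^sub>R v) *v v) \<bullet> v) \<le> 1 * M"
      using z t s H_pd[OF inS, of z] pd_nonneg[OF H_pd[OF inS, of z]] by (intro mult_mono Qb) auto
    then show ?thesis using z by simp
  qed (simp add: M_def)
  define C where "C = F x + \<bar>g x \<bullet> v\<bar> + M"
  have Fb: "F (x + \<tau> *\<^sub>R v) \<le> C" if t: "0 < \<tau>" "\<tau> < s" for \<tau>
  proof -
    have "\<exists>z::real. 0 < z \<and> z < \<tau> \<and> F (x + \<tau> *\<^sub>R v) - F (x + 0 *\<^sub>R v)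
        = (\<tau> - 0) * (g (x + z *\<^sub>R v) \<bullet> v)"
      using t by (intro MVT2 line_F_deriv inS) auto
    then obtain z where z: "0 < z" "z < \<tau>"
      "F (x + \<tau> *\<^sub>R v) - F x = \<tau> * (g (x + z *\<^sub>R v) \<bullet> v)" by auto
    have "\<tau> * (g (x + z *\<^sub>R v) \<bullet> v) \<le> \<tau> * (\<bar>g x \<bullet> v\<bar> + M)"
      using gb[of z] z t by (intro mult_left_mono) auto
    also have "\<dots> \<le> 1 * (\<bar>g x \<bullet> v\<bar> + M)" using t s by (intro mult_right_mono) (auto simp: M_def)
    finally show ?thesis using z by (simp add: C_def)
  qed
  have lim: "filterlim (\<lambda>\<tau>. x + \<tau> *\<^sub>R v) (at (x + s *\<^sub>R v) within S) (at_left s)"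
    unfolding filterlim_at
  proof
    have "\<forall>\<^sub>F \<tau> in at_left s. \<tau> \<in> {0<..<s}" using s by (intro eventually_at_left_real)
    then show "\<forall>\<^sub>F \<tau> in at_left s. x + \<tau> *\<^sub>R v \<in> S \<and> x + \<tau> *\<^sub>R v \<noteq> x + s *\<^sub>R v"
      by eventually_elim (use inS vne in auto)
    show "((\<lambda>\<tau>. x + \<tau> *\<^sub>R v) \<longlongrightarrow> x + s *\<^sub>R v) (at_left s)" by (intro tendsto_intros)
  qed
  have "x + s *\<^sub>R v \<in> closure S"
  proof (rule Lim_in_closed_set[OF closed_closure])
    have "\<forall>\<^sub>F \<tau> in at_left s. \<tau> \<in> {0<..<s}" using s by (intro eventually_at_left_real)
    then show "\<forall>\<^sub>F \<tau> in at_left s. x + \<tau> *\<^sub>R v \<in> closure S"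
      by eventually_elim (rule subsetD[OF closure_subset], rule inS, auto)
    show "((\<lambda>\<tau>. x + \<tau> *\<^sub>R v) \<longlongrightarrow> x + s *\<^sub>R v) (at_left s)" by (intro tendsto_intros)
  qed simp
  from barrier_S[OF this s(3)] have "filterlim (\<lambda>\<tau>. F (x + \<tau> *\<^sub>R v)) at_top (at_left s)"
    using lim by (rule filterlim_compose)
  then have "\<forall>\<^sub>F \<tau> in at_left s. C + 1 \<le> F (x + \<tau> *\<^sub>R v)" by (simp add: filterlim_at_top)
  moreover have "\<forall>\<^sub>F \<tau> in at_left s. \<tau> \<in> {0<..<s}" using s by (intro eventually_at_left_real)
  ultimately have "\<forall>\<^sub>F \<tau> in at_left s. False" by eventually_elim (use Fb in force)
  then show False by (simp add: trivial_limit_at_left_real)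
qed

text \<open>The Hessian is not assumed continuous. By the mean value theorem the difference quotient
  \<open>\<langle>g (x + \<eta> v) - g x, v\<rangle> / \<eta>\<close> is the squared norm of \<open>v\<close> at an intermediate point, so its power
  \<open>- 1/2\<close> differs from \<open>1 / \<parallel>v\<parallel>\<^sub>x\<close> by at most \<open>\<eta>\<close>. Thus \<open>1 / \<parallel>v\<parallel>\<^sub>x\<close> is locally a uniform limit of
  continuous functions.\<close>

lemma local_norm_continuous:
  assumes x0: "x0 \<in> S"
  shows "isCont (\<lambda>x. qnorm (H x) v) x0"
proof (cases "v = 0")
  case False
  let ?i = "\<lambda>x. 1 / qnorm (H x) v"
  have "(?i \<longlongrightarrow> ?i x0) (at x0)"
  proof (rule tendstoI)
    fix e :: real assume e: "e > 0"
    have "((\<lambda>\<eta>. x0 + \<eta> *\<^sub>R v) \<longlongrightarrow> x0 + 0 *\<^sub>R v) (at_right 0)" by (intro tendsto_intros)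
    then have "\<forall>\<^sub>F \<eta> in at_right 0. x0 + \<eta> *\<^sub>R v \<in> S"
      using open_S x0 by (intro topological_tendstoD) auto
    moreover have "\<forall>\<^sub>F \<eta> in at_right 0. \<eta> \<in> {0<..<e/3}" using e by (intro eventually_at_right_real) simp
    ultimately have "\<forall>\<^sub>F \<eta> in at_right 0. x0 + \<eta> *\<^sub>R v \<in> S \<and> \<eta> \<in> {0<..<e/3}" by (rule eventually_conj)
    then obtain \<eta> where eta: "x0 + \<eta> *\<^sub>R v \<in> S" "0 < \<eta>" "\<eta> < e/3"
      using eventually_happens[of _ "at_right (0::real)"] by auto
    define D where "D x = ((g (x + \<eta> *\<^sub>R v) - g x) \<bullet> v) / \<eta>" for x
    have D: "D x > 0 \<and> \<bar>1 / sqrt (D x) - ?i x\<bar> \<le> \<eta>" if "x \<in> S" "x + \<eta> *\<^sub>R v \<in> S" for x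
    proof -
      have "\<exists>z::real. 0 < z \<and> z < \<eta> \<and> g (x + \<eta> *\<^sub>R v) \<bullet> v - g (x + 0 *\<^sub>R v) \<bullet> v
        = (\<eta> - 0) * ((H (x + z *\<^sub>R v) *v v) \<bullet> v)"
        using that eta by (intro MVT2 line_g_deriv line_in_S[OF that]) auto
      then obtain z where z: "0 < z" "z < \<eta>" "D x = (H (x + z *\<^sub>R v) *v v) \<bullet> v"
        using eta by (auto simp: D_def inner_diff_left)
      have zS: "x + z *\<^sub>R v \<in> S" using z by (intro line_in_S[OF that]) auto
      have "1 / sqrt (D x) = ?i (x + z *\<^sub>R v)" using z by (simp add: qnorm_def)
      then have "\<bar>1 / sqrt (D x) - ?i x\<bar> \<le> \<eta>"
        using inverse_local_norm_Lipschitz[OF that(1) zS False] z by simp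
      then show ?thesis using z(3) pd_pos[OF H_pd[OF zS] False] by simp
    qed
    have "isCont (\<lambda>x. g (x + \<eta> *\<^sub>R v)) x0"
      by (rule isCont_o2[of x0 "\<lambda>x. x + \<eta> *\<^sub>R v"])
         (use has_derivative_continuous[OF g_deriv[OF eta(1)]] in \<open>auto intro!: continuous_intros\<close>)
    moreover have "isCont g x0" using has_derivative_continuous[OF g_deriv[OF x0]] by simp
    ultimately have "isCont (\<lambda>x. 1 / sqrt (D x)) x0"
      unfolding D_def using eta D[OF x0 eta(1)] by (intro continuous_intros) (auto simp: D_def)
    then have "((\<lambda>x. 1 / sqrt (D x)) \<longlongrightarrow> 1 / sqrt (D x0)) (at x0)" by (simp add: isCont_def)
    then have "\<forall>\<^sub>F x in at x0. dist (1 / sqrt (D x)) (1 / sqrt (D x0)) < e/3"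
      using e by (intro tendstoD) auto
    moreover have "\<forall>\<^sub>F x in at x0. x \<in> S" using open_S x0 by (rule eventually_at_in_open')
    moreover have "\<forall>\<^sub>F x in at x0. x + \<eta> *\<^sub>R v \<in> S"
    proof -
      have "((\<lambda>x. x + \<eta> *\<^sub>R v) \<longlongrightarrow> x0 + \<eta> *\<^sub>R v) (at x0)" by (intro tendsto_intros)
      then show ?thesis using open_S eta(1) by (rule topological_tendstoD)
    qed
    ultimately show "\<forall>\<^sub>F x in at x0. dist (?i x) (?i x0) < e"
    proof eventually_elim
      case (elim x)
      then show ?case using D[of x] D[OF x0 eta(1)] eta unfolding dist_real_def by linarith
    qed
  qed
  moreover have "?i x0 \<noteq> 0" using qnorm_pos[OF H_pd[OF x0] False] by simp
  ultimately have "((\<lambda>x. 1 / ?i x) \<longlongrightarrow> 1 / ?i x0) (at x0)" by (rule tendsto_divide[OF tendsto_const])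
  then show ?thesis by (simp add: isCont_def)
qed simp

lemma form_continuous: "continuous_on S (\<lambda>x. (H x *v u) \<bullet> v)"
proof (rule continuous_on_eq)
  show "continuous_on S (\<lambda>x. ((qnorm (H x) (u + v))\<^sup>2 - (qnorm (H x) (u - v))\<^sup>2) / 4)"
    by (intro continuous_intros continuous_at_imp_continuous_on ballI local_norm_continuous) auto
  fix x assume "x \<in> S"
  note pd = H_pd[OF this]
  show "((qnorm (H x) (u + v))\<^sup>2 - (qnorm (H x) (u - v))\<^sup>2) / 4 = (H x *v u) \<bullet> v"
    by (simp add: qnorm_sq_add[OF pd] qnorm_sq_diff[OF pd])
qed

end

section \<open>Mixed third derivatives from directional ones\<close>

text \<open>Turns the Lipschitz bounds along single directions into bounds for the derivatives of integrals over
  parallelograms.\<close>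

lemma derivative_bound_of_Lipschitz:
  fixes f :: "real \<Rightarrow> real"
  assumes D: "(f has_real_derivative D) (at 0)" and K: "\<forall>\<^sub>F h in at 0. \<bar>f h - f 0\<bar> \<le> K * \<bar>h\<bar>"
  shows "\<bar>D\<bar> \<le> K"
proof -
  have "((\<lambda>h. \<bar>(f (0 + h) - f 0) / h\<bar>) \<longlongrightarrow> \<bar>D\<bar>) (at 0)"
    using D unfolding DERIV_def by (rule tendsto_rabs)
  moreover have "\<forall>\<^sub>F h in at 0. \<bar>(f (0 + h) - f 0) / h\<bar> \<le> K"
    using K eventually_neq_at_within[of 0 0 UNIV]
    by eventually_elim (auto simp: abs_divide field_simps)
  ultimately show ?thesis by (rule tendsto_upperbound) auto
qed

text \<open>For an orthonormal pair \<open>d, e\<close> and a symmetric trilinear form \<open>T\<close>, the moment conditions say that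
  \<open>T(d, d, w\<^sub>1 d + w\<^sub>2 e) = \<Sum> c\<^sub>j T(v\<^sub>j, v\<^sub>j, v\<^sub>j)\<close> with \<open>v\<^sub>j = x\<^sub>j d + y\<^sub>j e\<close>. The weights are
  convex, so a bound for \<open>T(v, v, v)\<close> on unit vectors holds for \<open>T(d, d, w)\<close> with the same constant. The extremal
  cubic form is \<open>cos (3 \<theta> - \<alpha>)\<close>, where \<open>\<alpha>\<close> is the angle of \<open>w\<close>; equality forces the nodes to be the
  points where it is \<open>1\<close>, which are the angles \<open>\<alpha> / 3 + 2 \<pi> j / 3\<close>.\<close>

lemma trisection_nodes:
  fixes w1 w2 :: real
  assumes "w1\<^sup>2 + w2\<^sup>2 = 1"
  shows "\<exists>c x y :: nat \<Rightarrow> real. (\<forall>j. 0 \<le> c j) \<and> (\<forall>j. (x j)\<^sup>2 + (y j)\<^sup>2 = 1)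
      \<and> (\<Sum>j\<in>{0,1,2}. c j) = 1
      \<and> (\<Sum>j\<in>{0,1,2}. c j * x j ^ 3) = w1 \<and> (\<Sum>j\<in>{0,1,2}. 3 * c j * (x j)\<^sup>2 * y j) = w2
      \<and> (\<Sum>j\<in>{0,1,2}. c j * x j * (y j)\<^sup>2) = 0 \<and> (\<Sum>j\<in>{0,1,2}. c j * y j ^ 3) = 0"
proof -
  obtain \<alpha> where al: "w1 = cos \<alpha>" "w2 = sin \<alpha>" using sincos_total_2pi[OF assms] by metis
  \<comment> \<open>halves of cosine and sine, so that the coordinates of the nodes are polynomials in \<open>p\<close>, \<open>q\<close>, \<open>s\<close>\<close>
  define p q s where "p = cos (\<alpha> / 3) / 2" and "q = sin (\<alpha> / 3) / 2" and "s = sqrt 3"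
  have pq: "4 * p\<^sup>2 + 4 * q\<^sup>2 = 1" by (simp add: p_def q_def power_divide)
  have s: "s\<^sup>2 = 3" by (simp add: s_def)
  have w1: "w1 = 32 * p ^ 3 - 6 * p"
    using cos_treble_cos[of "\<alpha> / 3"] by (simp add: al p_def power_divide)
  have w2: "w2 = 6 * q - 32 * q ^ 3"
  proof -
    have "sin (3 * (\<alpha> / 3)) = sin (2 * (\<alpha> / 3) + \<alpha> / 3)" by simp
    also have "\<dots> = 8 * q * (2 * p * p) + (1 - 8 * q\<^sup>2) * (2 * q)"
      unfolding sin_add sin_double cos_double_sin by (simp add: p_def q_def power2_eq_square)
    also have "\<dots> = 6 * q - 32 * q ^ 3" using pq by algebra
    finally show ?thesis by (simp add: al)
  qed
  define x where "x j = (if j = 0 then 2 * p else if j = (1::nat) then - p - s * q else - p + s * q)" for j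
  define y where "y j = (if j = 0 then 2 * q else if j = (1::nat) then - q + s * p else - q - s * p)" for j
  define c where "c j = (4 * (x j)\<^sup>2 - 1)\<^sup>2 / 9" for j
  have x: "x 0 = 2 * p" "x 1 = - p - s * q" "x 2 = - p + s * q" "x (Suc 0) = - p - s * q"
    and y: "y 0 = 2 * q" "y 1 = - q + s * p" "y 2 = - q - s * p" "y (Suc 0) = - q + s * p"
    by (auto simp: x_def y_def)
  have cases: "P (x j) (y j)" if "P (x 0) (y 0)" "P (x 1) (y 1)" "P (x 2) (y 2)" for P j
    using that unfolding x_def y_def by auto
  have rotated: "4 * (- p' - t * q') ^ 3 - 3 * (- p' - t * q') = 32 * p' ^ 3 - 6 * p'"
    if "4 * p'\<^sup>2 + 4 * q'\<^sup>2 = 1" "t\<^sup>2 = 3" for p' q' t :: real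
    using that by algebra
  have xy: "(x j)\<^sup>2 + (y j)\<^sup>2 = 1" for j
    by (rule cases; unfold x y; insert pq s; algebra)
  have xx: "4 * (x j) ^ 3 - 3 * x j = w1" for j
  proof (rule cases[where P = "\<lambda>x y. 4 * x ^ 3 - 3 * x = w1"])
    show "4 * (x 0) ^ 3 - 3 * x 0 = w1" unfolding x w1 by simp
    show "4 * (x 1) ^ 3 - 3 * x 1 = w1" "4 * (x 2) ^ 3 - 3 * x 2 = w1"
      using rotated[OF pq, of s] rotated[OF pq, of "- s"] s unfolding x w1 by auto
  qed
  have yy: "3 * y j - 4 * (y j) ^ 3 = w2" for j
  proof (rule cases[where P = "\<lambda>x y. 3 * y - 4 * y ^ 3 = w2"])
    show "3 * y 0 - 4 * (y 0) ^ 3 = w2" unfolding y w2 by simp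
    show "3 * y 1 - 4 * (y 1) ^ 3 = w2" "3 * y 2 - 4 * (y 2) ^ 3 = w2"
      using rotated[of q p "- s"] rotated[of q p s] pq s unfolding y w2 by auto
  qed
  have "9 * c j = 3 + 6 * (w1 * x j) + 2 * (w2 * y j)" for j
  proof -
    have "(y j)\<^sup>2 = 1 - (x j)\<^sup>2" "(y j) ^ 4 = (1 - (x j)\<^sup>2)\<^sup>2" using xy[of j] by algebra+
    then have "(4 * (x j)\<^sup>2 - 1)\<^sup>2
        = 3 + 6 * ((4 * (x j) ^ 3 - 3 * x j) * x j) + 2 * ((3 * y j - 4 * (y j) ^ 3) * y j)"
      by algebra
    then show ?thesis by (simp add: c_def xx yy)
  qed
  then have c: "c j = (3 + 6 * (w1 * x j) + 2 * (w2 * y j)) / 9" for j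
    by (metis mult.commute nonzero_mult_div_cancel_right zero_neq_numeral)
  have sx: "x 0 + x 1 + x 2 = 0" and sy: "y 0 + y 1 + y 2 = 0"
    by (simp_all add: x y)
  have sxx: "2 * ((x 0)\<^sup>2 + (x 1)\<^sup>2 + (x 2)\<^sup>2) = 3" and sxy: "x 0 * y 0 + x 1 * y 1 + x 2 * y 2 = 0"
    unfolding x y using pq s by algebra+
  have syy: "2 * ((y 0)\<^sup>2 + (y 1)\<^sup>2 + (y 2)\<^sup>2) = 3"
    using sxx xy[of 0] xy[of 1] xy[of 2] by simp
  have sum3: "(\<Sum>j\<in>{0,1,2}. f j) = f 0 + f 1 + f 2" for f :: "nat \<Rightarrow> real" by simp
  have c1: "(\<Sum>j\<in>{0,1,2}. c j) = 1"
    unfolding sum3 c using sx sy by algebra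
  have cx: "(\<Sum>j\<in>{0,1,2}. c j * x j) = w1"
    unfolding sum3 c using sx sxx sxy by algebra
  have cy: "(\<Sum>j\<in>{0,1,2}. c j * y j) = w2 / 3"
    unfolding sum3 c using sy syy sxy by algebra
  have x3: "x j ^ 3 = (3 * x j + w1) / 4" and y3: "y j ^ 3 = (3 * y j - w2) / 4" for j
    using xx[of j] yy[of j] by auto
  have cx3: "(\<Sum>j\<in>{0,1,2}. c j * x j ^ 3) = w1"
    using c1 cx unfolding x3 sum3 by algebra
  have cy3: "(\<Sum>j\<in>{0,1,2}. c j * y j ^ 3) = 0"
    using c1 cy unfolding y3 sum3 by algebra
  show ?thesis
  proof (rule exI[of _ c], rule exI[of _ x], rule exI[of _ y], intro conjI allI)
    show "0 \<le> c j" for j by (simp add: c_def)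
    show "(x j)\<^sup>2 + (y j)\<^sup>2 = 1" for j by (rule xy)
    have "3 * c j * (x j)\<^sup>2 * y j = 3 * (c j * y j) - 3 * (c j * y j ^ 3)" for j
      using xy[of j] by algebra
    then show "(\<Sum>j\<in>{0,1,2}. 3 * c j * (x j)\<^sup>2 * y j) = w2"
      using cy cy3 by (simp only: sum_subtractf flip: sum_distrib_left)
    have "c j * x j * (y j)\<^sup>2 = c j * x j - c j * x j ^ 3" for j
      using xy[of j] by algebra
    then show "(\<Sum>j\<in>{0,1,2}. c j * x j * (y j)\<^sup>2) = 0"
      using cx cx3 by (simp only: sum_subtractf)
  qed (fact c1 cx3 cy3)+
qed

context self_concordant begin

lemma form_increment:
  assumes W: "convex W" "W \<subseteq> S" and b: "\<And>y. y \<in> W \<Longrightarrow> qnorm (H y) v \<le> \<mu>"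
    and y: "y \<in> W" "y + h *\<^sub>R v \<in> W"
  shows "\<bar>(H (y + h *\<^sub>R v) *v v) \<bullet> v - (H y *v v) \<bullet> v\<bar> \<le> 2 * \<mu> ^ 3 * \<bar>h\<bar>"
proof -
  let ?I = "{\<tau>. y + \<tau> *\<^sub>R v \<in> W}"
  have "\<exists>D. ((\<lambda>\<tau>. (H (y + \<tau> *\<^sub>R v) *v v) \<bullet> v) has_real_derivative D) (at \<tau>) \<and> \<bar>D\<bar> \<le> 2 * \<mu> ^ 3"
    if "\<tau> \<in> ?I" for \<tau>
  proof -
    have "qnorm (H (y + \<tau> *\<^sub>R v)) v ^ 3 \<le> \<mu> ^ 3"
      using that b W(2) H_pd by (intro power_mono) auto
    then show ?thesis using line_third[of y \<tau> v] that W(2) by force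
  qed
  then obtain D where D: "\<And>\<tau>. \<tau> \<in> ?I \<Longrightarrow>
     ((\<lambda>\<tau>. (H (y + \<tau> *\<^sub>R v) *v v) \<bullet> v) has_real_derivative D \<tau>) (at \<tau>) \<and> \<bar>D \<tau>\<bar> \<le> 2 * \<mu> ^ 3"
    by metis
  have "norm ((H (y + h *\<^sub>R v) *v v) \<bullet> v - (H (y + 0 *\<^sub>R v) *v v) \<bullet> v) \<le> 2 * \<mu> ^ 3 * norm (h - 0)"
    by (rule field_differentiable_bound[OF convex_line_preimage[OF W(1), of y v], where f' = D])
       (use D y in \<open>auto intro: has_field_derivative_at_within\<close>)
  then show ?thesis by simp
qed

lemma integral_g:
  assumes "0 \<le> \<epsilon>" "\<And>a. 0 \<le> a \<Longrightarrow> a \<le> \<epsilon> \<Longrightarrow> y + a *\<^sub>R e \<in> S"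
  shows "integral {0..\<epsilon>} (\<lambda>a. (H (y + a *\<^sub>R e) *v e) \<bullet> u) = g (y + \<epsilon> *\<^sub>R e) \<bullet> u - g y \<bullet> u"
proof -
  have "((\<lambda>a. (H (y + a *\<^sub>R e) *v e) \<bullet> u) has_integral (g (y + \<epsilon> *\<^sub>R e) \<bullet> u - g (y + 0 *\<^sub>R e) \<bullet> u)) {0..\<epsilon>}"
    using assms by (intro fundamental_theorem_of_calculus)
      (auto intro!: line_g_deriv simp flip: has_real_derivative_iff_has_vector_derivative)
  then show ?thesis by (simp add: integral_unique)
qed

lemma integral_F:
  assumes "0 \<le> \<epsilon>" "\<And>a. 0 \<le> a \<Longrightarrow> a \<le> \<epsilon> \<Longrightarrow> y + a *\<^sub>R e \<in> S"
  shows "((\<lambda>a. g (y + a *\<^sub>R e) \<bullet> e) has_integral (F (y + \<epsilon> *\<^sub>R e) - F y)) {0..\<epsilon>}"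
proof -
  have "((\<lambda>a. g (y + a *\<^sub>R e) \<bullet> e) has_integral (F (y + \<epsilon> *\<^sub>R e) - F (y + 0 *\<^sub>R e))) {0..\<epsilon>}"
    using assms by (intro fundamental_theorem_of_calculus)
      (auto intro!: line_F_deriv simp flip: has_real_derivative_iff_has_vector_derivative)
  then show ?thesis by simp
qed

text \<open>Integrals over the parallelogram \<open>z + [0, \<epsilon>] d + [0, \<epsilon>] e\<close>: \<open>edge\<close> is that of \<open>\<langle>H d, d\<rangle>\<close> and
  \<open>corner\<close> that of \<open>\<langle>H d, e\<rangle>\<close>. Integrating once or twice in closed form leaves expressions in
  \<open>g\<close> and \<open>F\<close>, which are differentiable in \<open>z\<close> although \<open>H\<close> need not be.\<close>

definition edge :: "real \<Rightarrow> real^'n \<Rightarrow> real^'n \<Rightarrow> real^'n \<Rightarrow> real" where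
  "edge \<epsilon> d e z = integral {0..\<epsilon>} (\<lambda>b. g (z + b *\<^sub>R e + \<epsilon> *\<^sub>R d) \<bullet> d - g (z + b *\<^sub>R e) \<bullet> d)"

definition edge_deriv :: "real \<Rightarrow> real^'n \<Rightarrow> real^'n \<Rightarrow> real^'n \<Rightarrow> real^'n \<Rightarrow> real" where
  "edge_deriv \<epsilon> d e z w = integral {0..\<epsilon>}
     (\<lambda>b. (H (z + b *\<^sub>R e + \<epsilon> *\<^sub>R d) *v w) \<bullet> d - (H (z + b *\<^sub>R e) *v w) \<bullet> d)"

definition corner :: "real \<Rightarrow> real^'n \<Rightarrow> real^'n \<Rightarrow> real^'n \<Rightarrow> real" where
  "corner \<epsilon> d e z = F (z + \<epsilon> *\<^sub>R d + \<epsilon> *\<^sub>R e) - F (z + \<epsilon> *\<^sub>R d) - F (z + \<epsilon> *\<^sub>R e) + F z"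

definition corner_deriv :: "real \<Rightarrow> real^'n \<Rightarrow> real^'n \<Rightarrow> real^'n \<Rightarrow> real^'n \<Rightarrow> real" where
  "corner_deriv \<epsilon> d e z w = g (z + \<epsilon> *\<^sub>R d + \<epsilon> *\<^sub>R e) \<bullet> w - g (z + \<epsilon> *\<^sub>R d) \<bullet> w - g (z + \<epsilon> *\<^sub>R e) \<bullet> w + g z \<bullet> w"

definition box_inside :: "real \<Rightarrow> real^'n \<Rightarrow> real^'n \<Rightarrow> real^'n \<Rightarrow> bool" where
  "box_inside \<epsilon> d e z \<longleftrightarrow> (\<forall>a\<in>{0..\<epsilon>}. \<forall>b\<in>{0..\<epsilon>}. z + b *\<^sub>R e + a *\<^sub>R d \<in> S)"

lemma box_insideD:
  assumes "box_inside \<epsilon> d e z" "0 \<le> \<epsilon>"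
  shows "0 \<le> a \<Longrightarrow> a \<le> \<epsilon> \<Longrightarrow> 0 \<le> b \<Longrightarrow> b \<le> \<epsilon> \<Longrightarrow> z + b *\<^sub>R e + a *\<^sub>R d \<in> S"
    and "0 \<le> b \<Longrightarrow> b \<le> \<epsilon> \<Longrightarrow> z + b *\<^sub>R e \<in> S" and "0 \<le> a \<Longrightarrow> a \<le> \<epsilon> \<Longrightarrow> z + a *\<^sub>R d \<in> S" and "z \<in> S"
proof -
  have *: "z + b *\<^sub>R e + a *\<^sub>R d \<in> S" if "0 \<le> a" "a \<le> \<epsilon>" "0 \<le> b" "b \<le> \<epsilon>" for a b
    using assms(1) that by (auto simp: box_inside_def)
  show "0 \<le> a \<Longrightarrow> a \<le> \<epsilon> \<Longrightarrow> 0 \<le> b \<Longrightarrow> b \<le> \<epsilon> \<Longrightarrow> z + b *\<^sub>R e + a *\<^sub>R d \<in> S" using * .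
  show "0 \<le> b \<Longrightarrow> b \<le> \<epsilon> \<Longrightarrow> z + b *\<^sub>R e \<in> S" "0 \<le> a \<Longrightarrow> a \<le> \<epsilon> \<Longrightarrow> z + a *\<^sub>R d \<in> S" "z \<in> S"
    using *[of 0 b] *[of a 0] *[of 0 0] assms(2) by auto
qed

lemma edge_has_derivative:
  assumes V: "open V" "\<And>z. z \<in> V \<Longrightarrow> box_inside \<epsilon> d e z" and z: "z \<in> V" and eps: "0 \<le> \<epsilon>"
  shows "((\<lambda>h. edge \<epsilon> d e (z + h *\<^sub>R w)) has_real_derivative edge_deriv \<epsilon> d e z w) (at 0)"
proof -
  have "open ((\<lambda>h. z + h *\<^sub>R w) -` V)" using V(1) by (intro open_vimage continuous_intros)
  moreover have "0 \<in> (\<lambda>h. z + h *\<^sub>R w) -` V" using z by simp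
  ultimately obtain r where r: "r > 0" "ball 0 r \<subseteq> (\<lambda>h. z + h *\<^sub>R w) -` V"
    using openE by blast
  have inV: "z + h *\<^sub>R w \<in> V" if "h \<in> ball (0::real) r" for h using r(2) that by auto
  have inS: "z + h *\<^sub>R w + b *\<^sub>R e + \<epsilon> *\<^sub>R d \<in> S" "z + h *\<^sub>R w + b *\<^sub>R e \<in> S"
    if "h \<in> ball (0::real) r" "b \<in> {0..\<epsilon>}" for h b
    using box_insideD(1,2)[OF V(2)[OF inV[OF that(1)]] eps] that(2) eps by auto
  define f where "f h b = g (z + h *\<^sub>R w + b *\<^sub>R e + \<epsilon> *\<^sub>R d) \<bullet> d - g (z + h *\<^sub>R w + b *\<^sub>R e) \<bullet> d" for h b :: real
  define f' where "f' h b = (H (z + h *\<^sub>R w + b *\<^sub>R e + \<epsilon> *\<^sub>R d) *v w) \<bullet> d - (H (z + h *\<^sub>R w + b *\<^sub>R e) *v w) \<bullet> d" for h b :: real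
  have "((\<lambda>h. integral (cbox 0 \<epsilon>) (f h)) has_field_derivative integral (cbox 0 \<epsilon>) (f' 0)) (at 0 within ball 0 r)"
  proof (rule leibniz_rule_field_derivative)
    fix h b :: real assume hb: "h \<in> ball 0 r" "b \<in> cbox 0 \<epsilon>"
    have "((\<lambda>h. g ((z + b *\<^sub>R e + \<epsilon> *\<^sub>R d) + h *\<^sub>R w) \<bullet> d - g ((z + b *\<^sub>R e) + h *\<^sub>R w) \<bullet> d) has_real_derivative
       (H ((z + b *\<^sub>R e + \<epsilon> *\<^sub>R d) + h *\<^sub>R w) *v w) \<bullet> d - (H ((z + b *\<^sub>R e) + h *\<^sub>R w) *v w) \<bullet> d) (at h within ball 0 r)"
      using inS[of h b] hb by (intro DERIV_diff line_g_deriv) (auto simp: algebra_simps)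
    then show "((\<lambda>h. f h b) has_real_derivative f' h b) (at h within ball 0 r)"
      unfolding f_def f'_def by (simp add: algebra_simps)
  next
    fix h assume h: "h \<in> ball (0::real) r"
    have "continuous_on {0..\<epsilon>} (f h)" unfolding f_def
      by (intro continuous_on_diff continuous_on_inner continuous_on_const continuous_on_compose2[OF gradient_continuous]
            continuous_on_add continuous_on_scaleR continuous_on_id) (use inS[OF h] in auto)
    then show "f h integrable_on cbox 0 \<epsilon>" by (simp add: integrable_continuous_real)
  next
    show "continuous_on (ball 0 r \<times> cbox 0 \<epsilon>) (\<lambda>(h, b). f' h b)"
      unfolding f'_def split_beta
      by (intro continuous_on_diff continuous_on_compose2[OF form_continuous]
            continuous_on_add continuous_on_scaleR continuous_on_const continuous_on_fst continuous_on_snd continuous_on_id)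
         (use inS in auto)
  qed (use r(1) in auto)
  then have "((\<lambda>h. integral {0..\<epsilon>} (f h)) has_real_derivative integral {0..\<epsilon>} (f' 0)) (at 0)"
    using r(1) by (simp add: at_within_open[of 0 "ball 0 r"])
  then show ?thesis by (simp add: edge_def edge_deriv_def f_def[abs_def] f'_def[abs_def])
qed

lemma corner_has_derivative:
  assumes "box_inside \<epsilon> d e z" and eps: "0 \<le> \<epsilon>"
  shows "((\<lambda>h. corner \<epsilon> d e (z + h *\<^sub>R w)) has_real_derivative corner_deriv \<epsilon> d e z w) (at 0)"
proof -
  have inS: "z + \<epsilon> *\<^sub>R d + \<epsilon> *\<^sub>R e \<in> S" "z + \<epsilon> *\<^sub>R d \<in> S" "z + \<epsilon> *\<^sub>R e \<in> S" "z \<in> S"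
    using box_insideD(1)[OF assms, of \<epsilon> \<epsilon>] box_insideD(2-4)[OF assms] eps by (auto simp: algebra_simps)
  have "((\<lambda>h. F ((z + \<epsilon> *\<^sub>R d + \<epsilon> *\<^sub>R e) + h *\<^sub>R w) - F ((z + \<epsilon> *\<^sub>R d) + h *\<^sub>R w) - F ((z + \<epsilon> *\<^sub>R e) + h *\<^sub>R w) + F (z + h *\<^sub>R w))
     has_real_derivative g ((z + \<epsilon> *\<^sub>R d + \<epsilon> *\<^sub>R e) + 0 *\<^sub>R w) \<bullet> w - g ((z + \<epsilon> *\<^sub>R d) + 0 *\<^sub>R w) \<bullet> w
        - g ((z + \<epsilon> *\<^sub>R e) + 0 *\<^sub>R w) \<bullet> w + g (z + 0 *\<^sub>R w) \<bullet> w) (at 0)"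
    using inS by (intro DERIV_diff DERIV_add line_F_deriv) auto
  then show ?thesis by (simp add: corner_def corner_deriv_def algebra_simps)
qed

lemma edge_deriv_linear:
  assumes "box_inside \<epsilon> d e z" and eps: "0 \<le> \<epsilon>"
  shows "edge_deriv \<epsilon> d e z (x *\<^sub>R u + y *\<^sub>R v) = x * edge_deriv \<epsilon> d e z u + y * edge_deriv \<epsilon> d e z v"
proof -
  define f where "f w b = (H (z + b *\<^sub>R e + \<epsilon> *\<^sub>R d) *v w) \<bullet> d - (H (z + b *\<^sub>R e) *v w) \<bullet> d" for w b
  have int: "f w integrable_on {0..\<epsilon>}" for w
    unfolding f_def using box_insideD[OF assms] eps
    by (intro integrable_continuous_real continuous_on_diff continuous_on_compose2[OF form_continuous]
          continuous_on_add continuous_on_scaleR continuous_on_const continuous_on_id) auto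
  have "f (x *\<^sub>R u + y *\<^sub>R v) = (\<lambda>b. x * f u b + y * f v b)"
    by (rule ext) (simp add: f_def matrix_vector_right_distrib matrix_vector_mult_scaleR inner_add_left algebra_simps)
  then show ?thesis unfolding edge_deriv_def
    using integrable_on_cmult_left[OF int[of u], of x] integrable_on_cmult_left[OF int[of v], of y]
    by (simp add: integral_add flip: f_def)
qed

text \<open>This is the symmetry of the mixed third derivatives after integration: the derivative of the integral of
  \<open>\<langle>H d, d\<rangle>\<close> in the direction \<open>e\<close> is the derivative of the integral of \<open>\<langle>H d, e\<rangle>\<close> in the
  direction \<open>d\<close>, because both are the mixed second difference of \<open>\<langle>g, d\<rangle>\<close>.\<close>

lemma edge_deriv_corner:
  assumes "box_inside \<epsilon> d e z" and eps: "0 \<le> \<epsilon>"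
  shows "edge_deriv \<epsilon> d e z e = corner_deriv \<epsilon> d e z d"
proof -
  have i: "z + \<epsilon> *\<^sub>R d + b *\<^sub>R e \<in> S" "z + b *\<^sub>R e \<in> S" if "0 \<le> b" "b \<le> \<epsilon>" for b
    using box_insideD(1)[OF assms, of \<epsilon> b] box_insideD(2)[OF assms, of b] that eps by (simp_all add: ac_simps)
  have c: "(\<lambda>b. (H (z + \<epsilon> *\<^sub>R d + b *\<^sub>R e) *v e) \<bullet> d) integrable_on {0..\<epsilon>}"
     "(\<lambda>b. (H (z + b *\<^sub>R e) *v e) \<bullet> d) integrable_on {0..\<epsilon>}"
    by (intro integrable_continuous_real continuous_on_compose2[OF form_continuous]
          continuous_on_add continuous_on_scaleR continuous_on_const continuous_on_id; use i in auto)+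
  have "edge_deriv \<epsilon> d e z e = integral {0..\<epsilon>}
     (\<lambda>b. (H (z + \<epsilon> *\<^sub>R d + b *\<^sub>R e) *v e) \<bullet> d - (H (z + b *\<^sub>R e) *v e) \<bullet> d)"
    unfolding edge_deriv_def by (simp add: ac_simps)
  also have "\<dots> = (g (z + \<epsilon> *\<^sub>R d + \<epsilon> *\<^sub>R e) \<bullet> d - g (z + \<epsilon> *\<^sub>R d) \<bullet> d) - (g (z + \<epsilon> *\<^sub>R e) \<bullet> d - g z \<bullet> d)"
    unfolding integral_diff[OF c] using i eps by (simp add: integral_g)
  finally show ?thesis by (simp add: corner_deriv_def)
qed

lemma corner_deriv_commute: "corner_deriv \<epsilon> d e z w = corner_deriv \<epsilon> e d z w"
  by (simp add: corner_deriv_def algebra_simps)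

definition box_integral :: "real \<Rightarrow> real^'n \<Rightarrow> real^'n \<Rightarrow> (real^'n \<Rightarrow> real) \<Rightarrow> real^'n \<Rightarrow> real" where
  "box_integral \<epsilon> d e k z = integral (cbox (0, 0) (\<epsilon>, \<epsilon>)) (\<lambda>p. k (z + snd p *\<^sub>R e + fst p *\<^sub>R d))"

lemma box_continuous:
  assumes "continuous_on S k" "box_inside \<epsilon> d e z"
  shows "continuous_on (cbox (0, 0) (\<epsilon>, \<epsilon>)) (\<lambda>p. k (z + snd p *\<^sub>R e + fst p *\<^sub>R d))"
  by (intro continuous_on_compose2[OF assms(1)] continuous_on_add continuous_on_scaleR
        continuous_on_const continuous_on_fst continuous_on_snd continuous_on_id)
     (use assms(2) in \<open>auto simp: box_inside_def\<close>)

lemma box_integral_iterated: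
  assumes "continuous_on S k" "box_inside \<epsilon> d e z"
  shows "box_integral \<epsilon> d e k z = integral {0..\<epsilon>} (\<lambda>a. integral {0..\<epsilon>} (\<lambda>b. k (z + b *\<^sub>R e + a *\<^sub>R d)))"
    and "box_integral \<epsilon> d e k z = integral {0..\<epsilon>} (\<lambda>b. integral {0..\<epsilon>} (\<lambda>a. k (z + b *\<^sub>R e + a *\<^sub>R d)))"
proof -
  note c = box_continuous[OF assms]
  show a: "box_integral \<epsilon> d e k z = integral {0..\<epsilon>} (\<lambda>a. integral {0..\<epsilon>} (\<lambda>b. k (z + b *\<^sub>R e + a *\<^sub>R d)))"
    using integral_prod_continuous[OF c] by (simp add: box_integral_def)
  have "continuous_on (cbox (0, 0) (\<epsilon>, \<epsilon>)) (\<lambda>(a, b). k (z + b *\<^sub>R e + a *\<^sub>R d))"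
    using c by (simp add: case_prod_unfold)
  from integral_swap_continuous[OF this]
  show "box_integral \<epsilon> d e k z = integral {0..\<epsilon>} (\<lambda>b. integral {0..\<epsilon>} (\<lambda>a. k (z + b *\<^sub>R e + a *\<^sub>R d)))"
    unfolding a by simp
qed

lemma box_integral_close:
  assumes "continuous_on S k" "box_inside \<epsilon> d e z" and eps: "0 \<le> \<epsilon>" and "0 \<le> \<eta>"
    and b: "\<And>a b. 0 \<le> a \<Longrightarrow> a \<le> \<epsilon> \<Longrightarrow> 0 \<le> b \<Longrightarrow> b \<le> \<epsilon> \<Longrightarrow> \<bar>k (z + b *\<^sub>R e + a *\<^sub>R d) - m\<bar> \<le> \<eta>"
  shows "\<bar>box_integral \<epsilon> d e k z - m * \<epsilon>\<^sup>2\<bar> \<le> \<eta> * \<epsilon>\<^sup>2"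
proof -
  have cont: "measure lborel (cbox (0, 0) (\<epsilon>, \<epsilon>) :: (real \<times> real) set) = \<epsilon>\<^sup>2"
    using eps by (simp add: content_Pair power2_eq_square)
  have "((\<lambda>p. k (z + snd p *\<^sub>R e + fst p *\<^sub>R d)) has_integral box_integral \<epsilon> d e k z) (cbox (0, 0) (\<epsilon>, \<epsilon>))"
    unfolding box_integral_def
    by (intro integrable_integral integrable_continuous box_continuous assms)
  from has_integral_diff[OF this has_integral_const[of m]]
  have "((\<lambda>p. k (z + snd p *\<^sub>R e + fst p *\<^sub>R d) - m) has_integral (box_integral \<epsilon> d e k z - m * \<epsilon>\<^sup>2)) (cbox (0, 0) (\<epsilon>, \<epsilon>))"
    by (simp add: cont mult.commute)
  from has_integral_bound[OF \<open>0 \<le> \<eta>\<close> this] show ?thesis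
    using b unfolding cont by (auto simp: cbox_Pair_eq)
qed

lemma box_integral_diff:
  assumes "continuous_on S k" "box_inside \<epsilon> d e z" "box_inside \<epsilon> d e z'" and eps: "0 \<le> \<epsilon>" and "0 \<le> \<eta>"
    and b: "\<And>a b. 0 \<le> a \<Longrightarrow> a \<le> \<epsilon> \<Longrightarrow> 0 \<le> b \<Longrightarrow> b \<le> \<epsilon> \<Longrightarrow>
              \<bar>k (z' + b *\<^sub>R e + a *\<^sub>R d) - k (z + b *\<^sub>R e + a *\<^sub>R d)\<bar> \<le> \<eta>"
  shows "\<bar>box_integral \<epsilon> d e k z' - box_integral \<epsilon> d e k z\<bar> \<le> \<eta> * \<epsilon>\<^sup>2"
proof -
  have cont: "measure lborel (cbox (0, 0) (\<epsilon>, \<epsilon>) :: (real \<times> real) set) = \<epsilon>\<^sup>2"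
    using eps by (simp add: content_Pair power2_eq_square)
  have "((\<lambda>p. k (z' + snd p *\<^sub>R e + fst p *\<^sub>R d) - k (z + snd p *\<^sub>R e + fst p *\<^sub>R d))
      has_integral (box_integral \<epsilon> d e k z' - box_integral \<epsilon> d e k z)) (cbox (0, 0) (\<epsilon>, \<epsilon>))"
    unfolding box_integral_def
    by (intro has_integral_diff integrable_integral integrable_continuous box_continuous assms)
  from has_integral_bound[OF \<open>0 \<le> \<eta>\<close> this] show ?thesis
    using b unfolding cont by (auto simp: cbox_Pair_eq)
qed

lemma box_integral_form:
  assumes B: "box_inside \<epsilon> d e z" and eps: "0 \<le> \<epsilon>"
  shows "box_integral \<epsilon> d e (\<lambda>z. (H z *v (x *\<^sub>R d + y *\<^sub>R e)) \<bullet> (x *\<^sub>R d + y *\<^sub>R e)) z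
      = x\<^sup>2 * edge \<epsilon> d e z + 2 * x * y * corner \<epsilon> d e z + y\<^sup>2 * edge \<epsilon> e d z"
proof -
  let ?I = "\<lambda>u v. box_integral \<epsilon> d e (\<lambda>z. (H z *v u) \<bullet> v) z"
  have int: "(\<lambda>p. (H (z + snd p *\<^sub>R e + fst p *\<^sub>R d) *v u) \<bullet> v) integrable_on cbox (0, 0) (\<epsilon>, \<epsilon>)" for u v
    by (intro integrable_continuous box_continuous[OF form_continuous B])
  have expand: "(H y' *v (x *\<^sub>R d + y *\<^sub>R e)) \<bullet> (x *\<^sub>R d + y *\<^sub>R e)
      = x\<^sup>2 * ((H y' *v d) \<bullet> d) + 2 * x * y * ((H y' *v d) \<bullet> e) + y\<^sup>2 * ((H y' *v e) \<bullet> e)"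
    if "y' \<in> S" for y'
    using pd_sym[OF H_pd[OF that], of d e]
    by (simp add: matrix_vector_right_distrib matrix_vector_mult_scaleR inner_add_left inner_add_right
         power2_eq_square algebra_simps)
  have "?I (x *\<^sub>R d + y *\<^sub>R e) (x *\<^sub>R d + y *\<^sub>R e) = integral (cbox (0, 0) (\<epsilon>, \<epsilon>))
     (\<lambda>p. x\<^sup>2 * ((H (z + snd p *\<^sub>R e + fst p *\<^sub>R d) *v d) \<bullet> d)
        + 2 * x * y * ((H (z + snd p *\<^sub>R e + fst p *\<^sub>R d) *v d) \<bullet> e)
        + y\<^sup>2 * ((H (z + snd p *\<^sub>R e + fst p *\<^sub>R d) *v e) \<bullet> e))"
    unfolding box_integral_def
    by (intro integral_cong expand) (use box_insideD(1)[OF B eps] in \<open>auto simp: cbox_Pair_eq\<close>)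
  also have "\<dots> = x\<^sup>2 * ?I d d + 2 * x * y * ?I d e + y\<^sup>2 * ?I e e"
  proof -
    have i: "(\<lambda>p. t * ((H (z + snd p *\<^sub>R e + fst p *\<^sub>R d) *v u) \<bullet> v)) integrable_on cbox (0, 0) (\<epsilon>, \<epsilon>)" for t u v
      using integrable_on_cmult_left[OF int[of u v], of t] by simp
    show ?thesis unfolding box_integral_def
      by (subst integral_add integral_add; (intro integrable_add i)?)+ (simp only: integral_mult[OF int])
  qed
  also have "?I d d = edge \<epsilon> d e z"
    unfolding box_integral_iterated(2)[OF form_continuous B] edge_def
    by (intro integral_cong integral_g eps) (use box_insideD(1)[OF B eps] in auto)
  also have "?I e e = edge \<epsilon> e d z"
    unfolding box_integral_iterated(1)[OF form_continuous B] edge_def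
  proof (intro integral_cong)
    fix a assume a: "a \<in> {0..\<epsilon>}"
    have "integral {0..\<epsilon>} (\<lambda>b. (H (z + a *\<^sub>R d + b *\<^sub>R e) *v e) \<bullet> e)
       = g (z + a *\<^sub>R d + \<epsilon> *\<^sub>R e) \<bullet> e - g (z + a *\<^sub>R d) \<bullet> e"
      using box_insideD(1)[OF B eps, of a] a by (intro integral_g eps) (auto simp: ac_simps)
    then show "integral {0..\<epsilon>} (\<lambda>b. (H (z + b *\<^sub>R e + a *\<^sub>R d) *v e) \<bullet> e)
       = g (z + a *\<^sub>R d + \<epsilon> *\<^sub>R e) \<bullet> e - g (z + a *\<^sub>R d) \<bullet> e"
      by (simp add: ac_simps)
  qed
  also have "?I d e = corner \<epsilon> d e z"
  proof -
    have "?I d e = integral {0..\<epsilon>} (\<lambda>b. g (z + b *\<^sub>R e + \<epsilon> *\<^sub>R d) \<bullet> e - g (z + b *\<^sub>R e) \<bullet> e)"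
      unfolding box_integral_iterated(2)[OF form_continuous B]
      by (intro integral_cong integral_g eps) (use box_insideD(1)[OF B eps] in auto)
    also have "\<dots> = integral {0..\<epsilon>} (\<lambda>b. g ((z + \<epsilon> *\<^sub>R d) + b *\<^sub>R e) \<bullet> e - g (z + b *\<^sub>R e) \<bullet> e)"
      by (simp add: ac_simps)
    also have "\<dots> = (F ((z + \<epsilon> *\<^sub>R d) + \<epsilon> *\<^sub>R e) - F (z + \<epsilon> *\<^sub>R d)) - (F (z + \<epsilon> *\<^sub>R e) - F z)"
    proof (intro integral_unique has_integral_diff integral_F eps)
      show "z + \<epsilon> *\<^sub>R d + a *\<^sub>R e \<in> S" if "0 \<le> a" "a \<le> \<epsilon>" for a
        using box_insideD(1)[OF B eps, of \<epsilon> a] that eps by (simp add: ac_simps)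
    qed (use box_insideD(2)[OF B eps] in auto)
    finally show ?thesis by (simp add: corner_def)
  qed
  finally show ?thesis .
qed

text \<open>The derivatives of the three integrals are the coefficients of a cubic form \<open>C\<close>, whose value at \<open>v\<^sub>j\<close> is the derivative
  of the integral of \<open>\<langle>H v\<^sub>j, v\<^sub>j\<rangle>\<close> in the direction \<open>v\<^sub>j\<close>. Self-concordance bounds this value, and the
  moment conditions on the weights carry the bound over to the derivative of the integral of \<open>\<langle>H d, d\<rangle>\<close> in
  the direction \<open>w\<^sub>1 d + w\<^sub>2 e\<close>.\<close>

lemma edge_Lipschitz:
  fixes J :: "'j set"
  assumes W: "ball x0 (2 * r) \<subseteq> S" and r: "0 < r" and eps: "0 < \<epsilon>" "\<epsilon> * (norm d + norm e) < r"
    and mu: "0 \<le> \<mu>" "\<And>j z. j \<in> J \<Longrightarrow> z \<in> ball x0 (2 * r) \<Longrightarrow> qnorm (H z) (x j *\<^sub>R d + y j *\<^sub>R e) \<le> \<mu>"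
    and c: "\<And>j. j \<in> J \<Longrightarrow> 0 \<le> c j" "(\<Sum>j\<in>J. c j) = 1"
      "(\<Sum>j\<in>J. c j * x j ^ 3) = w1" "(\<Sum>j\<in>J. 3 * c j * (x j)\<^sup>2 * y j) = w2"
      "(\<Sum>j\<in>J. c j * x j * (y j)\<^sup>2) = 0" "(\<Sum>j\<in>J. c j * y j ^ 3) = 0"
    and h: "x0 + h *\<^sub>R (w1 *\<^sub>R d + w2 *\<^sub>R e) \<in> ball x0 r"
  shows "\<bar>edge \<epsilon> d e (x0 + h *\<^sub>R (w1 *\<^sub>R d + w2 *\<^sub>R e)) - edge \<epsilon> d e x0\<bar> \<le> 2 * \<mu> ^ 3 * \<epsilon>\<^sup>2 * \<bar>h\<bar>"
proof -
  define w where "w = w1 *\<^sub>R d + w2 *\<^sub>R e"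
  have inW: "z + b *\<^sub>R e + a *\<^sub>R d \<in> ball x0 (2 * r)"
    if "z \<in> ball x0 r" "0 \<le> a" "a \<le> \<epsilon>" "0 \<le> b" "b \<le> \<epsilon>" for z a b
  proof -
    have "norm (b *\<^sub>R e + a *\<^sub>R d) \<le> \<epsilon> * norm e + \<epsilon> * norm d"
      by (rule order_trans[OF norm_triangle_ineq]) (use that in \<open>auto intro!: add_mono mult_right_mono\<close>)
    also have "\<dots> < r" using eps(2) by (simp add: algebra_simps)
    finally have "norm (b *\<^sub>R e + a *\<^sub>R d) < r" .
    moreover have "dist x0 (z + b *\<^sub>R e + a *\<^sub>R d) \<le> dist x0 z + norm (b *\<^sub>R e + a *\<^sub>R d)"
      using dist_triangle[of x0 "z + b *\<^sub>R e + a *\<^sub>R d" z]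
      by (simp add: dist_norm add.assoc norm_minus_commute add.commute[of "b *\<^sub>R e"])
    ultimately show ?thesis using that(1) by simp
  qed
  have B: "box_inside \<epsilon> d e z" if "z \<in> ball x0 r" for z
    using inW[OF that] W by (auto simp: box_inside_def)
  have B': "box_inside \<epsilon> e d z" if "z \<in> ball x0 r" for z
    unfolding box_inside_def
  proof (intro ballI)
    fix a b assume "a \<in> {0..\<epsilon>}" "b \<in> {0..\<epsilon>}"
    then have "z + a *\<^sub>R e + b *\<^sub>R d \<in> S" using inW[OF that, of b a] W by auto
    then show "z + b *\<^sub>R d + a *\<^sub>R e \<in> S" by (simp add: ac_simps)
  qed
  have e0: "0 \<le> \<epsilon>" using eps by simp
  \<comment> \<open>the cubic form whose coefficients are the derivatives of the three integrals\<close>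
  define C where "C z x y = x ^ 3 * edge_deriv \<epsilon> d e z d + 3 * x\<^sup>2 * y * corner_deriv \<epsilon> d e z d
      + 3 * x * y\<^sup>2 * corner_deriv \<epsilon> d e z e + y ^ 3 * edge_deriv \<epsilon> e d z e" for z x y
  have Cb: "\<bar>C z (x j) (y j)\<bar> \<le> 2 * \<mu> ^ 3 * \<epsilon>\<^sup>2" if z: "z \<in> ball x0 r" and j: "j \<in> J" for z j
  proof -
    define v where "v = x j *\<^sub>R d + y j *\<^sub>R e"
    have bv: "qnorm (H y) v \<le> \<mu>" if "y \<in> ball x0 (2 * r)" for y
      unfolding v_def by (rule mu(2)[OF j that])
    let ?N = "\<lambda>z. (x j)\<^sup>2 * edge \<epsilon> d e z + 2 * x j * y j * corner \<epsilon> d e z + (y j)\<^sup>2 * edge \<epsilon> e d z"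
    have D1: "((\<lambda>h. edge \<epsilon> d e (z + h *\<^sub>R v)) has_real_derivative
          x j * edge_deriv \<epsilon> d e z d + y j * corner_deriv \<epsilon> d e z d) (at 0)"
      using edge_has_derivative[OF open_ball B z e0, of v]
      by (simp add: v_def edge_deriv_linear[OF B[OF z] e0] edge_deriv_corner[OF B[OF z] e0])
    have D2: "((\<lambda>h. edge \<epsilon> e d (z + h *\<^sub>R v)) has_real_derivative
          x j * corner_deriv \<epsilon> d e z e + y j * edge_deriv \<epsilon> e d z e) (at 0)"
      using edge_has_derivative[OF open_ball B' z e0, of v]
      by (simp add: v_def edge_deriv_linear[OF B'[OF z] e0] edge_deriv_corner[OF B'[OF z] e0]
           corner_deriv_commute[of \<epsilon> e d])
    have D3: "((\<lambda>h. corner \<epsilon> d e (z + h *\<^sub>R v)) has_real_derivative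
          x j * corner_deriv \<epsilon> d e z d + y j * corner_deriv \<epsilon> d e z e) (at 0)"
      using corner_has_derivative[OF B[OF z] e0, of v]
      by (simp add: v_def corner_deriv_def inner_add_right algebra_simps)
    have "((\<lambda>h. ?N (z + h *\<^sub>R v)) has_real_derivative
        (x j)\<^sup>2 * (x j * edge_deriv \<epsilon> d e z d + y j * corner_deriv \<epsilon> d e z d)
        + 2 * x j * y j * (x j * corner_deriv \<epsilon> d e z d + y j * corner_deriv \<epsilon> d e z e)
        + (y j)\<^sup>2 * (x j * corner_deriv \<epsilon> d e z e + y j * edge_deriv \<epsilon> e d z e)) (at 0)"
      by (intro DERIV_add DERIV_cmult D1 D2 D3)
    also have "(x j)\<^sup>2 * (x j * edge_deriv \<epsilon> d e z d + y j * corner_deriv \<epsilon> d e z d)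
        + 2 * x j * y j * (x j * corner_deriv \<epsilon> d e z d + y j * corner_deriv \<epsilon> d e z e)
        + (y j)\<^sup>2 * (x j * corner_deriv \<epsilon> d e z e + y j * edge_deriv \<epsilon> e d z e) = C z (x j) (y j)"
      by (simp add: C_def power2_eq_square power3_eq_cube algebra_simps)
    finally have D: "((\<lambda>h. ?N (z + h *\<^sub>R v)) has_real_derivative C z (x j) (y j)) (at 0)" .
    show ?thesis
    proof (rule derivative_bound_of_Lipschitz[OF D])
      have "((\<lambda>h. z + h *\<^sub>R v) \<longlongrightarrow> z + 0 *\<^sub>R v) (at 0)" by (intro tendsto_intros)
      then have "\<forall>\<^sub>F h in at 0. z + h *\<^sub>R v \<in> ball x0 r"
        using z by (intro topological_tendstoD[OF _ open_ball]) auto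
      then show "\<forall>\<^sub>F h in at 0. \<bar>?N (z + h *\<^sub>R v) - ?N (z + 0 *\<^sub>R v)\<bar> \<le> 2 * \<mu> ^ 3 * \<epsilon>\<^sup>2 * \<bar>h\<bar>"
      proof eventually_elim
        case (elim h)
        have "\<bar>box_integral \<epsilon> d e (\<lambda>z. (H z *v v) \<bullet> v) (z + h *\<^sub>R v) - box_integral \<epsilon> d e (\<lambda>z. (H z *v v) \<bullet> v) z\<bar>
            \<le> (2 * \<mu> ^ 3 * \<bar>h\<bar>) * \<epsilon>\<^sup>2"
        proof (rule box_integral_diff[OF form_continuous B[OF z] B[OF elim] e0])
          show "0 \<le> 2 * \<mu> ^ 3 * \<bar>h\<bar>" using mu(1) by simp
          fix a b assume ab: "0 \<le> a" "a \<le> \<epsilon>" "0 \<le> b" "b \<le> \<epsilon>"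
          have eq: "z + b *\<^sub>R e + a *\<^sub>R d + h *\<^sub>R v = z + h *\<^sub>R v + b *\<^sub>R e + a *\<^sub>R d" by simp
          have "z + b *\<^sub>R e + a *\<^sub>R d + h *\<^sub>R v \<in> ball x0 (2 * r)"
            unfolding eq by (rule inW[OF elim ab])
          from form_increment[OF convex_ball W bv inW[OF z ab] this]
          show "\<bar>(H (z + h *\<^sub>R v + b *\<^sub>R e + a *\<^sub>R d) *v v) \<bullet> v - (H (z + b *\<^sub>R e + a *\<^sub>R d) *v v) \<bullet> v\<bar>
              \<le> 2 * \<mu> ^ 3 * \<bar>h\<bar>"
            unfolding eq .
        qed
        then show ?case
          unfolding v_def box_integral_form[OF B[OF z] e0] box_integral_form[OF B[OF elim, unfolded v_def] e0]
          by (simp add: mult_ac)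
      qed
    qed
  qed
  have Eb: "\<bar>edge_deriv \<epsilon> d e z w\<bar> \<le> 2 * \<mu> ^ 3 * \<epsilon>\<^sup>2" if z: "z \<in> ball x0 r" for z
  proof -
    have "edge_deriv \<epsilon> d e z w = w1 * edge_deriv \<epsilon> d e z d + w2 * corner_deriv \<epsilon> d e z d"
      by (simp add: w_def edge_deriv_linear[OF B[OF z] e0] edge_deriv_corner[OF B[OF z] e0])
    also have "\<dots> = (\<Sum>j\<in>J. c j * x j ^ 3) * edge_deriv \<epsilon> d e z d
         + (\<Sum>j\<in>J. 3 * c j * (x j)\<^sup>2 * y j) * corner_deriv \<epsilon> d e z d
         + (\<Sum>j\<in>J. c j * x j * (y j)\<^sup>2) * (3 * corner_deriv \<epsilon> d e z e)
         + (\<Sum>j\<in>J. c j * y j ^ 3) * edge_deriv \<epsilon> e d z e"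
      unfolding c by simp
    also have "\<dots> = (\<Sum>j\<in>J. c j * C z (x j) (y j))"
      unfolding C_def sum_distrib_right sum.distrib[symmetric]
      by (intro sum.cong refl) (simp add: algebra_simps)
    finally have "\<bar>edge_deriv \<epsilon> d e z w\<bar> \<le> (\<Sum>j\<in>J. \<bar>c j * C z (x j) (y j)\<bar>)" by simp
    also have "\<dots> \<le> (\<Sum>j\<in>J. c j * (2 * \<mu> ^ 3 * \<epsilon>\<^sup>2))"
      using c(1) Cb[OF z] by (intro sum_mono) (auto simp: abs_mult intro!: mult_left_mono)
    also have "\<dots> = 2 * \<mu> ^ 3 * \<epsilon>\<^sup>2" using c(2) by (simp flip: sum_distrib_right)
    finally show ?thesis .
  qed
  have D: "((\<lambda>\<tau>. edge \<epsilon> d e (x0 + \<tau> *\<^sub>R w)) has_real_derivative edge_deriv \<epsilon> d e (x0 + \<tau> *\<^sub>R w) w) (at \<tau>)"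
    if "x0 + \<tau> *\<^sub>R w \<in> ball x0 r" for \<tau>
  proof -
    have "((\<lambda>\<tau>. edge \<epsilon> d e (x0 + \<tau> *\<^sub>R w)) has_real_derivative edge_deriv \<epsilon> d e (x0 + \<tau> *\<^sub>R w) w) (at (0 + \<tau>))"
      by (subst DERIV_shift)
         (use edge_has_derivative[OF open_ball B that e0, of w] in \<open>simp add: algebra_simps\<close>)
    then show ?thesis by simp
  qed
  have "norm (edge \<epsilon> d e (x0 + h *\<^sub>R w) - edge \<epsilon> d e (x0 + 0 *\<^sub>R w)) \<le> 2 * \<mu> ^ 3 * \<epsilon>\<^sup>2 * norm (h - 0)"
    by (rule field_differentiable_bound[OF convex_line_preimage[OF convex_ball, of x0 w x0 r],
          where f' = "\<lambda>\<tau>. edge_deriv \<epsilon> d e (x0 + \<tau> *\<^sub>R w) w"])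
       (use D Eb h r in \<open>auto intro: has_field_derivative_at_within simp flip: w_def\<close>)
  then show ?thesis by (simp add: w_def)
qed

end

section \<open>Local Lipschitz bound for the Hessian form\<close>

text \<open>A substitute for the sign of the derivative, for functions that need not be differentiable: the set of
  points up to which \<open>\<phi>\<close> has grown at most with slope \<open>\<eta>\<close> is closed, and its supremum can only be \<open>b\<close>.\<close>

lemma nonincreasing_if_small_local_slope:
  fixes \<phi> :: "real \<Rightarrow> real"
  assumes "a \<le> b" and cont: "continuous_on {a..b} \<phi>"
    and loc: "\<And>t \<eta>. a \<le> t \<Longrightarrow> t < b \<Longrightarrow> 0 < \<eta> \<Longrightarrow>
               \<exists>\<rho>>0. \<forall>h. 0 < h \<and> h < \<rho> \<and> t + h \<le> b \<longrightarrow> \<phi> (t + h) \<le> \<phi> t + \<eta> * h"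
  shows "\<phi> b \<le> \<phi> a"
proof -
  have "\<phi> b \<le> \<phi> a + e" if e: "e > 0" for e
  proof -
    define \<eta> where "\<eta> = e / (b - a + 1)"
    have eta: "\<eta> > 0" using e assms(1) by (simp add: \<eta>_def)
    define T where "T = {t \<in> {a..b}. \<phi> t - \<eta> * (t - a) \<in> {..\<phi> a}}"
    have "closed ({a..b} \<inter> (\<lambda>t. \<phi> t - \<eta> * (t - a)) -` {..\<phi> a})"
      by (intro continuous_closed_preimage continuous_intros cont)
    also have "{a..b} \<inter> (\<lambda>t. \<phi> t - \<eta> * (t - a)) -` {..\<phi> a} = T" by (auto simp: T_def)
    finally have "closed T" .
    moreover have aT: "a \<in> T" using assms(1) by (simp add: T_def)
    moreover have bdd: "bdd_above T" by (rule bdd_aboveI[of _ b]) (auto simp: T_def)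
    ultimately have sT: "Sup T \<in> T" by (intro closed_contains_Sup) auto
    have "Sup T = b"
    proof (rule ccontr)
      assume "Sup T \<noteq> b"
      then have s: "a \<le> Sup T" "Sup T < b" using sT by (auto simp: T_def)
      from loc[OF s eta] obtain \<rho> where rho: "\<rho> > 0"
        "\<And>h. 0 < h \<Longrightarrow> h < \<rho> \<Longrightarrow> Sup T + h \<le> b \<Longrightarrow> \<phi> (Sup T + h) \<le> \<phi> (Sup T) + \<eta> * h" by blast
      define h where "h = min (\<rho> / 2) (b - Sup T)"
      have h: "0 < h" "h < \<rho>" "Sup T + h \<le> b" using rho(1) s by (auto simp: h_def)
      have "Sup T + h \<in> T" using rho(2)[OF h] sT h s by (auto simp: T_def algebra_simps)
      then show False using cSup_upper[OF _ bdd] h(1) by fastforce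
    qed
    then have "\<phi> b \<le> \<phi> a + \<eta> * (b - a)" using sT by (simp add: T_def)
    also have "\<eta> * (b - a) \<le> \<eta> * (b - a + 1)" using eta by (intro mult_left_mono) auto
    also have "\<dots> = e" using assms(1) by (simp add: \<eta>_def)
    finally show ?thesis by simp
  qed
  then show ?thesis by (rule field_le_epsilon)
qed

text \<open>Gram-Schmidt for two vectors. If \<open>u\<close> and \<open>s\<close> are parallel then \<open>e = 0\<close>, which is why the frame is only required
  to map the unit circle into the unit ball; this covers dimension one as well.\<close>

lemma orthonormal_frame:
  fixes M :: "real^'n^'n"
  assumes M: "positive_definite M" and u: "u \<noteq> 0" and s: "s \<noteq> 0"
  obtains d e w1 w2 where "u = qnorm M u *\<^sub>R d" "s = qnorm M s *\<^sub>R (w1 *\<^sub>R d + w2 *\<^sub>R e)"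
    "w1\<^sup>2 + w2\<^sup>2 = 1" "\<And>x y. x\<^sup>2 + y\<^sup>2 = 1 \<Longrightarrow> qnorm M (x *\<^sub>R d + y *\<^sub>R e) \<le> 1"
proof -
  define U V where "U = qnorm M u" and "V = qnorm M s"
  have UV: "U > 0" "V > 0" using M u s by (auto simp: U_def V_def qnorm_pos)
  define d w1 where "d = (1 / U) *\<^sub>R u" and "w1 = (M *v d) \<bullet> s / V"
  define z where "z = (1 / V) *\<^sub>R s - w1 *\<^sub>R d"
  \<comment> \<open>\<open>w2 = 0\<close> exactly if the vectors are parallel\<close>
  define w2 where "w2 = sqrt (1 - w1\<^sup>2)"
  define e where "e = (if w2 = 0 then 0 else (1 / w2) *\<^sub>R z)"
  have d1: "qnorm M d = 1" using UV by (simp add: d_def qnorm_scaleR flip: U_def)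
  then have dd: "(M *v d) \<bullet> d = 1" using qnorm_sq[OF M, of d] by simp
  have "\<bar>(M *v d) \<bullet> s\<bar> \<le> V" using qnorm_Cauchy_Schwarz[OF M, of d s] d1 by (simp add: V_def)
  then have w1: "\<bar>w1\<bar> \<le> 1" using UV by (simp add: w1_def field_simps abs_divide)
  then have w1s: "w1\<^sup>2 \<le> 1" by (simp add: abs_square_le_1)
  then have w: "w1\<^sup>2 + w2\<^sup>2 = 1" by (simp add: w2_def)
  have dz: "(M *v d) \<bullet> z = 0" using UV dd by (simp add: z_def inner_diff_right w1_def)
  have "(qnorm M ((1 / V) *\<^sub>R s))\<^sup>2 = 1" using UV by (simp add: qnorm_scaleR flip: V_def)
  moreover have "(1 / V) *\<^sub>R s = w1 *\<^sub>R d + z" by (simp add: z_def)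
  ultimately have zz: "(qnorm M z)\<^sup>2 = w2\<^sup>2"
    using w dz d1 by (simp add: qnorm_sq_add[OF M] qnorm_scaleR matrix_vector_mult_scaleR)
  have ze: "z = w2 *\<^sub>R e"
  proof (cases "w2 = 0")
    case True
    then have "qnorm M z = 0" using zz by simp
    then have "z = 0" using qnorm_pos[OF M, of z] by force
    then show ?thesis using True by simp
  qed (simp add: e_def)
  have e1: "(qnorm M e)\<^sup>2 \<le> 1"
    using zz by (auto simp: e_def qnorm_scaleR power_divide power_mult_distrib)
  have de: "(M *v d) \<bullet> e = 0" using dz by (simp add: e_def)
  show thesis
  proof
    show "u = qnorm M u *\<^sub>R d" using UV by (simp add: d_def flip: U_def)
    show "s = qnorm M s *\<^sub>R (w1 *\<^sub>R d + w2 *\<^sub>R e)"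
    proof -
      have "V *\<^sub>R ((1 / V) *\<^sub>R s) = V *\<^sub>R (w1 *\<^sub>R d + w2 *\<^sub>R e)"
        using ze unfolding z_def by (metis add.commute diff_add_cancel)
      then have "s = V *\<^sub>R (w1 *\<^sub>R d + w2 *\<^sub>R e)" using UV by simp
      then show ?thesis unfolding V_def .
    qed
    show "w1\<^sup>2 + w2\<^sup>2 = 1" by (rule w)
    fix x y :: real assume xy: "x\<^sup>2 + y\<^sup>2 = 1"
    have "(qnorm M (x *\<^sub>R d + y *\<^sub>R e))\<^sup>2 = x\<^sup>2 + y\<^sup>2 * (qnorm M e)\<^sup>2"
      using de d1 by (simp add: qnorm_sq_add[OF M] qnorm_scaleR matrix_vector_mult_scaleR power_mult_distrib)
    also have "\<dots> \<le> x\<^sup>2 + y\<^sup>2 * 1" using e1 by (intro add_left_mono mult_left_mono) auto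
    finally have "(qnorm M (x *\<^sub>R d + y *\<^sub>R e))\<^sup>2 \<le> 1\<^sup>2" using xy by simp
    then show "qnorm M (x *\<^sub>R d + y *\<^sub>R e) \<le> 1" by (rule power2_le_imp_le) simp
  qed
qed

context self_concordant begin

text \<open>In a frame that is orthonormal for \<open>H x\<^sub>0\<close>, the three directions of \<open>trisection_nodes\<close> have norm at most
  \<open>1\<close> at \<open>x\<^sub>0\<close>, hence at most \<open>\<mu> > 1\<close> near \<open>x\<^sub>0\<close>. So the integrals of \<open>\<langle>H d, d\<rangle>\<close> over small
  parallelograms have the Lipschitz constant \<open>2 \<mu>\<^sup>3 \<epsilon>\<^sup>2\<close>; dividing by the area \<open>\<epsilon>\<^sup>2\<close> and letting
  \<open>\<epsilon>\<close> tend to \<open>0\<close> gives the bound for \<open>\<langle>H d, d\<rangle>\<close> itself, with \<open>\<kappa> = \<mu>\<^sup>3\<close> arbitrarily close to \<open>1\<close>.\<close>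

lemma form_local_Lipschitz:
  assumes x0: "x0 \<in> S" and kappa: "1 < \<kappa>"
  shows "\<exists>\<rho>>0. \<forall>h. \<bar>h\<bar> < \<rho> \<longrightarrow> x0 + h *\<^sub>R s \<in> S \<and>
      \<bar>(H (x0 + h *\<^sub>R s) *v u) \<bullet> u - (H x0 *v u) \<bullet> u\<bar> \<le> 2 * \<kappa> * ((H x0 *v u) \<bullet> u) * qnorm (H x0) s * \<bar>h\<bar>"
proof (cases "u = 0 \<or> s = 0")
  case True
  have "((\<lambda>h. x0 + h *\<^sub>R s) \<longlongrightarrow> x0 + 0 *\<^sub>R s) (at 0)" by (intro tendsto_intros)
  then have "\<forall>\<^sub>F h in at 0. x0 + h *\<^sub>R s \<in> S" using open_S x0 by (intro topological_tendstoD) auto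
  then obtain \<rho> where "\<rho> > 0" "\<forall>h. h \<noteq> 0 \<and> dist h 0 < \<rho> \<longrightarrow> x0 + h *\<^sub>R s \<in> S"
    unfolding eventually_at by auto
  then have "\<forall>h. \<bar>h\<bar> < \<rho> \<longrightarrow> x0 + h *\<^sub>R s \<in> S" using x0 by (metis add.right_neutral dist_0_norm dist_commute real_norm_def scaleR_zero_left)
  then show ?thesis using \<open>\<rho> > 0\<close> True by auto
next
  case False
  let ?M = "H x0"
  define U V where "U = qnorm ?M u" and "V = qnorm ?M s"
  have UV: "U > 0" "V > 0" using H_pd[OF x0] False by (auto simp: U_def V_def qnorm_pos)
  obtain d e w1 w2 where fr: "u = U *\<^sub>R d" "s = V *\<^sub>R (w1 *\<^sub>R d + w2 *\<^sub>R e)"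
    "w1\<^sup>2 + w2\<^sup>2 = 1" "\<And>x y. x\<^sup>2 + y\<^sup>2 = 1 \<Longrightarrow> qnorm ?M (x *\<^sub>R d + y *\<^sub>R e) \<le> 1"
    using orthonormal_frame[OF H_pd[OF x0]] False unfolding U_def V_def by metis
  define w where "w = w1 *\<^sub>R d + w2 *\<^sub>R e"
  let ?J = "{0,1,2::nat}"
  obtain c x y where nodes: "\<And>j. 0 \<le> c j" "\<And>j. (x j)\<^sup>2 + (y j)\<^sup>2 = 1" "(\<Sum>j\<in>?J. c j) = 1"
    "(\<Sum>j\<in>?J. c j * x j ^ 3) = w1" "(\<Sum>j\<in>?J. 3 * c j * (x j)\<^sup>2 * y j) = w2"
    "(\<Sum>j\<in>?J. c j * x j * (y j)\<^sup>2) = 0" "(\<Sum>j\<in>?J. c j * y j ^ 3) = 0"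
    using trisection_nodes[OF fr(3)] by blast
  define \<mu> where "\<mu> = root 3 \<kappa>"
  have mu: "1 < \<mu>" "\<mu> ^ 3 = \<kappa>" using kappa by (auto simp: \<mu>_def)
  have "\<forall>\<^sub>F z in nhds x0. qnorm (H z) (x j *\<^sub>R d + y j *\<^sub>R e) < \<mu>" for j
  proof -
    have "((\<lambda>z. qnorm (H z) (x j *\<^sub>R d + y j *\<^sub>R e)) \<longlongrightarrow> qnorm ?M (x j *\<^sub>R d + y j *\<^sub>R e)) (nhds x0)"
      using local_norm_continuous[OF x0] unfolding isCont_def by (rule tendsto_at_iff_tendsto_nhds[THEN iffD1])
    moreover have "qnorm ?M (x j *\<^sub>R d + y j *\<^sub>R e) < \<mu>" using fr(4)[OF nodes(2)[of j]] mu(1) by linarith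
    ultimately show ?thesis by (rule order_tendstoD(2))
  qed
  then have "\<forall>\<^sub>F z in nhds x0. \<forall>j\<in>?J. qnorm (H z) (x j *\<^sub>R d + y j *\<^sub>R e) < \<mu>"
    by (intro eventually_ball_finite) auto
  moreover have "\<forall>\<^sub>F z in nhds x0. z \<in> S" using open_S x0 by (rule eventually_nhds_in_open)
  ultimately have "\<forall>\<^sub>F z in nhds x0. z \<in> S \<and> (\<forall>j\<in>?J. qnorm (H z) (x j *\<^sub>R d + y j *\<^sub>R e) < \<mu>)"
    by (rule eventually_conj[rotated])
  then obtain r0 where r0: "r0 > 0" "\<And>z. dist z x0 < r0 \<Longrightarrow> z \<in> S"
    "\<And>z j. dist z x0 < r0 \<Longrightarrow> j \<in> ?J \<Longrightarrow> qnorm (H z) (x j *\<^sub>R d + y j *\<^sub>R e) < \<mu>"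
    unfolding eventually_nhds_metric by blast
  define r where "r = r0 / 2"
  have r: "r > 0" "ball x0 (2 * r) \<subseteq> S" using r0 by (auto simp: r_def dist_commute)
  have rmu: "qnorm (H z) (x j *\<^sub>R d + y j *\<^sub>R e) \<le> \<mu>" if "j \<in> ?J" "z \<in> ball x0 (2 * r)" for j z
    using r0(3)[of z j] that by (auto simp: r_def dist_commute)
  let ?Q = "\<lambda>z. (H z *v d) \<bullet> d"
  have near: "\<exists>\<eta>>0. \<forall>y. dist y z < \<eta> \<longrightarrow> \<bar>?Q y - ?Q z\<bar> \<le> \<delta>" if "z \<in> S" "\<delta> > 0" for z \<delta>
  proof -
    have "isCont ?Q z" using form_continuous[of d d] open_S that(1) by (simp add: continuous_on_eq_continuous_at)
    then have "\<forall>\<^sub>F y in nhds z. dist (?Q y) (?Q z) < \<delta>"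
      using that(2) unfolding isCont_def
      by (intro tendstoD tendsto_at_iff_tendsto_nhds[of ?Q, THEN iffD1])
    then show ?thesis unfolding eventually_nhds_metric dist_real_def by (meson less_imp_le)
  qed
  have dir: "\<bar>?Q (x0 + h *\<^sub>R w) - ?Q x0\<bar> \<le> 2 * \<kappa> * \<bar>h\<bar>" if h: "x0 + h *\<^sub>R w \<in> ball x0 r" for h
  proof (rule field_le_epsilon)
    fix \<delta> :: real assume "\<delta> > 0"
    then have del: "\<delta> / 2 > 0" by simp
    let ?z = "x0 + h *\<^sub>R w"
    have zS: "?z \<in> S" using h r by auto
    obtain \<eta>1 where e1: "\<eta>1 > 0" "\<And>y. dist y x0 < \<eta>1 \<Longrightarrow> \<bar>?Q y - ?Q x0\<bar> \<le> \<delta> / 2"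
      using near[OF x0 del] by blast
    obtain \<eta>2 where e2: "\<eta>2 > 0" "\<And>y. dist y ?z < \<eta>2 \<Longrightarrow> \<bar>?Q y - ?Q ?z\<bar> \<le> \<delta> / 2"
      using near[OF zS del] by blast
    define m where "m = min r (min \<eta>1 \<eta>2)"
    define \<epsilon> where "\<epsilon> = m / (norm d + norm e + 1)"
    have m: "m > 0" "m \<le> r" "m \<le> \<eta>1" "m \<le> \<eta>2" using r(1) e1(1) e2(1) by (auto simp: m_def)
    have N: "norm d + norm e + 1 > 0" by (simp add: add_nonneg_pos)
    have eps: "\<epsilon> > 0" using m N by (simp add: \<epsilon>_def)
    have "\<epsilon> * (norm d + norm e + 1) = m" using N by (simp add: \<epsilon>_def)
    then have epsm: "\<epsilon> * (norm d + norm e) < m" using eps by (simp add: algebra_simps)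
    have step: "norm (b *\<^sub>R e + a *\<^sub>R d) < m" if "0 \<le> a" "a \<le> \<epsilon>" "0 \<le> b" "b \<le> \<epsilon>" for a b
    proof -
      have "norm (b *\<^sub>R e + a *\<^sub>R d) \<le> \<epsilon> * norm e + \<epsilon> * norm d"
        by (rule order_trans[OF norm_triangle_ineq]) (use that in \<open>auto intro!: add_mono mult_right_mono\<close>)
      then show ?thesis using epsm by (simp add: algebra_simps)
    qed
    have B: "box_inside \<epsilon> d e z" if "z \<in> ball x0 r" for z
      unfolding box_inside_def
    proof (intro ballI)
      fix a b assume "a \<in> {0..\<epsilon>}" "b \<in> {0..\<epsilon>}"
      then have "norm (b *\<^sub>R e + a *\<^sub>R d) < r" using step[of a b] m by auto
      moreover have "dist x0 (z + (b *\<^sub>R e + a *\<^sub>R d)) \<le> dist x0 z + norm (b *\<^sub>R e + a *\<^sub>R d)"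
        by (metis add_diff_cancel_left' dist_commute dist_norm dist_triangle)
      ultimately have "z + (b *\<^sub>R e + a *\<^sub>R d) \<in> ball x0 (2 * r)" using that by simp
      then show "z + b *\<^sub>R e + a *\<^sub>R d \<in> S" using r(2) by (auto simp: add.assoc)
    qed
    have edge: "\<bar>edge \<epsilon> d e z - ?Q z * \<epsilon>\<^sup>2\<bar> \<le> \<delta> / 2 * \<epsilon>\<^sup>2"
      if "z \<in> ball x0 r" "\<And>y. dist y z < m \<Longrightarrow> \<bar>?Q y - ?Q z\<bar> \<le> \<delta> / 2" for z
    proof -
      have "edge \<epsilon> d e z = box_integral \<epsilon> d e ?Q z"
        using box_integral_form[OF B[OF that(1)], of 1 0] eps by simp
      moreover have "\<bar>box_integral \<epsilon> d e ?Q z - ?Q z * \<epsilon>\<^sup>2\<bar> \<le> \<delta> / 2 * \<epsilon>\<^sup>2"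
      proof (rule box_integral_close[OF form_continuous B[OF that(1)]])
        fix a b assume "0 \<le> a" "a \<le> \<epsilon>" "0 \<le> b" "b \<le> \<epsilon>"
        then have "dist (z + b *\<^sub>R e + a *\<^sub>R d) z < m" using step[of a b] by (simp add: dist_norm add.assoc)
        then show "\<bar>?Q (z + b *\<^sub>R e + a *\<^sub>R d) - ?Q z\<bar> \<le> \<delta> / 2" by (rule that(2))
      qed (use eps del in auto)
      ultimately show ?thesis by simp
    qed
    have "\<bar>edge \<epsilon> d e ?z - edge \<epsilon> d e x0\<bar> \<le> 2 * \<mu> ^ 3 * \<epsilon>\<^sup>2 * \<bar>h\<bar>"
      unfolding w_def
    proof (rule edge_Lipschitz[OF r(2,1) eps _ _ rmu nodes(1) nodes(3-7)])
      show "\<epsilon> * (norm d + norm e) < r" using epsm m by simp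
      show "x0 + h *\<^sub>R (w1 *\<^sub>R d + w2 *\<^sub>R e) \<in> ball x0 r" using h by (simp add: w_def)
    qed (use mu in auto)
    moreover have "\<bar>edge \<epsilon> d e ?z - ?Q ?z * \<epsilon>\<^sup>2\<bar> \<le> \<delta> / 2 * \<epsilon>\<^sup>2"
      using e2(2) m by (intro edge[OF h]) auto
    moreover have "\<bar>edge \<epsilon> d e x0 - ?Q x0 * \<epsilon>\<^sup>2\<bar> \<le> \<delta> / 2 * \<epsilon>\<^sup>2"
      using e1(2) m r by (intro edge) auto
    ultimately have "\<bar>?Q ?z * \<epsilon>\<^sup>2 - ?Q x0 * \<epsilon>\<^sup>2\<bar> \<le> 2 * \<kappa> * \<epsilon>\<^sup>2 * \<bar>h\<bar> + \<delta> * \<epsilon>\<^sup>2"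
      unfolding mu(2) by linarith
    moreover have "\<bar>?Q ?z * \<epsilon>\<^sup>2 - ?Q x0 * \<epsilon>\<^sup>2\<bar> = \<bar>?Q ?z - ?Q x0\<bar> * \<epsilon>\<^sup>2"
      by (simp add: abs_mult flip: left_diff_distrib)
    ultimately have "\<bar>?Q ?z - ?Q x0\<bar> * \<epsilon>\<^sup>2 \<le> (2 * \<kappa> * \<bar>h\<bar> + \<delta>) * \<epsilon>\<^sup>2"
      by (simp add: algebra_simps)
    then show "\<bar>?Q ?z - ?Q x0\<bar> \<le> 2 * \<kappa> * \<bar>h\<bar> + \<delta>" using eps by (simp add: mult_le_cancel_right)
  qed
  define \<rho> where "\<rho> = r / (V * (norm w + 1))"
  have rho: "\<rho> > 0" using r UV by (simp add: \<rho>_def add_nonneg_pos)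
  show ?thesis
  proof (intro exI[of _ \<rho>] conjI allI impI rho)
    fix h assume h: "\<bar>h\<bar> < \<rho>"
    have hs: "h *\<^sub>R s = (h * V) *\<^sub>R w" using fr(2) by (simp add: w_def)
    have "\<bar>h\<bar> * (V * (norm w + 1)) < r"
      using h UV by (simp add: \<rho>_def pos_less_divide_eq add_nonneg_pos)
    moreover have "\<bar>h\<bar> * V * norm w \<le> \<bar>h\<bar> * (V * (norm w + 1))"
      using UV by (simp add: distrib_left mult.assoc)
    ultimately have inb: "x0 + (h * V) *\<^sub>R w \<in> ball x0 r"
      using UV by (simp add: dist_norm abs_mult)
    then show "x0 + h *\<^sub>R s \<in> S" using r hs by auto
    have Qu: "(H z *v u) \<bullet> u = U\<^sup>2 * ?Q z" for z
      by (subst (1 2) fr(1)) (simp add: matrix_vector_mult_scaleR power2_eq_square)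
    have "?Q x0 = 1"
      using qnorm_sq[OF H_pd[OF x0], of u] Qu[of x0] UV by (simp flip: U_def)
    then have "\<bar>(H (x0 + h *\<^sub>R s) *v u) \<bullet> u - (H x0 *v u) \<bullet> u\<bar> = U\<^sup>2 * \<bar>?Q (x0 + (h * V) *\<^sub>R w) - ?Q x0\<bar>"
      unfolding Qu hs right_diff_distrib[symmetric] abs_mult by simp
    also have "\<dots> \<le> U\<^sup>2 * (2 * \<kappa> * \<bar>h * V\<bar>)" by (intro mult_left_mono dir inb) auto
    also have "\<dots> = 2 * \<kappa> * ((H x0 *v u) \<bullet> u) * qnorm (H x0) s * \<bar>h\<bar>"
      using UV qnorm_sq[OF H_pd[OF x0], of u] by (simp add: abs_mult flip: U_def V_def)
    finally show "\<bar>(H (x0 + h *\<^sub>R s) *v u) \<bullet> u - (H x0 *v u) \<bullet> u\<bar>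
       \<le> 2 * \<kappa> * ((H x0 *v u) \<bullet> u) * qnorm (H x0) s * \<bar>h\<bar>" .
  qed
qed

section \<open>Comparison of Hessians\<close>

lemma ln_form_local:
  assumes x: "x \<in> S" and u: "u \<noteq> 0" and kappa: "1 < \<kappa>"
  shows "\<exists>\<rho>>0. \<forall>h. 0 < h \<and> h < \<rho> \<longrightarrow>
     \<bar>ln ((H (x + h *\<^sub>R s) *v u) \<bullet> u) - ln ((H x *v u) \<bullet> u)\<bar> \<le> 2 * \<kappa> * qnorm (H x) s * h"
proof -
  \<comment> \<open>one factor \<open>k\<close> for the form, one for replacing \<open>f 0\<close> by \<open>f h\<close> in the denominator\<close>
  define k where "k = sqrt \<kappa>"
  have k: "1 < k" "k * k = \<kappa>" using kappa by (auto simp: k_def)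
  define V where "V = qnorm (H x) s"
  have V: "0 \<le> V" using H_pd[OF x] by (simp add: V_def)
  define f where "f h = (H (x + h *\<^sub>R s) *v u) \<bullet> u" for h
  have f0: "f 0 > 0" using pd_pos[OF H_pd[OF x] u] by (simp add: f_def)
  obtain \<rho> where rho: "\<rho> > 0" "\<And>h. \<bar>h\<bar> < \<rho> \<Longrightarrow> x + h *\<^sub>R s \<in> S"
    "\<And>h. \<bar>h\<bar> < \<rho> \<Longrightarrow> \<bar>f h - f 0\<bar> \<le> 2 * k * f 0 * V * \<bar>h\<bar>"
    using form_local_Lipschitz[OF x k(1), of s u] unfolding f_def V_def by auto
  define \<rho>' where "\<rho>' = min \<rho> ((1 - 1 / k) / (2 * k * V + 1))"
  have den: "2 * k * V + 1 > 0" using k V by (simp add: add_nonneg_pos)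
  have rho': "\<rho>' > 0" using rho(1) k den by (simp add: \<rho>'_def)
  have "\<bar>ln (f h) - ln (f 0)\<bar> \<le> 2 * \<kappa> * V * h" if h: "0 < h" "h < \<rho>'" for h
  proof -
    have hr: "\<bar>h\<bar> < \<rho>" and hs: "h * (2 * k * V + 1) < 1 - 1 / k"
      using h den by (auto simp: \<rho>'_def pos_less_divide_eq)
    have fh: "f h > 0" using pd_pos[OF H_pd[OF rho(2)[OF hr]] u] by (simp add: f_def)
    define D where "D = 2 * k * V * h"
    have D: "0 \<le> D" "D < 1 - 1 / k" using hs h V k by (auto simp: D_def algebra_simps)
    have df: "\<bar>f h - f 0\<bar> \<le> f 0 * D"
      using rho(3)[OF hr] h by (simp add: D_def mult_ac)
    have k2: "2 * \<kappa> * V * h = k * D" using k(2) by (simp add: D_def mult_ac flip: k(2))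
    have lnle: "ln a - ln b \<le> (a - b) / b" if "a > 0" "b > 0" for a b :: real
      using ln_le_minus_one[of "a / b"] that by (simp add: ln_div diff_divide_distrib)
    have "ln (f h) - ln (f 0) \<le> (f h - f 0) / f 0" using lnle fh f0 by blast
    also have "\<dots> \<le> f 0 * D / f 0" using df f0 by (intro divide_right_mono) auto
    also have "\<dots> = 1 * D" using f0 by simp
    also have "\<dots> \<le> k * D" using k D by (intro mult_right_mono) auto
    finally have up: "ln (f h) - ln (f 0) \<le> k * D" .
    have "f 0 * (1 / k) \<le> f 0 * (1 - D)" using D f0 by (intro mult_left_mono) auto
    also have "\<dots> \<le> f h" using df by (simp add: algebra_simps abs_le_iff)
    finally have fk: "f 0 \<le> k * f h" using k by (simp add: field_simps)
    have "ln (f 0) - ln (f h) \<le> (f 0 - f h) / f h" using lnle fh f0 by blast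
    also have "\<dots> \<le> f 0 * D / f h" using df fh by (intro divide_right_mono) auto
    also have "\<dots> \<le> k * f h * D / f h" using fk fh D by (intro divide_right_mono mult_right_mono) auto
    also have "\<dots> = k * D" using fh by simp
    finally show ?thesis using up unfolding k2 by linarith
  qed
  then show ?thesis using rho' unfolding f_def V_def by (intro exI[of _ \<rho>']) auto
qed

text \<open>Along the segment the logarithm of the form changes at most at the rate \<open>2 \<parallel>s\<parallel>\<close>, and
  \<open>\<parallel>s\<parallel> \<le> r / (1 - \<tau> r)\<close> at the point \<open>x + \<tau> s\<close>, where \<open>r = \<parallel>s\<parallel>\<^sub>x\<close>. The function \<open>- 2 ln (1 - \<tau> r)\<close> has
  twice this bound as its derivative.\<close>

lemma Hessian_comparison:
  assumes x: "x \<in> S" and r: "qnorm (H x) s < 1"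
  shows "(1 - qnorm (H x) s)\<^sup>2 * ((H x *v u) \<bullet> u) \<le> (H (x + s) *v u) \<bullet> u"
    and "(1 - qnorm (H x) s)\<^sup>2 * ((H (x + s) *v u) \<bullet> u) \<le> (H x *v u) \<bullet> u"
proof -
  define r where "r = qnorm (H x) s"
  have r01: "0 \<le> r" "r < 1" using assms H_pd by (auto simp: r_def)
  have *: "(1 - r)\<^sup>2 * ((H x *v u) \<bullet> u) \<le> (H (x + s) *v u) \<bullet> u \<and> (1 - r)\<^sup>2 * ((H (x + s) *v u) \<bullet> u) \<le> (H x *v u) \<bullet> u"
  proof (cases "u = 0")
    case u: False
    define f where "f \<tau> = (H (x + \<tau> *\<^sub>R s) *v u) \<bullet> u" for \<tau>
    have inS: "x + \<tau> *\<^sub>R s \<in> S" if "0 \<le> \<tau>" "\<tau> \<le> 1" for \<tau>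
      using line_in_S[OF x _ that, of s] Dikin_ellipsoid[OF x r] by simp
    have fpos: "f \<tau> > 0" if "0 \<le> \<tau>" "\<tau> \<le> 1" for \<tau>
      using pd_pos[OF H_pd[OF inS[OF that]] u] by (simp add: f_def)
    have tr: "\<tau> * r < 1" if "0 \<le> \<tau>" "\<tau> \<le> 1" for \<tau>
      using that r01 mult_left_le_one_le[of r \<tau>] by linarith
    have fcont: "continuous_on {0..1} f" unfolding f_def
      by (intro continuous_on_compose2[OF form_continuous] continuous_intros) (use inS in auto)
    \<comment> \<open>\<open>\<sigma> = 1\<close> bounds the form from above and \<open>\<sigma> = - 1\<close> from below\<close>
    have key: "\<sigma> * ln (f 1) + 2 * ln (1 - 1 * r) \<le> \<sigma> * ln (f 0) + 2 * ln (1 - 0 * r)"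
      if sig: "\<sigma> = 1 \<or> \<sigma> = -1" for \<sigma> :: real
    proof (rule nonincreasing_if_small_local_slope[where a = 0 and b = "1::real"
            and \<phi> = "\<lambda>\<tau>. \<sigma> * ln (f \<tau>) + 2 * ln (1 - \<tau> * r)"])
      show "continuous_on {0..1} (\<lambda>\<tau>. \<sigma> * ln (f \<tau>) + 2 * ln (1 - \<tau> * r))"
        by (intro continuous_intros fcont) (use fpos tr in force)+
      fix t \<eta> :: real assume t: "0 \<le> t" "t < 1" and eta: "0 < \<eta>"
      define R where "R = r / (1 - t * r)"
      have t1: "t * r < 1" using tr t by simp
      have R: "0 \<le> R" using r01 t1 by (simp add: R_def)
      \<comment> \<open>chosen so that the excess \<open>2 (\<kappa> - 1) R\<close> over the rate \<open>2 R\<close> is at most \<open>\<eta>\<close>\<close>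
      define \<kappa> where "\<kappa> = 1 + \<eta> / (2 * (R + 1))"
      have kappa: "1 < \<kappa>" using eta R by (simp add: \<kappa>_def)
      have xt: "x + t *\<^sub>R s \<in> S" using inS t by simp
      have V: "qnorm (H (x + t *\<^sub>R s)) s \<le> R"
        using local_norm_along_line(1)[OF x xt t(1)] t1 by (simp add: R_def r_def)
      obtain \<rho> where rho: "\<rho> > 0" "\<And>h. 0 < h \<Longrightarrow> h < \<rho> \<Longrightarrow>
          \<bar>ln ((H (x + t *\<^sub>R s + h *\<^sub>R s) *v u) \<bullet> u) - ln (f t)\<bar> \<le> 2 * \<kappa> * qnorm (H (x + t *\<^sub>R s)) s * h"
        using ln_form_local[OF xt u kappa, of s] unfolding f_def by blast
      show "\<exists>\<rho>>0. \<forall>h. 0 < h \<and> h < \<rho> \<and> t + h \<le> 1 \<longrightarrow>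
          \<sigma> * ln (f (t + h)) + 2 * ln (1 - (t + h) * r) \<le> \<sigma> * ln (f t) + 2 * ln (1 - t * r) + \<eta> * h"
      proof (intro exI[of _ \<rho>] conjI rho(1) allI impI)
        fix h assume h: "0 < h \<and> h < \<rho> \<and> t + h \<le> 1"
        have th: "(t + h) * r < 1" using h t by (intro tr) auto
        have "\<bar>ln (f (t + h)) - ln (f t)\<bar> \<le> 2 * \<kappa> * qnorm (H (x + t *\<^sub>R s)) s * h"
          using rho(2)[of h] h by (simp add: f_def scaleR_add_left add.assoc)
        also have "\<dots> \<le> 2 * \<kappa> * R * h" using V kappa h by (intro mult_right_mono mult_left_mono) auto
        finally have 1: "\<bar>ln (f (t + h)) - ln (f t)\<bar> \<le> 2 * \<kappa> * R * h" .
        have "ln ((1 - (t + h) * r) / (1 - t * r)) \<le> (1 - (t + h) * r) / (1 - t * r) - 1"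
          using th t1 by (intro ln_le_minus_one) auto
        also have "\<dots> = - R * h" using t1 by (simp add: R_def field_simps)
        finally have 2: "ln (1 - (t + h) * r) - ln (1 - t * r) \<le> - R * h"
          using th t1 by (simp add: ln_div)
        have "2 * (\<kappa> - 1) * R * h = \<eta> * (R / (R + 1)) * h" using R by (simp add: \<kappa>_def field_simps)
        also have "\<dots> \<le> \<eta> * 1 * h" using R eta h by (intro mult_right_mono mult_left_mono) auto
        finally have 3: "2 * \<kappa> * R * h \<le> 2 * (R * h) + \<eta> * h" by (simp add: algebra_simps)
        have "\<sigma> * ln (f (t + h)) - \<sigma> * ln (f t) \<le> 2 * \<kappa> * R * h" using 1 sig by auto
        then show "\<sigma> * ln (f (t + h)) + 2 * ln (1 - (t + h) * r) \<le> \<sigma> * ln (f t) + 2 * ln (1 - t * r) + \<eta> * h"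
          using 2 3 by linarith
      qed
    qed simp
    have f1: "f 0 > 0" "f 1 > 0" using fpos by auto
    have sq: "ln ((1 - r)\<^sup>2) = 2 * ln (1 - r)" using r01 by (simp add: ln_realpow)
    have "ln ((1 - r)\<^sup>2 * f 1) \<le> ln (f 0)" using key[of 1] f1 r01 by (simp add: ln_mult sq)
    moreover have "ln ((1 - r)\<^sup>2 * f 0) \<le> ln (f 1)" using key[of "-1"] f1 r01 by (simp add: ln_mult sq)
    ultimately have "(1 - r)\<^sup>2 * f 1 \<le> f 0" "(1 - r)\<^sup>2 * f 0 \<le> f 1" using f1 r01 by auto
    then show ?thesis by (simp add: f_def)
  qed simp
  show "(1 - qnorm (H x) s)\<^sup>2 * ((H x *v u) \<bullet> u) \<le> (H (x + s) *v u) \<bullet> u"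
    "(1 - qnorm (H x) s)\<^sup>2 * ((H (x + s) *v u) \<bullet> u) \<le> (H x *v u) \<bullet> u"
    using * by (auto simp: r_def)
qed

lemma norm_comparison:
  assumes x: "x \<in> S" and r: "qnorm (H x) s < 1"
  shows "(1 - qnorm (H x) s) * qnorm (H x) u \<le> qnorm (H (x + s)) u"
    and "(1 - qnorm (H x) s) * qnorm (H (x + s)) u \<le> qnorm (H x) u"
proof -
  note pd = H_pd[OF x] H_pd[OF Dikin_ellipsoid[OF x r]]
  show "(1 - qnorm (H x) s) * qnorm (H x) u \<le> qnorm (H (x + s)) u"
    using Hessian_comparison(1)[OF x r, of u] pd
    by (intro power2_le_imp_le[OF _ qnorm_nonneg]) (auto simp: power_mult_distrib qnorm_sq)
  show "(1 - qnorm (H x) s) * qnorm (H (x + s)) u \<le> qnorm (H x) u"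
    using Hessian_comparison(2)[OF x r, of u] pd
    by (intro power2_le_imp_le[OF _ qnorm_nonneg]) (auto simp: power_mult_distrib qnorm_sq)
qed

lemma dual_norm_comparison:
  assumes x: "x \<in> S" and r: "qnorm (H x) s < 1"
  shows "dnorm (H (x + s)) c \<le> dnorm (H x) c / (1 - qnorm (H x) s)"
proof -
  have "dnorm (H (x + s)) c \<le> (1 / (1 - qnorm (H x) s)) * dnorm (H x) c"
  proof (rule dnorm_compare)
    show "qnorm (H x) w \<le> 1 / (1 - qnorm (H x) s) * qnorm (H (x + s)) w" for w
      using norm_comparison(1)[OF x r, of w] r by (simp add: field_simps)
  qed (use assms H_pd Dikin_ellipsoid[OF x r] in auto)
  then show ?thesis by simp
qed

lemma Hessian_difference:
  assumes x: "x \<in> S" and r: "qnorm (H x) s < 1"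
  shows "\<bar>((H (x + s) - H x) *v u) \<bullet> w\<bar> \<le> (1 / (1 - qnorm (H x) s)\<^sup>2 - 1) * (qnorm (H x) u * qnorm (H x) w)"
proof (rule form_bound_polarize[OF H_pd[OF x]])
  define \<rho> where "\<rho> = (1 - qnorm (H x) s)\<^sup>2"
  have rho: "0 < \<rho>" "\<rho> \<le> 1" using r H_pd[OF x] by (auto simp: \<rho>_def power_le_one)
  note pd = H_pd[OF x] H_pd[OF Dikin_ellipsoid[OF x r]]
  show "transpose (H (x + s) - H x) = H (x + s) - H x"
    using pd unfolding positive_definite_def by (simp add: transpose_def vec_eq_iff)
  fix y
  define p q where "p = (H x *v y) \<bullet> y" and "q = (H (x + s) *v y) \<bullet> y"
  have p: "0 \<le> p" using pd_nonneg[OF pd(1)] by (simp add: p_def)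
  have a: "\<rho> * p \<le> q" "\<rho> * q \<le> p" using Hessian_comparison[OF x r, of y] by (auto simp: \<rho>_def p_def q_def)
  have 1: "q - p \<le> (1 / \<rho> - 1) * p" using a rho by (simp add: field_simps)
  have "2 \<le> 1 / \<rho> + \<rho>"
  proof -
    have "0 \<le> (1 - \<rho>)\<^sup>2 / \<rho>" using rho by simp
    then show ?thesis using rho by (simp add: field_simps power2_eq_square)
  qed
  then have "(1 - \<rho>) * p \<le> (1 / \<rho> - 1) * p" using p by (intro mult_right_mono) auto
  then have "p - q \<le> (1 / \<rho> - 1) * p" using a by (simp add: algebra_simps)
  then show "\<bar>((H (x + s) - H x) *v y) \<bullet> y\<bar> \<le> (1 / (1 - qnorm (H x) s)\<^sup>2 - 1) * ((H x *v y) \<bullet> y)"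
    using 1 by (simp add: p_def q_def matrix_vector_mult_diff_rdistrib inner_diff_left flip: \<rho>_def)
qed

text \<open>Along the segment, the derivative of the error tested with \<open>w\<close> is at most
  \<open>(1 / (1 - \<tau> r)\<^sup>2 - 1) r \<parallel>w\<parallel>\<close>, the derivative of \<open>\<parallel>w\<parallel> (1 / (1 - \<tau> r) - \<tau> r)\<close>.\<close>

lemma gradient_linearization_error:
  assumes x: "x \<in> S" and r: "qnorm (H x) s < 1"
  shows "dnorm (H x) (g (x + s) - g x - H x *v s) \<le> (qnorm (H x) s)\<^sup>2 / (1 - qnorm (H x) s)"
proof (rule dnorm_leI[OF H_pd[OF x]])
  define r where "r = qnorm (H x) s"
  have r01: "0 \<le> r" "r < 1" using assms H_pd by (auto simp: r_def)
  then show "0 \<le> (qnorm (H x) s)\<^sup>2 / (1 - qnorm (H x) s)" by (simp add: r_def)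
  fix w
  define W where "W = qnorm (H x) w"
  have W: "0 \<le> W" using H_pd[OF x] by (simp add: W_def)
  have inS: "x + \<tau> *\<^sub>R s \<in> S" if "0 \<le> \<tau>" "\<tau> \<le> 1" for \<tau>
    using line_in_S[OF x _ that, of s] Dikin_ellipsoid[OF x r] by simp
  have tr: "\<tau> * r < 1" if "0 \<le> \<tau>" "\<tau> \<le> 1" for \<tau>
    using that r01 mult_left_le_one_le[of r \<tau>] by linarith
  define \<psi> where "\<psi> \<tau> = g (x + \<tau> *\<^sub>R s) \<bullet> w - \<tau> * ((H x *v s) \<bullet> w) - W * (1 / (1 - \<tau> * r) - \<tau> * r)" for \<tau>
  have "\<psi> 1 \<le> \<psi> 0"
  proof (rule DERIV_nonpos_imp_nonincreasing[where f = \<psi> and a = 0 and b = 1])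
    fix \<tau> :: real assume t: "0 \<le> \<tau>" "\<tau> \<le> 1"
    have D: "(\<psi> has_real_derivative (H (x + \<tau> *\<^sub>R s) *v s) \<bullet> w - (H x *v s) \<bullet> w
        - W * (r / (1 - \<tau> * r)\<^sup>2 - r)) (at \<tau>)"
      unfolding \<psi>_def using tr[OF t]
      by (auto intro!: derivative_eq_intros line_g_deriv inS t simp: power2_eq_square)
    have q: "qnorm (H x) (\<tau> *\<^sub>R s) = \<tau> * r" using t by (simp add: qnorm_scaleR r_def)
    have "((H (x + \<tau> *\<^sub>R s) - H x) *v s) \<bullet> w \<le> (1 / (1 - \<tau> * r)\<^sup>2 - 1) * (r * W)"
      using Hessian_difference[OF x, of "\<tau> *\<^sub>R s" s w] tr[OF t] unfolding q by (simp add: r_def W_def abs_le_iff)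
    then have "(H (x + \<tau> *\<^sub>R s) *v s) \<bullet> w - (H x *v s) \<bullet> w - W * (r / (1 - \<tau> * r)\<^sup>2 - r) \<le> 0"
      by (simp add: matrix_vector_mult_diff_rdistrib inner_diff_left algebra_simps)
    then show "\<exists>y. (\<psi> has_real_derivative y) (at \<tau>) \<and> y \<le> 0" using D by blast
  qed simp
  then have "(g (x + s) - g x - H x *v s) \<bullet> w \<le> W * (1 / (1 - r) - r - 1)"
    by (simp add: \<psi>_def inner_diff_left algebra_simps)
  also have "1 / (1 - r) - r - 1 = r\<^sup>2 / (1 - r)" using r01 by (simp add: field_simps power2_eq_square)
  finally show "(g (x + s) - g x - H x *v s) \<bullet> w \<le> (qnorm (H x) s)\<^sup>2 / (1 - qnorm (H x) s) * qnorm (H x) w"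
    by (simp add: r_def W_def mult.commute)
qed

end

section \<open>One step of the damped Newton scheme\<close>

lemma has_derivative_gradient:
  assumes "F differentiable (at z)"
  shows "(F has_derivative (\<lambda>h. gradient F z \<bullet> h)) (at z)"
proof -
  obtain F' where F': "(F has_derivative F') (at z)" using assms by (auto simp: differentiable_def)
  have "linear F'" by (rule has_derivative_linear[OF F'])
  then have "F' h = h \<bullet> adjoint F' 1" for h
    using adjoint_works[of F' h 1] by simp
  then have "F' = (\<lambda>h. h \<bullet> adjoint F' 1)" by (rule ext)
  then have G: "GDERIV F z :> adjoint F' 1" using F' by (simp add: gderiv_def)
  have "D = adjoint F' 1" if "GDERIV F z :> D" for D
  proof -
    have "(\<lambda>h. h \<bullet> D) = (\<lambda>h. h \<bullet> adjoint F' 1)"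
      using that G unfolding gderiv_def by (rule has_derivative_unique)
    then have "h \<bullet> (D - adjoint F' 1) = 0" for h by (simp add: inner_diff_right fun_eq_iff)
    then show ?thesis by (metis inner_eq_zero_iff eq_iff_diff_eq_0)
  qed
  then have "GDERIV F z :> gradient F z"
    unfolding gradient_def by (rule theI[where P = "\<lambda>D. GDERIV F z :> D", OF G])
  then show ?thesis by (simp add: gderiv_def inner_commute)
qed

lemma has_derivative_hessian:
  assumes "gradient F differentiable (at z)"
  shows "(gradient F has_derivative (\<lambda>h. hessian F z *v h)) (at z)"
proof -
  have D: "(gradient F has_derivative frechet_derivative (gradient F) (at z)) (at z)"
    using assms frechet_derivative_works by blast
  have "(\<lambda>h. hessian F z *v h) = frechet_derivative (gradient F) (at z)"
    unfolding hessian_def using has_derivative_linear[OF D]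
    by (simp add: fun_eq_iff matrix_works linear_matrix_vector_mul_eq)
  then show ?thesis using D by simp
qed

text \<open>With \<open>u = M\<^sup>-\<^sup>1 q\<close> the hypothesis says that \<open>v\<close> lies in the ball with diameter from \<open>a\<close> to \<open>- u\<close>. So \<open>v\<close> is
  within \<open>\<parallel>a + u\<parallel>\<close> of \<open>a\<close>, and its norm is at most half of \<open>\<parallel>a - u\<parallel> + \<parallel>a + u\<parallel>\<close>, whose square is at most
  \<open>\<parallel>a\<parallel>\<^sup>2 + \<parallel>u\<parallel>\<^sup>2\<close> by the parallelogram law. The first bound is sharper when \<open>a + u\<close> is small,
  the second one when \<open>a\<close> and \<open>u\<close> are nearly orthogonal.\<close>

lemma monotone_residual_bounds:
  fixes M :: "real^'n^'n"
  assumes M: "positive_definite M" and mono: "0 \<le> (q + M *v v) \<bullet> (a - v)"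
  shows "qnorm M v \<le> qnorm M a + dnorm M (q + M *v a)"
    and "(qnorm M v)\<^sup>2 \<le> (qnorm M a)\<^sup>2 + (dnorm M q)\<^sup>2"
proof -
  define y where "y = v - a"
  have "(qnorm M y)\<^sup>2 \<le> - ((q + M *v a) \<bullet> y)"
    using mono unfolding qnorm_sq[OF M] y_def
    by (simp add: matrix_vector_mult_diff_distrib inner_diff_left inner_diff_right inner_add_left)
  also have "\<dots> \<le> dnorm M (q + M *v a) * qnorm M y"
    using inner_le_dnorm[OF M, of "q + M *v a" y] by linarith
  finally have "qnorm M y * qnorm M y \<le> dnorm M (q + M *v a) * qnorm M y" by (simp add: power2_eq_square)
  then have "qnorm M y \<le> dnorm M (q + M *v a)"
    using M by (cases "qnorm M y = 0") (auto simp: mult_le_cancel_right less_le)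
  then show "qnorm M v \<le> qnorm M a + dnorm M (q + M *v a)"
    using qnorm_triangle[OF M, of a y] by (simp add: y_def)
next
  define u where "u = matrix_inv M *v q"
  have q: "q = M *v u" using pd_inv[OF M] by (simp add: u_def)
  have "2 * (qnorm M v)\<^sup>2 \<le> 2 * ((M *v u) \<bullet> a) - 2 * ((M *v u) \<bullet> v) + 2 * ((M *v v) \<bullet> a)"
    using mono unfolding qnorm_sq[OF M] q by (simp add: inner_add_left inner_diff_right)
  moreover have "0 \<le> (qnorm M (v - (a - u)))\<^sup>2" by simp
  moreover have "(qnorm M (v - (a - u)))\<^sup>2 = (qnorm M v)\<^sup>2 - 2 * ((M *v v) \<bullet> a) + 2 * ((M *v u) \<bullet> v)
       + (qnorm M a)\<^sup>2 - 2 * ((M *v u) \<bullet> a) + (qnorm M u)\<^sup>2"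
    using pd_sym[OF M, of u v] pd_sym[OF M, of a u]
    by (simp add: qnorm_sq_diff[OF M] inner_diff_right)
  ultimately have "(qnorm M v)\<^sup>2 \<le> (qnorm M a)\<^sup>2 + (qnorm M u)\<^sup>2" by linarith
  then show "(qnorm M v)\<^sup>2 \<le> (qnorm M a)\<^sup>2 + (dnorm M q)\<^sup>2"
    using M by (simp add: dnorm_eq_qnorm u_def)
qed

lemma dnorm_ball_compact:
  fixes M :: "real^'n^'n"
  assumes M: "positive_definite M"
  shows "compact {c. dnorm M c \<le> R}"
proof -
  have "compact ((*v) M ` {u. qnorm M (u - 0) \<le> R})"
    by (intro compact_continuous_image qnorm_ball_compact[OF M] matrix_vector_mult_linear_continuous_on)
  also have "(*v) M ` {u. qnorm M (u - 0) \<le> R} = {c. dnorm M c \<le> R}"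
  proof (intro equalityI subsetI)
    fix c assume "c \<in> {c. dnorm M c \<le> R}"
    then show "c \<in> (*v) M ` {u. qnorm M (u - 0) \<le> R}"
      using M pd_inv[OF M] by (intro image_eqI[of _ _ "matrix_inv M *v c"]) (auto simp: dnorm_eq_qnorm)
  qed (use M in \<open>auto simp: dnorm_image\<close>)
  finally show ?thesis .
qed

lemma local_dist_attained:
  assumes M: "positive_definite (hessian F z)" and E: "closed E" and le: "local_dist F z E \<le> ereal b"
  shows "\<exists>e\<in>E. dnorm (hessian F z) e \<le> b"
proof -
  let ?n = "dnorm (hessian F z)"
  have "E \<noteq> {}" using le by (auto simp: local_dist_def top_ereal_def)
  then obtain e0 where e0: "e0 \<in> E" by blast
  let ?K = "E \<inter> {c. ?n c \<le> ?n e0}"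
  have "continuous_on ?K ?n"
  proof -
    have "continuous_on UNIV (\<lambda>c. qnorm (hessian F z) (matrix_inv (hessian F z) *v c - 0))"
      by (rule continuous_on_compose2[OF continuous_on_qnorm[of UNIV]])
         (auto intro: matrix_vector_mult_linear_continuous_on)
    then show ?thesis
      by (rule continuous_on_subset[THEN continuous_on_cong[THEN iffD1, rotated -1]])
         (auto simp: dnorm_eq_qnorm[OF M])
  qed
  moreover have "compact ?K" by (intro closed_Int_compact E dnorm_ball_compact[OF M])
  ultimately have "\<exists>e\<in>?K. \<forall>c\<in>?K. ?n e \<le> ?n c" using e0 by (intro continuous_attains_inf) auto
  then obtain e where e: "e \<in> E" "?n e \<le> ?n e0" "\<And>c. c \<in> E \<Longrightarrow> ?n c \<le> ?n e0 \<Longrightarrow> ?n e \<le> ?n c" by auto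
  have "ereal (?n e) \<le> local_dist F z E"
    unfolding local_dist_def dual_local_norm_dnorm
  proof (rule INF_greatest)
    fix c assume "c \<in> E"
    then show "ereal (?n e) \<le> ereal (?n c)" using e(2) e(3)[of c] by (cases "?n c \<le> ?n e0") auto
  qed
  then have "ereal (?n e) \<le> ereal b" using le by (rule order_trans)
  then show ?thesis using e(1) by auto
qed

locale barrier_inclusion =
  self_concordant S F "gradient F" "hessian F" for S :: "(real^'n) set" and F +
  fixes A :: "real^'n \<Rightarrow> (real^'n) set" and t :: real
  assumes A: "maximally_monotone A" and t: "0 < t"
begin

abbreviation g :: "real^'n \<Rightarrow> real^'n" where "g \<equiv> gradient F"
abbreviation H :: "real^'n \<Rightarrow> real^'n^'n" where "H \<equiv> hessian F"
abbreviation newton :: "real^'n \<Rightarrow> real^'n" where "newton \<equiv> newton_point F A t"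
abbreviation dec :: "real^'n \<Rightarrow> real" where "dec \<equiv> newton_decrement F A t"

lemma A_mono:
  assumes "b \<in> A y" "c \<in> A z"
  shows "(b - c) \<bullet> (y - z) \<ge> 0"
proof -
  have "monotone_operator A" using A by (simp add: maximally_monotone_def)
  from this[unfolded monotone_operator_def, rule_format, OF assms] show ?thesis .
qed

text \<open>The resolvent equation is equivalent to \<open>t (H z - g) - t H w \<in> A w\<close>. Minty's theorem for \<open>M = t H\<close> gives
  a solution, monotonicity gives uniqueness, and so the definite description denotes it.\<close>

lemma newton_point_inclusion:
  assumes z: "z \<in> S"
  shows "- (t *\<^sub>R (g z + H z *v (newton z - z))) \<in> A (newton z)"
proof -
  note pd = H_pd[OF z]
  define P where "P w \<longleftrightarrow> (\<exists>a\<in>A w. z - matrix_inv (H z) *v g z = w + (1 / t) *\<^sub>R (matrix_inv (H z) *v a))" for w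
  have P_iff: "P w \<longleftrightarrow> - (t *\<^sub>R (g z + H z *v (w - z))) \<in> A w" for w
  proof
    assume "P w"
    then obtain a where a: "a \<in> A w" "z - matrix_inv (H z) *v g z = w + (1 / t) *\<^sub>R (matrix_inv (H z) *v a)"
      by (auto simp: P_def)
    have "H z *v z - g z = H z *v (z - matrix_inv (H z) *v g z)"
      by (simp add: matrix_vector_mult_diff_distrib pd_inv[OF pd])
    also have "\<dots> = H z *v w + (1 / t) *\<^sub>R a"
      unfolding a(2) by (simp add: matrix_vector_right_distrib matrix_vector_mult_scaleR pd_inv[OF pd])
    finally have "(1 / t) *\<^sub>R a = - (g z + H z *v (w - z))"
      by (simp add: matrix_vector_mult_diff_distrib algebra_simps)
    then have "t *\<^sub>R ((1 / t) *\<^sub>R a) = - (t *\<^sub>R (g z + H z *v (w - z)))"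
      by (simp only: scaleR_minus_right)
    then have "a = - (t *\<^sub>R (g z + H z *v (w - z)))" using t by simp
    then show "- (t *\<^sub>R (g z + H z *v (w - z))) \<in> A w" using a(1) by simp
  next
    assume a: "- (t *\<^sub>R (g z + H z *v (w - z))) \<in> A w"
    have "w + (1 / t) *\<^sub>R (matrix_inv (H z) *v (- (t *\<^sub>R (g z + H z *v (w - z))))) = z - matrix_inv (H z) *v g z"
    proof -
      have "- (t *\<^sub>R (g z + H z *v (w - z))) = (- t) *\<^sub>R (g z + H z *v (w - z))" by simp
      then show ?thesis using t
        by (simp only: matrix_vector_mult_scaleR matrix_vector_right_distrib pd_inv[OF pd]) simp
    qed
    then show "P w" unfolding P_def using a by metis
  qed
  have "\<exists>w. P w"
  proof -
    have "positive_definite (t *\<^sub>R H z)"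
      using pd t unfolding positive_definite_def
      by (auto simp: transpose_def vec_eq_iff scaleR_matrix_vector_assoc[symmetric])
    then obtain w where "t *\<^sub>R (H z *v z - g z) - (t *\<^sub>R H z) *v w \<in> A w"
      using scaled_Minty[OF A] by blast
    moreover have "t *\<^sub>R (H z *v z - g z) - (t *\<^sub>R H z) *v w = - (t *\<^sub>R (g z + H z *v (w - z)))"
      by (simp add: scaleR_matrix_vector_assoc[symmetric] matrix_vector_mult_diff_distrib algebra_simps)
    ultimately show ?thesis using P_iff by auto
  qed
  moreover have "w = w'" if "P w" "P w'" for w w'
  proof (rule ccontr)
    assume "w \<noteq> w'"
    have "0 \<le> (- (t *\<^sub>R (g z + H z *v (w - z))) - - (t *\<^sub>R (g z + H z *v (w' - z)))) \<bullet> (w - w')"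
      using that P_iff by (intro A_mono) auto
    also have "\<dots> = - t * ((H z *v (w - w')) \<bullet> (w - w'))"
      by (simp add: matrix_vector_mult_diff_distrib inner_diff_left inner_diff_right inner_add_left algebra_simps)
    also have "\<dots> < 0" using pd_pos[OF pd, of "w - w'"] \<open>w \<noteq> w'\<close> t by simp
    finally show False by simp
  qed
  ultimately have "P (THE w. P w)" by (metis theI)
  moreover have "newton z = (THE w. P w)"
    unfolding newton_point_def scaled_resolvent_def P_def ..
  ultimately have "P (newton z)" by simp
  then show ?thesis using P_iff by blast
qed

lemma newton_decrement_qnorm: "dec z = qnorm (H z) (newton z - z)"
  unfolding newton_decrement_def local_norm_qnorm by (rule qnorm_minus_commute)

text \<open>The infimum in the criterion is attained, because the values of a maximally monotone operator are
  closed. The residual \<open>c\<close> is normalized by \<open>t\<close>.\<close>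

lemma newton_approxD:
  assumes z: "z \<in> S" and ap: "newton_approx F A t \<delta> z zt"
  shows "\<exists>c. dnorm (H z) c \<le> \<delta> \<and> t *\<^sub>R (c - g z - H z *v (zt - z)) \<in> A zt"
proof -
  let ?E = "{t *\<^sub>R (g z + H z *v (zt - z)) + a |a. a \<in> A zt}"
  have "?E = (\<lambda>a. t *\<^sub>R (g z + H z *v (zt - z)) + a) ` A zt" by auto
  then have "closed ?E" using closed_translation maximally_monotone_closed[OF A] by metis
  then obtain e where e: "e \<in> ?E" "dnorm (H z) e \<le> t * \<delta>"
    using local_dist_attained[OF H_pd[OF z]] ap unfolding newton_approx_def by meson
  then obtain a where a: "a \<in> A zt" "e = t *\<^sub>R (g z + H z *v (zt - z)) + a" by blast
  define c where "c = (1 / t) *\<^sub>R e"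
  have "dnorm (H z) c \<le> \<delta>"
    using e(2) t by (simp add: c_def dnorm_scaleR[OF H_pd[OF z]] field_simps)
  moreover have "t *\<^sub>R (c - g z - H z *v (zt - z)) = a"
  proof -
    have "t *\<^sub>R c = e" using t by (simp add: c_def)
    then show ?thesis by (simp add: a(2) algebra_simps)
  qed
  ultimately show ?thesis using a(1) by auto
qed

context
  fixes z d c :: "real^'n" and \<delta> :: real
  assumes z: "z \<in> S" and c: "dnorm (H z) c \<le> \<delta>"
    and incl: "t *\<^sub>R (c - g z - H z *v d) \<in> A (z + d)"
begin

text \<open>Let \<open>y\<close> be the difference of the inexact and the exact Newton point. Monotonicity places \<open>y\<close> in the ball
  with diameter from \<open>0\<close> to \<open>u = H\<^sup>-\<^sup>1 c\<close>. The second bound compares \<open>d\<close> with the centre \<open>u / 2\<close> instead of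
  \<open>0\<close>: if \<open>c\<close> does not point towards \<open>d\<close>, then the inexact decrement exceeds the exact one by at most
  \<open>\<delta> / 2\<close>.\<close>

lemma inexact_point_error:
  shows "qnorm (H z) d \<le> dec z + \<delta>"
    and "c \<bullet> d \<le> 0 \<Longrightarrow> (qnorm (H z) d)\<^sup>2 \<le> (dec z)\<^sup>2 + dec z * \<delta>"
proof -
  note pd = H_pd[OF z]
  define y where "y = z + d - newton z"
  define u where "u = matrix_inv (H z) *v c"
  have cu: "c = H z *v u" by (simp add: u_def pd_inv[OF pd])
  have nu: "qnorm (H z) u \<le> \<delta>" using c by (simp add: dnorm_eq_qnorm[OF pd] u_def)
  have dy: "d - y = newton z - z" by (simp add: y_def)
  have "0 \<le> (t *\<^sub>R (c - g z - H z *v d) - - (t *\<^sub>R (g z + H z *v (newton z - z)))) \<bullet> (z + d - newton z)"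
    by (intro A_mono incl newton_point_inclusion z)
  also have "t *\<^sub>R (c - g z - H z *v d) - - (t *\<^sub>R (g z + H z *v (newton z - z))) = t *\<^sub>R (c - H z *v y)"
    by (simp add: matrix_vector_mult_diff_distrib matrix_vector_right_distrib y_def algebra_simps)
  finally have "0 \<le> t * ((c - H z *v y) \<bullet> y)" by (simp add: y_def)
  then have yy: "(qnorm (H z) y)\<^sup>2 \<le> c \<bullet> y"
    using t by (simp add: qnorm_sq[OF pd] inner_diff_left zero_le_mult_iff)
  then have half: "(qnorm (H z) (y - (1/2) *\<^sub>R u))\<^sup>2 \<le> (qnorm (H z) u / 2)\<^sup>2"
    using pd_sym[OF pd, of y u]
    unfolding qnorm_sq_diff[OF pd] qnorm_scaleR power_mult_distrib cu
    by (simp add: power2_eq_square)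
  have half': "qnorm (H z) (y - (1/2) *\<^sub>R u) \<le> qnorm (H z) u / 2"
    by (rule power2_le_imp_le[OF half]) (simp add: pd)
  have "qnorm (H z) y \<le> qnorm (H z) (y - (1/2) *\<^sub>R u) + qnorm (H z) ((1/2) *\<^sub>R u)"
    using qnorm_triangle[OF pd, of "y - (1/2) *\<^sub>R u" "(1/2) *\<^sub>R u"] by simp
  then have "qnorm (H z) y \<le> qnorm (H z) u" using half' by (simp add: qnorm_scaleR)
  moreover have "qnorm (H z) d \<le> qnorm (H z) (d - y) + qnorm (H z) y"
    using qnorm_triangle[OF pd, of "d - y" y] by simp
  ultimately show "qnorm (H z) d \<le> dec z + \<delta>"
    using nu by (simp add: newton_decrement_qnorm dy)
  assume cd: "c \<bullet> d \<le> 0"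
  have "qnorm (H z) (d - (1/2) *\<^sub>R u) \<le> qnorm (H z) (d - y) + qnorm (H z) (y - (1/2) *\<^sub>R u)"
    using qnorm_triangle[OF pd, of "d - y" "y - (1/2) *\<^sub>R u"] by simp
  also have "\<dots> \<le> dec z + qnorm (H z) u / 2" using half' by (simp add: newton_decrement_qnorm dy)
  finally have "(qnorm (H z) (d - (1/2) *\<^sub>R u))\<^sup>2 \<le> (dec z + qnorm (H z) u / 2)\<^sup>2"
    using pd by (intro power_mono) auto
  moreover have "(qnorm (H z) (d - (1/2) *\<^sub>R u))\<^sup>2 = (qnorm (H z) d)\<^sup>2 - c \<bullet> d + (qnorm (H z) u)\<^sup>2 / 4"
    using pd_sym[OF pd, of d u]
    unfolding qnorm_sq_diff[OF pd] qnorm_scaleR power_mult_distrib cu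
    by (simp add: power2_eq_square)
  moreover have "dec z * qnorm (H z) u \<le> dec z * \<delta>"
    using nu pd by (intro mult_left_mono) (auto simp: newton_decrement_qnorm)
  ultimately show "(qnorm (H z) d)\<^sup>2 \<le> (dec z)\<^sup>2 + dec z * \<delta>"
    using cd by (simp add: power2_eq_square algebra_simps)
qed

text \<open>In terms of \<open>a = l s\<close>, \<open>b = l H s\<close> and the linearization error \<open>th\<close> of the gradient, the vector \<open>q\<close> of
  \<open>monotone_residual_bounds\<close> is \<open>c - b + th\<close>, and \<open>q + H\<^sub>+ a = c + th + l (H\<^sub>+ - H) s\<close>. The second claim uses
  the triangle bound with the latter expression. The last two use the Pythagorean bound: for
  \<open>\<delta> \<le> l\<^sup>2 / (1 + l)\<close> all of \<open>a\<close>, \<open>th\<close>, \<open>b\<close> and \<open>c\<close> have norm at most \<open>l\<^sup>2\<close> in the metric of the new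
  point, and \<open>c - b\<close> has norm at most \<open>2 l\<^sup>2\<close>, or \<open>\<surd>2 l\<^sup>2\<close> if \<open>\<langle>c, d\<rangle> \<ge> 0\<close>.\<close>

lemma damped_step:
  defines "l \<equiv> qnorm (H z) d"
  defines "zp \<equiv> z + (1 / (1 + l)) *\<^sub>R d"
  shows "zp \<in> S"
    and "dec zp \<le> l\<^sup>2 * (2 + 2 * l + l\<^sup>2) + (1 + l) * \<delta>"
    and "c \<bullet> d \<ge> 0 \<Longrightarrow> \<delta> \<le> l\<^sup>2 / (1 + l) \<Longrightarrow> (dec zp)\<^sup>2 \<le> (1 + (1 + sqrt 2)\<^sup>2) * (l\<^sup>2)\<^sup>2"
    and "\<delta> \<le> l\<^sup>2 / (1 + l) \<Longrightarrow> (dec zp)\<^sup>2 \<le> 10 * (l\<^sup>2)\<^sup>2"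
proof -
  note pd = H_pd[OF z]
  have l: "0 \<le> l" using pd by (simp add: l_def)
  define s where "s = (1 / (1 + l)) *\<^sub>R d"
  define r where "r = l / (1 + l)"
  have ns: "qnorm (H z) s = r" using l by (simp add: s_def qnorm_scaleR r_def l_def)
  have r: "0 \<le> r" "r < 1" "1 - r = 1 / (1 + l)" using l by (auto simp: r_def field_simps)
  have ns1: "qnorm (H z) s < 1" using ns r by simp
  have zp: "zp = z + s" by (simp add: zp_def s_def)
  show zpS: "zp \<in> S" unfolding zp by (rule Dikin_ellipsoid[OF z ns1])
  note pdp = H_pd[OF zpS]
  have d: "d = (1 + l) *\<^sub>R s" using l by (simp add: s_def)
  define v where "v = newton zp - zp"
  define a where "a = l *\<^sub>R s"
  define q where "q = c - g z - H z *v d + g zp"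
  define b where "b = l *\<^sub>R (H z *v s)"
  define th where "th = g (z + s) - g z - H z *v s"
  have "0 \<le> (t *\<^sub>R (c - g z - H z *v d) - - (t *\<^sub>R (g zp + H zp *v (newton zp - zp)))) \<bullet> (z + d - newton zp)"
    by (intro A_mono incl newton_point_inclusion zpS)
  also have "t *\<^sub>R (c - g z - H z *v d) - - (t *\<^sub>R (g zp + H zp *v (newton zp - zp))) = t *\<^sub>R (q + H zp *v v)"
    by (simp add: q_def v_def algebra_simps)
  also have "z + d - newton zp = a - v"
    by (simp add: a_def v_def zp d algebra_simps)
  finally have "0 \<le> t * ((q + H zp *v v) \<bullet> (a - v))" by simp
  then have mono: "0 \<le> (q + H zp *v v) \<bullet> (a - v)" using t by (simp add: zero_le_mult_iff)
  have decv: "dec zp = qnorm (H zp) v" by (simp add: newton_decrement_qnorm v_def)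
  have up: "dnorm (H zp) x \<le> (1 + l) * dnorm (H z) x" for x
    using dual_norm_comparison[OF z ns1, of x] r(3) by (simp add: zp ns mult.commute)
  have na: "qnorm (H zp) a \<le> l\<^sup>2"
  proof -
    have "(1 - r) * qnorm (H zp) s \<le> r"
      using norm_comparison(2)[OF z ns1, of s] unfolding ns zp .
    then have "qnorm (H zp) s \<le> r / (1 - r)" using r(2) by (simp add: pos_le_divide_eq mult.commute)
    also have "\<dots> = l" using l unfolding r(3) by (simp add: r_def field_simps)
    finally show ?thesis using l by (simp add: a_def qnorm_scaleR power2_eq_square mult_left_mono)
  qed
  have nth: "dnorm (H z) th \<le> r\<^sup>2 / (1 - r)"
    using gradient_linearization_error[OF z ns1] by (simp add: th_def ns)
  have lr2: "(1 + l) * r = l" using l by (simp add: r_def)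
  have "(1 + l) * (r\<^sup>2 / (1 - r)) = ((1 + l) * r)\<^sup>2"
    unfolding r(3) by (simp add: power2_eq_square)
  then have lr: "(1 + l) * (r\<^sup>2 / (1 - r)) = l\<^sup>2" "(1 + l) * r = l" "l * r = l\<^sup>2 / (1 + l)"
    using lr2 by (simp_all add: r_def power2_eq_square)
  have nhd: "dnorm (H z) ((H zp - H z) *v s) \<le> ((1 + l)\<^sup>2 - 1) * r"
  proof (rule dnorm_leI[OF pd])
    have "1 \<le> (1 + l)\<^sup>2" using l by (simp add: one_le_power)
    then show "0 \<le> ((1 + l)\<^sup>2 - 1) * r" using r by simp
    show "((H zp - H z) *v s) \<bullet> w \<le> ((1 + l)\<^sup>2 - 1) * r * qnorm (H z) w" for w
      using Hessian_difference[OF z ns1, of s w] unfolding ns r(3) zp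
      by (simp add: power_one_over mult.assoc abs_le_iff)
  qed
  have qa: "q + H zp *v a = c + th + l *\<^sub>R ((H zp - H z) *v s)"
    by (simp add: q_def a_def th_def zp d matrix_vector_mult_scaleR matrix_vector_mult_diff_rdistrib
         scaleR_right_diff_distrib scaleR_left_distrib matrix_vector_right_distrib)
  have expand: "(1 + l) * ((\<delta> + R) + l * (X * r)) = (1 + l) * \<delta> + (1 + l) * R + l * X * ((1 + l) * r)"
    for R X :: real by (simp add: algebra_simps)
  have "dnorm (H z) (q + H zp *v a) \<le> dnorm (H z) (c + th) + dnorm (H z) (l *\<^sub>R ((H zp - H z) *v s))"
    unfolding qa by (rule dnorm_triangle[OF pd])
  also have "\<dots> \<le> (dnorm (H z) c + dnorm (H z) th) + l * dnorm (H z) ((H zp - H z) *v s)"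
    using dnorm_triangle[OF pd, of c th] l by (simp add: dnorm_scaleR[OF pd])
  also have "\<dots> \<le> (\<delta> + r\<^sup>2 / (1 - r)) + l * (((1 + l)\<^sup>2 - 1) * r)"
    using c nth nhd l by (intro add_mono mult_left_mono)
  finally have "(1 + l) * dnorm (H z) (q + H zp *v a)
      \<le> (1 + l) * ((\<delta> + r\<^sup>2 / (1 - r)) + l * (((1 + l)\<^sup>2 - 1) * r))"
    using l by (intro mult_left_mono) auto
  also have "\<dots> = (1 + l) * \<delta> + (1 + l) * (r\<^sup>2 / (1 - r)) + l * ((1 + l)\<^sup>2 - 1) * ((1 + l) * r)"
    by (rule expand)
  also have "\<dots> = (1 + l) * \<delta> + l\<^sup>2 + l * ((1 + l)\<^sup>2 - 1) * l" by (simp only: lr)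
  finally have "dnorm (H zp) (q + H zp *v a) \<le> (1 + l) * \<delta> + l\<^sup>2 + l * ((1 + l)\<^sup>2 - 1) * l"
    using up[of "q + H zp *v a"] by linarith
  then have "dec zp \<le> l\<^sup>2 + ((1 + l) * \<delta> + l\<^sup>2 + l * ((1 + l)\<^sup>2 - 1) * l)"
    using monotone_residual_bounds(1)[OF pdp mono] na unfolding decv by linarith
  then show "dec zp \<le> l\<^sup>2 * (2 + 2 * l + l\<^sup>2) + (1 + l) * \<delta>"
    by (simp add: power2_eq_square algebra_simps)
  have q: "q = (c - b) + th"
    by (simp add: q_def b_def th_def zp d matrix_vector_mult_scaleR scaleR_left_distrib
         matrix_vector_right_distrib)
  have nb: "dnorm (H z) b = l * r"
    using l by (simp add: b_def dnorm_scaleR[OF pd] dnorm_image[OF pd] ns)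
  have nq: "dnorm (H zp) q \<le> (1 + l) * dnorm (H z) (c - b) + l\<^sup>2"
  proof -
    have "dnorm (H zp) q \<le> (1 + l) * dnorm (H z) q" by (rule up)
    also have "\<dots> \<le> (1 + l) * (dnorm (H z) (c - b) + r\<^sup>2 / (1 - r))"
      using l nth dnorm_triangle[OF pd, of "c - b" th] unfolding q by (intro mult_left_mono) auto
    also have "\<dots> = (1 + l) * dnorm (H z) (c - b) + l\<^sup>2" unfolding distrib_left lr(1) ..
    finally show ?thesis .
  qed
  have final: "(dec zp)\<^sup>2 \<le> (1 + (1 + k)\<^sup>2) * (l\<^sup>2)\<^sup>2" if k: "dnorm (H z) (c - b) \<le> k * (l * r)" for k
  proof -
    have "(1 + l) * dnorm (H z) (c - b) \<le> (1 + l) * (k * (l * r))" using l k by (intro mult_left_mono) auto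
    also have "\<dots> = k * l * ((1 + l) * r)" by (simp only: mult_ac)
    also have "\<dots> = k * l\<^sup>2" unfolding lr(2) by (simp add: power2_eq_square)
    finally have "dnorm (H zp) q \<le> (1 + k) * l\<^sup>2" using nq by (simp add: algebra_simps)
    then have "(dnorm (H zp) q)\<^sup>2 \<le> ((1 + k) * l\<^sup>2)\<^sup>2" using pdp by (intro power_mono) auto
    moreover have "(qnorm (H zp) a)\<^sup>2 \<le> (l\<^sup>2)\<^sup>2" using na pdp by (intro power_mono) auto
    ultimately have "(dec zp)\<^sup>2 \<le> (l\<^sup>2)\<^sup>2 + (1 + k)\<^sup>2 * (l\<^sup>2)\<^sup>2"
      using monotone_residual_bounds(2)[OF pdp mono]
      unfolding decv power_mult_distrib[of "1 + k"] by linarith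
    then show ?thesis unfolding distrib_right mult_1 .
  qed
  assume del: "\<delta> \<le> l\<^sup>2 / (1 + l)"
  then have nc: "dnorm (H z) c \<le> l * r" using c lr(3) by simp
  have "dnorm (H z) (c - b) \<le> 2 * (l * r)"
    using dnorm_triangle_diff[OF pd, of c b] nc nb by simp
  from final[OF this] show "(dec zp)\<^sup>2 \<le> 10 * (l\<^sup>2)\<^sup>2" by simp
  assume cd: "c \<bullet> d \<ge> 0"
  have "(dnorm (H z) (c - b))\<^sup>2 = (dnorm (H z) c)\<^sup>2 - 2 * (l * (c \<bullet> s)) + (dnorm (H z) b)\<^sup>2"
    using qnorm_sq_diff[OF pd, of "matrix_inv (H z) *v c" "matrix_inv (H z) *v b"]
    by (simp add: dnorm_eq_qnorm[OF pd] matrix_vector_mult_diff_distrib pd_inv[OF pd] b_def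
         matrix_vector_mult_scaleR)
  moreover have "0 \<le> l * (c \<bullet> s)" using cd l by (simp add: s_def)
  moreover have "(dnorm (H z) c)\<^sup>2 \<le> (l * r)\<^sup>2" using nc pd by (intro power_mono) auto
  ultimately have "(dnorm (H z) (c - b))\<^sup>2 \<le> (sqrt 2 * (l * r))\<^sup>2"
    using nb by (simp add: power_mult_distrib)
  then have "dnorm (H z) (c - b) \<le> sqrt 2 * (l * r)"
    by (rule power2_le_imp_le) (use l r in auto)
  from final[OF this] show "(dec zp)\<^sup>2 \<le> (1 + (1 + sqrt 2)\<^sup>2) * (l\<^sup>2)\<^sup>2" .
qed

end

end

section \<open>Scalar recursions\<close>

text \<open>The hypothesis says \<open>l / (1 + l) \<le> lam\<close>.\<close>

lemma exact_from_inexact_bound: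
  fixes l lam :: real
  assumes "0 \<le> l" "l \<le> lam + l\<^sup>2 / (1 + l)" "lam < 1"
  shows "l \<le> lam / (1 - lam)"
proof -
  have "l * (1 + l) \<le> (lam + l\<^sup>2 / (1 + l)) * (1 + l)" using assms by (intro mult_right_mono) auto
  also have "\<dots> = lam * (1 + l) + l\<^sup>2" using assms(1) by (simp add: distrib_right)
  finally have "l * (1 - lam) \<le> lam" by (simp add: algebra_simps power2_eq_square)
  then show ?thesis using assms(3) by (simp add: pos_le_divide_eq)
qed

text \<open>The constants are \<open>1 / (1 - 0.21027)\<close> and \<open>0.21027 / (1 - 0.21027)\<close>, rounded up.\<close>

lemma inexact_le_exact:
  fixes l lam :: real
  assumes "0 \<le> l" "0 \<le> lam" "lam \<le> (21027 / 100000)" "l \<le> lam + l\<^sup>2 / (1 + l)"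
  shows "l \<le> (12663 / 10000) * lam" "l \<le> (2663 / 10000)"
proof -
  have "l \<le> lam / (1 - lam)" using assms by (intro exact_from_inexact_bound) auto
  also have "\<dots> \<le> lam / (78973 / 100000)" using assms by (intro divide_left_mono) auto
  also have "\<dots> \<le> (12663 / 10000) * lam" using assms(2) by simp
  finally show "l \<le> (12663 / 10000) * lam" .
  then show "l \<le> (2663 / 10000)" using assms(3) by simp
qed

text \<open>The two alternatives are those of \<open>damped_step\<close>. If the residual points towards the step, then \<open>l\<close>
  can be as large as \<open>lam / (1 - lam)\<close>, but the better factor \<open>1 + (1 + \<surd>2)\<^sup>2 < 7\<close> is available. Otherwise
  the factor is \<open>10\<close>, but \<open>l\<^sup>2 \<le> lam\<^sup>2 / (1 - lam)\<close>. For
  \<open>lam \<le> 0.21027\<close> either case leaves the factor \<open>0.9\<close>.\<close>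

lemma decrement_contraction:
  fixes l lam lam' \<delta> :: real
  assumes "0 \<le> l" "0 \<le> lam" "lam \<le> (21027 / 100000)" and l: "l \<le> lam + \<delta>" and del: "\<delta> \<le> l\<^sup>2 / (1 + l)" and "0 \<le> lam'"
    and alt: "lam'\<^sup>2 \<le> (1 + (1 + sqrt 2)\<^sup>2) * (l\<^sup>2)\<^sup>2
             \<or> l\<^sup>2 \<le> lam\<^sup>2 + lam * \<delta> \<and> lam'\<^sup>2 \<le> 10 * (l\<^sup>2)\<^sup>2"
  shows "lam' \<le> (9 / 10) * lam"
proof -
  have ll: "l \<le> (12663 / 10000) * lam" using inexact_le_exact[of l lam] assms(1-3) l del by linarith
  have small: "lam\<^sup>2 \<le> (21027 / 100000) * lam" using mult_right_mono[OF assms(3,2)] by (simp add: power2_eq_square)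
  have "lam'\<^sup>2 \<le> ((9 / 10) * lam)\<^sup>2"
    using alt
  proof
    assume a: "lam'\<^sup>2 \<le> (1 + (1 + sqrt 2)\<^sup>2) * (l\<^sup>2)\<^sup>2"
    have "l\<^sup>2 \<le> ((12663 / 10000) * lam)\<^sup>2" using ll assms(1) by (intro power_mono)
    also have "\<dots> = (160351569 / 100000000) * lam\<^sup>2" by (simp add: power_mult_distrib power2_eq_square)
    also have "\<dots> \<le> (3372 / 10000) * lam" using small assms(2) by simp
    finally have "(l\<^sup>2)\<^sup>2 \<le> ((3372 / 10000) * lam)\<^sup>2" by (intro power_mono) auto
    moreover have "1 + (1 + sqrt 2)\<^sup>2 \<le> (683 / 100)"
    proof -
      have "sqrt 2 \<le> (14143 / 10000)" by (intro real_le_lsqrt) (auto simp: power2_eq_square)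
      moreover have "(1 + sqrt 2)\<^sup>2 = 3 + 2 * sqrt 2" by (simp add: power2_sum)
      ultimately show ?thesis by simp
    qed
    ultimately have "(1 + (1 + sqrt 2)\<^sup>2) * (l\<^sup>2)\<^sup>2 \<le> (683 / 100) * ((3372 / 10000) * lam)\<^sup>2" by (intro mult_mono) auto
    also have "\<dots> \<le> ((9 / 10) * lam)\<^sup>2" by (simp add: power_mult_distrib power2_eq_square)
    finally show ?thesis using a by linarith
  next
    assume a: "l\<^sup>2 \<le> lam\<^sup>2 + lam * \<delta> \<and> lam'\<^sup>2 \<le> 10 * (l\<^sup>2)\<^sup>2"
    have "l\<^sup>2 / (1 + l) \<le> l\<^sup>2" using assms(1) by (simp add: divide_le_eq mult_le_cancel_left1)
    then have "lam * \<delta> \<le> lam * l\<^sup>2" using del assms(2) by (intro mult_left_mono) auto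
    also have "\<dots> \<le> (21027 / 100000) * l\<^sup>2" using assms(3) by (intro mult_right_mono) auto
    finally have "l\<^sup>2 \<le> (21027 / 100000) * lam + (21027 / 100000) * l\<^sup>2" using a small by linarith
    then have "l\<^sup>2 \<le> (2663 / 10000) * lam" using assms(2) by simp
    then have "(l\<^sup>2)\<^sup>2 \<le> ((2663 / 10000) * lam)\<^sup>2" by (intro power_mono) auto
    then have "lam'\<^sup>2 \<le> 10 * ((2663 / 10000) * lam)\<^sup>2" using a by linarith
    also have "\<dots> \<le> ((9 / 10) * lam)\<^sup>2" by (simp add: power_mult_distrib power2_eq_square)
    finally show ?thesis .
  qed
  then show ?thesis by (rule power2_le_imp_le) (use assms(2) in auto)
qed

text \<open>The equation \<open>c \<beta> = 1\<close> reads \<open>\<beta> (1 + \<beta>) (2 \<beta>\<^sup>2 + 4 \<beta> + 3) = 1\<close>; its positive root lies just above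
  \<open>0.21027\<close>, which is where this constant comes from.\<close>

lemma schedule_ratio_less_1:
  fixes \<beta> :: real
  assumes b: "0 < \<beta>" "\<beta> \<le> (21027 / 100000)"
  defines "c \<equiv> (2 * \<beta>\<^sup>2 + 4 * \<beta> + 3) / (1 - \<beta>\<^sup>2 * (2 * \<beta>\<^sup>2 + 4 * \<beta> + 3))"
  shows "0 < c" "c * \<beta> < 1" "c \<le> 5"
proof -
  define p where "p = 2 * \<beta>\<^sup>2 + 4 * \<beta> + 3"
  have b2: "\<beta>\<^sup>2 \<le> (21027 / 100000)\<^sup>2" using b by (intro power_mono) auto
  then have b2': "\<beta>\<^sup>2 \<le> (442134729 / 10000000000)" by (simp add: power2_eq_square)
  have p: "0 < p" "p \<le> (3929506946 / 1000000000)" using b b2' by (auto simp: p_def intro!: add_pos_pos)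
  have "\<beta>\<^sup>2 * p \<le> (442134729 / 10000000000) * (3929506946 / 1000000000)" using b2' p by (intro mult_mono) auto
  then have bp: "\<beta>\<^sup>2 * p \<le> (17374 / 100000)" by simp
  have "\<beta> * p \<le> (21027 / 100000) * (3929506946 / 1000000000)" using b p by (intro mult_mono) auto
  moreover have "\<beta>\<^sup>2 * p \<le> (442134729 / 10000000000) * (3929506946 / 1000000000)" using b2' p by (intro mult_mono) auto
  ultimately have sum: "\<beta> * p + \<beta>\<^sup>2 * p < 1" by simp
  have c: "c = p / (1 - \<beta>\<^sup>2 * p)" by (simp add: c_def p_def)
  show "0 < c" using p bp by (simp add: c)
  show "c * \<beta> < 1" using sum bp by (simp add: c divide_less_eq algebra_simps)
  show "c \<le> 5" using p bp by (simp add: c divide_le_eq)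
qed

lemma log_log_iterations:
  fixes e :: real
  assumes "0 < e" "e < 1" and j: "nat \<lceil>log 2 (log 2 (1 / e))\<rceil> \<le> j"
  shows "(1 / 2) ^ (2 ^ j) \<le> e"
proof -
  have L: "0 < log 2 (1 / e)" using assms by simp
  have "log 2 (log 2 (1 / e)) \<le> real j" using j by linarith
  then have "2 powr log 2 (log 2 (1 / e)) \<le> 2 powr real j" by (intro powr_mono) auto
  then have "log 2 (1 / e) \<le> 2 ^ j" using L by (simp add: powr_realpow)
  then have "2 powr log 2 (1 / e) \<le> 2 powr real (2 ^ j)" by (intro powr_mono) auto
  then have "1 / e \<le> 2 ^ (2 ^ j)" using assms by (simp add: powr_realpow del: of_nat_power)
  then show ?thesis using assms by (simp add: field_simps power_one_over)
qed

lemma log_log_bigo: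
  "(\<lambda>e. real (k0 + 1 + nat \<lceil>log 2 (log 2 (1 / e))\<rceil>)) \<in> O[at_right 0](\<lambda>e. ln (ln (1 / e)))"
proof -
  have "(\<lambda>e. real (k0 + 1 + nat \<lceil>log 2 (log 2 (1 / e))\<rceil>))
      \<in> O[at_right 0](\<lambda>e. real k0 + 2 + log 2 (log 2 (1 / e)))"
  proof (rule landau_o.big_mono)
    have "\<forall>\<^sub>F e in at_right 0. log 2 (log 2 (1 / e)) \<ge> (0::real)" by real_asymp
    then show "\<forall>\<^sub>F e in at_right 0. norm (real (k0 + 1 + nat \<lceil>log 2 (log 2 (1 / e))\<rceil>))
        \<le> norm (real k0 + 2 + log 2 (log 2 (1 / e)))"
    proof eventually_elim
      case (elim e)
      then have "real (nat \<lceil>log 2 (log 2 (1 / e))\<rceil>) \<le> log 2 (log 2 (1 / e)) + 1" by linarith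
      then show ?case using elim unfolding real_norm_def of_nat_add of_nat_1 by linarith
    qed
  qed
  also have "(\<lambda>e. real k0 + 2 + log 2 (log 2 (1 / e))) \<in> O[at_right 0](\<lambda>e. ln (ln (1 / e)))"
    by real_asymp
  finally show ?thesis .
qed

lemma schedule_recursion:
  fixes c \<beta> :: real and \<beta>s :: "nat \<Rightarrow> real"
  assumes "0 < c" "0 < \<beta>" and s: "\<And>k. \<beta>s k = c ^ (2 ^ k - 1) * \<beta> ^ (2 ^ k)"
  shows "\<beta>s 0 = \<beta>" "\<beta>s (Suc k) = c * (\<beta>s k)\<^sup>2" "0 < \<beta>s k"
proof -
  show "\<beta>s 0 = \<beta>" by (simp add: s)
  show "0 < \<beta>s k" using assms by (simp add: s)
  obtain m where "(2::nat) ^ k = Suc m" using gr0_implies_Suc[of "2 ^ k"] by auto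
  then have "(2::nat) ^ Suc k - 1 = Suc (2 * m)" "(2::nat) ^ k - 1 = m" by simp_all
  then have "c ^ (2 ^ Suc k - 1) = c * (c ^ (2 ^ k - 1))\<^sup>2" by (simp only: power_Suc power_even_eq)
  moreover have "\<beta> ^ (2 ^ Suc k) = (\<beta> ^ 2 ^ k)\<^sup>2" by (simp only: power_Suc power_even_eq)
  ultimately show "\<beta>s (Suc k) = c * (\<beta>s k)\<^sup>2" by (simp add: s power_mult_distrib)
qed

text \<open>The index \<open>k0\<close> has to depend on \<open>\<beta>\<close> and \<open>c\<close> only, not on the run. As long as \<open>lam \<le> 0.21027\<close>, the step
  estimate gives \<open>lam\<^sub>k\<^sub>+\<^sub>1 \<le> 0.64 lam\<^sub>k + 2 \<beta>\<^sub>k\<close>, and it also preserves this bound on \<open>lam\<close>. Together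
  with \<open>\<beta>\<^sub>k\<^sub>+\<^sub>1 \<le> c \<beta> \<beta>\<^sub>k\<close> this makes \<open>lam\<^sub>k + C \<beta>\<^sub>k\<close> decrease geometrically. Once
  \<open>lam\<^sub>k + \<beta>\<^sub>k \<le> 1 / 20\<close>, the quadratic recursion takes over.\<close>

lemma scheduled_decrements_vanish:
  fixes \<beta> c :: real
  assumes b: "0 < \<beta>" "\<beta> \<le> (21027 / 100000)" and c: "0 < c" "c * \<beta> < 1" "c \<le> 5"
  shows "\<exists>k0. \<forall>\<beta>s lam l \<delta> :: nat \<Rightarrow> real.
     \<beta>s 0 = \<beta> \<longrightarrow> (\<forall>k. \<beta>s (Suc k) = c * (\<beta>s k)\<^sup>2) \<longrightarrow> (\<forall>k. \<delta> k = (\<beta>s k)\<^sup>2 / (1 + \<beta>s k)) \<longrightarrow>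
     (\<forall>k. 0 \<le> l k \<and> 0 \<le> lam k) \<longrightarrow> lam 0 \<le> \<beta> \<longrightarrow> (\<forall>k. l k \<le> lam k + \<delta> k) \<longrightarrow>
     (\<forall>k. lam (Suc k) \<le> (l k)\<^sup>2 * (2 + 2 * l k + (l k)\<^sup>2) + (1 + l k) * \<delta> k) \<longrightarrow>
     (\<forall>j. 10 * (lam (k0 + j) + \<beta>s (k0 + j)) \<le> (1 / 2) ^ (2 ^ j))"
proof -
  define \<rho> where "\<rho> = c * \<beta>"
  \<comment> \<open>with this weight, \<open>2 \<beta>\<^sub>k + C \<rho> \<beta>\<^sub>k = C (1 + \<rho>) / 2 \<beta>\<^sub>k\<close>\<close>
  define C where "C = 4 / (1 - \<rho>)"
  define \<kappa> where "\<kappa> = max (64 / 100) ((1 + \<rho>) / 2)"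
  have rho: "0 < \<rho>" "\<rho> < 1" using b c by (auto simp: \<rho>_def)
  have C: "4 \<le> C" "C * (1 - \<rho>) = 4"
    using rho C_def nonzero_eq_divide_eq[of "1 - \<rho>" C 4] by (auto simp: pos_le_divide_eq)
  have kappa: "0 < \<kappa>" "\<kappa> < 1" "(64 / 100) \<le> \<kappa>" "(1 + \<rho>) / 2 \<le> \<kappa>" using rho by (auto simp: \<kappa>_def)
  have "(\<lambda>k. \<kappa> ^ k * (1 + C)) \<longlonglongrightarrow> 0 * (1 + C)"
    using kappa by (intro tendsto_mult LIMSEQ_power_zero tendsto_const) auto
  then have "\<forall>\<^sub>F k in sequentially. \<kappa> ^ k * (1 + C) < 1 / 20"
    by (intro order_tendstoD(2)) auto
  then obtain k0 where k0: "\<kappa> ^ k0 * (1 + C) < 1 / 20" by (auto simp: eventually_sequentially)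
  show ?thesis
  proof (intro exI[of _ k0] allI impI)
    fix \<beta>s lam l \<delta> :: "nat \<Rightarrow> real" and j :: nat
    assume b0: "\<beta>s 0 = \<beta>" and bS: "\<forall>k. \<beta>s (Suc k) = c * (\<beta>s k)\<^sup>2"
      and del: "\<forall>k. \<delta> k = (\<beta>s k)\<^sup>2 / (1 + \<beta>s k)" and nn: "\<forall>k. 0 \<le> l k \<and> 0 \<le> lam k"
      and lam0: "lam 0 \<le> \<beta>" and ll: "\<forall>k. l k \<le> lam k + \<delta> k"
      and step: "\<forall>k. lam (Suc k) \<le> (l k)\<^sup>2 * (2 + 2 * l k + (l k)\<^sup>2) + (1 + l k) * \<delta> k"
    have bpos: "0 < \<beta>s k \<and> \<beta>s k \<le> \<beta>" for k
    proof (induction k)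
      case (Suc k)
      have "\<beta>s (Suc k) = (c * \<beta>s k) * \<beta>s k" using bS by (simp add: power2_eq_square)
      also have "\<dots> \<le> 1 * \<beta>s k"
      proof (rule mult_right_mono)
        have "c * \<beta>s k \<le> c * \<beta>" using Suc c by (intro mult_left_mono) auto
        then show "c * \<beta>s k \<le> 1" using c by linarith
      qed (use Suc in auto)
      finally show ?case using Suc bS c by auto
    qed (use b b0 in auto)
    have bred: "\<beta>s (Suc k) \<le> \<rho> * \<beta>s k" for k
    proof -
      have "\<beta>s (Suc k) = (c * \<beta>s k) * \<beta>s k" using bS by (simp add: power2_eq_square)
      also have "\<dots> \<le> \<rho> * \<beta>s k" unfolding \<rho>_def
        using bpos[of k] c by (intro mult_right_mono mult_left_mono) auto
      finally show ?thesis .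
    qed
    have db: "0 \<le> \<delta> k" "\<delta> k \<le> (\<beta>s k)\<^sup>2" "\<delta> k \<le> (3654 / 100000)" "(\<beta>s k)\<^sup>2 \<le> \<beta>s k" for k
    proof -
      have p: "0 < \<beta>s k" "\<beta>s k \<le> (21027 / 100000)" using bpos[of k] b by auto
      show "0 \<le> \<delta> k" using del p by simp
      show "\<delta> k \<le> (\<beta>s k)\<^sup>2" using del p by (simp add: divide_le_eq mult_le_cancel_left1)
      have sq: "(\<beta>s k)\<^sup>2 \<le> (21027 / 100000) * \<beta>s k" using p by (simp add: power2_eq_square)
      then show "(\<beta>s k)\<^sup>2 \<le> \<beta>s k" using p by linarith
      have "(\<beta>s k)\<^sup>2 \<le> (3654 / 100000) * (1 + \<beta>s k)" using sq p by simp
      then show "\<delta> k \<le> (3654 / 100000)" using del p by (simp add: divide_le_eq)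
    qed
    have key: "lam (Suc k) \<le> (631 / 1000) * l k + (125 / 100) * \<delta> k"
      "lam (Suc k) \<le> (256 / 100) * (l k)\<^sup>2 + (125 / 100) * \<delta> k" "l k \<le> (24681 / 100000)"
      if "lam k \<le> (21027 / 100000)" for k
    proof -
      have l: "0 \<le> l k" "l k \<le> (24681 / 100000)" using nn ll[rule_format, of k] db(3)[of k] that by auto
      then show "l k \<le> (24681 / 100000)" by simp
      have l2: "(l k)\<^sup>2 \<le> (24681 / 100000) * l k" using mult_right_mono[OF l(2,1)] by (simp add: power2_eq_square)
      then have "2 + 2 * l k + (l k)\<^sup>2 \<le> (25546 / 10000)" using l by simp
      then have "(l k)\<^sup>2 * (2 + 2 * l k + (l k)\<^sup>2) \<le> (l k)\<^sup>2 * (25546 / 10000)" by (intro mult_left_mono) auto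
      moreover have "(1 + l k) * \<delta> k \<le> (125 / 100) * \<delta> k" using l db(1)[of k] by (intro mult_right_mono) auto
      ultimately show "lam (Suc k) \<le> (631 / 1000) * l k + (125 / 100) * \<delta> k"
          "lam (Suc k) \<le> (256 / 100) * (l k)\<^sup>2 + (125 / 100) * \<delta> k"
        using step[rule_format, of k] l2 l zero_le_power2[of "l k"] by linarith+
    qed
    have lamB: "lam k \<le> (21027 / 100000)" for k
    proof (induction k)
      case (Suc k)
      have l: "0 \<le> l k" "l k \<le> (24681 / 100000)" using key[OF Suc] nn by auto
      have "(1 + l k) * \<delta> k \<le> (124681 / 100000) * (3654 / 100000)" using l db(1,3)[of k] by (intro mult_mono) auto
      moreover have "lam (Suc k) \<le> (631 / 1000) * l k + (125 / 100) * \<delta> k" using key[OF Suc] by simp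
      ultimately show ?case using l db(3)[of k] by simp
    qed (use lam0 b in auto)
    have contr: "lam k + C * \<beta>s k \<le> \<kappa> ^ k * (1 + C)" for k
    proof (induction k)
      case 0
      have "\<beta>s 0 \<le> 1" "lam 0 \<le> 1" using b b0 lam0 by auto
      then have "C * \<beta>s 0 \<le> C * 1" using C by (intro mult_left_mono) auto
      then show ?case using \<open>lam 0 \<le> 1\<close> by simp
    next
      case (Suc k)
      have "lam (Suc k) \<le> (631 / 1000) * lam k + (1881 / 1000) * \<delta> k"
        using key[OF lamB, of k] ll[rule_format, of k] by linarith
      also have "\<dots> \<le> (64 / 100) * lam k + 2 * \<beta>s k"
        using db[of k] nn[rule_format, of k] by linarith
      also have "\<dots> \<le> \<kappa> * lam k + 2 * \<beta>s k"
        using kappa nn[rule_format, of k] by (intro add_right_mono mult_right_mono) auto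
      finally have "lam (Suc k) + C * \<beta>s (Suc k) \<le> \<kappa> * lam k + (2 * \<beta>s k + C * (\<rho> * \<beta>s k))"
        using mult_left_mono[OF bred[of k], of C] C by linarith
      also have "2 * \<beta>s k + C * (\<rho> * \<beta>s k) = C * ((1 + \<rho>) / 2) * \<beta>s k"
        using C(2) by (simp add: algebra_simps) algebra
      also have "\<kappa> * lam k + C * ((1 + \<rho>) / 2) * \<beta>s k \<le> \<kappa> * lam k + C * \<kappa> * \<beta>s k"
        using kappa C bpos[of k] by (intro add_left_mono mult_right_mono mult_left_mono) auto
      also have "\<dots> = \<kappa> * (lam k + C * \<beta>s k)" by (simp add: algebra_simps)
      also have "\<dots> \<le> \<kappa> * (\<kappa> ^ k * (1 + C))" using Suc kappa by (intro mult_left_mono) auto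
      finally show ?case by simp
    qed
    show "10 * (lam (k0 + j) + \<beta>s (k0 + j)) \<le> (1 / 2) ^ (2 ^ j)"
    proof (induction j)
      case 0
      have "\<beta>s k0 \<le> C * \<beta>s k0" using C bpos[of k0] by (simp add: mult_le_cancel_right1)
      then show ?case using contr[of k0] k0 by simp
    next
      case (Suc j)
      let ?k = "k0 + j"
      define y where "y = lam ?k + \<beta>s ?k"
      have y: "0 \<le> y" using nn bpos[of ?k] by (simp add: y_def)
      have "l ?k \<le> y" using ll[rule_format, of ?k] db[of ?k] by (simp add: y_def)
      then have "(l ?k)\<^sup>2 \<le> y\<^sup>2" using nn by (intro power_mono) auto
      moreover have "(\<beta>s ?k)\<^sup>2 \<le> y\<^sup>2" using nn bpos[of ?k] by (intro power_mono) (auto simp: y_def)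
      moreover have "c * (\<beta>s ?k)\<^sup>2 \<le> 5 * (\<beta>s ?k)\<^sup>2" using c by (intro mult_right_mono) auto
      moreover have "lam (Suc ?k) \<le> (256 / 100) * (l ?k)\<^sup>2 + (125 / 100) * (\<beta>s ?k)\<^sup>2"
        using key[OF lamB, of ?k] db[of ?k] by linarith
      ultimately have "lam (Suc ?k) + \<beta>s (Suc ?k) \<le> 10 * y\<^sup>2"
        using bS[rule_format, of ?k] zero_le_power2[of y] by linarith
      then have "10 * (lam (Suc ?k) + \<beta>s (Suc ?k)) \<le> (10 * y)\<^sup>2" by (simp add: power2_eq_square)
      also have "\<dots> \<le> ((1 / 2) ^ (2 ^ j))\<^sup>2" using Suc y by (intro power_mono) (auto simp: y_def)
      also have "\<dots> = (1 / 2) ^ (2 ^ Suc j)" by (simp add: power_mult[symmetric] mult.commute)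
      finally show ?case by simp
    qed
  qed
qed

section \<open>Runs of the scheme\<close>

locale dgn_run = barrier_inclusion +
  fixes \<delta> :: "nat \<Rightarrow> real" and z zt :: "nat \<Rightarrow> real^'a"
  assumes z0: "z 0 \<in> S"
    and approx: "newton_approx F A t (\<delta> k) (z k) (zt (Suc k))"
    and update: "z (Suc k) = (1 - 1 / (1 + inexact_decrement F z zt k)) *\<^sub>R z k
                   + (1 / (1 + inexact_decrement F z zt k)) *\<^sub>R zt (Suc k)"
begin

abbreviation l :: "nat \<Rightarrow> real" where "l \<equiv> inexact_decrement F z zt"

lemma l_qnorm: "l k = qnorm (H (z k)) (zt (Suc k) - z k)"
  by (simp add: inexact_decrement_def local_norm_qnorm)

lemma update': "z (Suc k) = z k + (1 / (1 + l k)) *\<^sub>R (zt (Suc k) - z k)"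
  unfolding update by (simp add: algebra_simps)

lemma residual:
  assumes "z k \<in> S"
  shows "\<exists>c. dnorm (H (z k)) c \<le> \<delta> k \<and>
     t *\<^sub>R (c - g (z k) - H (z k) *v (zt (Suc k) - z k)) \<in> A (z k + (zt (Suc k) - z k))"
  using newton_approxD[OF assms approx] by simp

lemma iterate_in_S: "z k \<in> S"
proof (induction k)
  case (Suc k)
  obtain c where c: "dnorm (H (z k)) c \<le> \<delta> k"
    "t *\<^sub>R (c - g (z k) - H (z k) *v (zt (Suc k) - z k)) \<in> A (z k + (zt (Suc k) - z k))"
    using residual[OF Suc] by blast
  show ?case using damped_step(1)[OF Suc c] unfolding update' l_qnorm .
qed (rule z0)

lemma l_nonneg: "0 \<le> l k"
  unfolding l_qnorm using H_pd[OF iterate_in_S] by simp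

lemma dec_nonneg: "0 \<le> dec (z k)"
  unfolding newton_decrement_qnorm using H_pd[OF iterate_in_S] by simp

lemma
  shows l_le: "l k \<le> dec (z k) + \<delta> k"
    and dec_Suc: "dec (z (Suc k)) \<le> (l k)\<^sup>2 * (2 + 2 * l k + (l k)\<^sup>2) + (1 + l k) * \<delta> k"
    and dec_Suc_alternatives: "\<delta> k \<le> (l k)\<^sup>2 / (1 + l k) \<Longrightarrow>
       (dec (z (Suc k)))\<^sup>2 \<le> (1 + (1 + sqrt 2)\<^sup>2) * ((l k)\<^sup>2)\<^sup>2 \<or>
       (l k)\<^sup>2 \<le> (dec (z k))\<^sup>2 + dec (z k) * \<delta> k \<and> (dec (z (Suc k)))\<^sup>2 \<le> 10 * ((l k)\<^sup>2)\<^sup>2"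
proof -
  obtain c where c: "dnorm (H (z k)) c \<le> \<delta> k"
    "t *\<^sub>R (c - g (z k) - H (z k) *v (zt (Suc k) - z k)) \<in> A (z k + (zt (Suc k) - z k))"
    using residual[OF iterate_in_S] by blast
  note S = iterate_in_S[of k]
  show "l k \<le> dec (z k) + \<delta> k" unfolding l_qnorm by (rule inexact_point_error(1)[OF S c])
  show "dec (z (Suc k)) \<le> (l k)\<^sup>2 * (2 + 2 * l k + (l k)\<^sup>2) + (1 + l k) * \<delta> k"
    unfolding update' unfolding l_qnorm by (rule damped_step(2)[OF S c])
  assume del: "\<delta> k \<le> (l k)\<^sup>2 / (1 + l k)"
  show "(dec (z (Suc k)))\<^sup>2 \<le> (1 + (1 + sqrt 2)\<^sup>2) * ((l k)\<^sup>2)\<^sup>2 \<or>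
       (l k)\<^sup>2 \<le> (dec (z k))\<^sup>2 + dec (z k) * \<delta> k \<and> (dec (z (Suc k)))\<^sup>2 \<le> 10 * ((l k)\<^sup>2)\<^sup>2"
  proof (cases "c \<bullet> (zt (Suc k) - z k) \<ge> 0")
    case True
    then show ?thesis
      using damped_step(3)[OF S c] del unfolding update' unfolding l_qnorm by blast
  next
    case False
    then have "c \<bullet> (zt (Suc k) - z k) \<le> 0" by simp
    then show ?thesis
      using damped_step(4)[OF S c] inexact_point_error(2)[OF S c] del
      unfolding update' unfolding l_qnorm by blast
  qed
qed

end

locale adaptive_dgn_run = dgn_run +
  assumes adaptive: "\<delta> k \<le> (l k)\<^sup>2 / (1 + l k)"
begin

lemma dec_Suc_adaptive: "dec (z (Suc k)) \<le> (l k)\<^sup>2 * (3 + 2 * l k + (l k)\<^sup>2)"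
proof -
  have "(1 + l k) * \<delta> k \<le> (l k)\<^sup>2"
    using adaptive[of k] l_nonneg[of k] by (simp add: pos_le_divide_eq mult.commute)
  then show ?thesis using dec_Suc[of k] by (simp add: algebra_simps)
qed

lemma l_le_adaptive: "l k \<le> dec (z k) + (l k)\<^sup>2 / (1 + l k)"
  using l_le[of k] adaptive[of k] by linarith

lemma l_Suc_adaptive:
  assumes lt: "(l k)\<^sup>2 * (2 * (l k)\<^sup>2 + 4 * l k + 3) < 1"
  shows "l (Suc k) \<le> (2 * (l k)\<^sup>2 + 4 * l k + 3) / (1 - (l k)\<^sup>2 * (2 * (l k)\<^sup>2 + 4 * l k + 3)) * (l k)\<^sup>2"
proof -
  let ?p = "(l k)\<^sup>2 * (2 * (l k)\<^sup>2 + 4 * l k + 3)"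
  have "(l k)\<^sup>2 * (3 + 2 * l k + (l k)\<^sup>2) \<le> ?p"
    using l_nonneg[of k] by (intro mult_left_mono) auto
  then have "l (Suc k) \<le> ?p + (l (Suc k))\<^sup>2 / (1 + l (Suc k))"
    using dec_Suc_adaptive[of k] l_le_adaptive[of "Suc k"] by linarith
  from exact_from_inexact_bound[OF l_nonneg this lt] show ?thesis by (simp add: mult.commute)
qed

context
  fixes \<beta> :: real
  assumes \<beta>: "\<beta> \<le> 0.21027" and start: "dec (z 0) \<le> \<beta>"
begin

lemma dec_geometric: "dec (z k) \<le> \<beta> \<and> dec (z k) \<le> (9 / 10) ^ k * dec (z 0)"
proof (induction k)
  case (Suc k)
  have small: "dec (z k) \<le> 21027 / 100000" using Suc \<beta> by simp
  have "dec (z (Suc k)) \<le> (9 / 10) * dec (z k)"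
    by (rule decrement_contraction[OF l_nonneg dec_nonneg small l_le adaptive dec_nonneg
          dec_Suc_alternatives[OF adaptive]])
  then show ?case using Suc dec_nonneg[of k] by auto
qed (use start in auto)

lemma dec_bound: "dec (z k) \<le> 21027 / 100000"
  using dec_geometric[of k] \<beta> by simp

lemma l_bounds: "l k \<le> (12663 / 10000) * dec (z k)" "l k \<le> 2663 / 10000"
  using inexact_le_exact[OF l_nonneg dec_nonneg dec_bound l_le_adaptive, of k] by auto

lemma dec_tendsto_0: "(\<lambda>k. dec (z k)) \<longlonglongrightarrow> 0"
proof (rule tendsto_sandwich[of "\<lambda>_. 0"])
  have "(\<lambda>k. (9 / 10 :: real) ^ k * dec (z 0)) \<longlonglongrightarrow> 0 * dec (z 0)"
    by (intro tendsto_mult LIMSEQ_power_zero tendsto_const) auto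
  then show "(\<lambda>k. (9 / 10) ^ k * dec (z 0)) \<longlonglongrightarrow> 0" by simp
qed (use dec_geometric dec_nonneg in auto)

lemma dec_quadratic: "converges_quadratically (\<lambda>k. dec (z k))"
  unfolding converges_quadratically_def
proof (intro conjI dec_tendsto_0 exI[of _ 7] allI)
  fix k
  have l2: "(l k)\<^sup>2 \<le> ((12663 / 10000) * dec (z k))\<^sup>2"
    using l_nonneg[of k] l_bounds(1)[of k] by (intro power_mono)
  have "(l k)\<^sup>2 \<le> (2663 / 10000)\<^sup>2" using l_nonneg[of k] l_bounds(2)[of k] by (intro power_mono)
  then have "3 + 2 * l k + (l k)\<^sup>2 \<le> 4" using l_bounds(2)[of k] by (simp add: power2_eq_square)
  then have "(l k)\<^sup>2 * (3 + 2 * l k + (l k)\<^sup>2) \<le> (l k)\<^sup>2 * 4" by (intro mult_left_mono) auto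
  then have "dec (z (Suc k)) \<le> ((12663 / 10000) * dec (z k))\<^sup>2 * 4"
    using dec_Suc_adaptive[of k] l2 by linarith
  also have "\<dots> \<le> 7 * (dec (z k))\<^sup>2" by (simp add: power_mult_distrib power2_eq_square)
  finally show "\<bar>dec (z (Suc k))\<bar> \<le> 7 * (dec (z k))\<^sup>2" using dec_nonneg by simp
qed

lemma inexact_quadratic: "converges_quadratically l"
  unfolding converges_quadratically_def
proof (intro conjI exI[of _ 9] allI)
  have "(\<lambda>k. (12663 / 10000) * dec (z k)) \<longlonglongrightarrow> (12663 / 10000) * 0"
    by (intro tendsto_mult tendsto_const dec_tendsto_0)
  then show "l \<longlonglongrightarrow> 0"
    using l_nonneg l_bounds(1)
    by (intro tendsto_sandwich[of "\<lambda>_. 0" l _ "\<lambda>k. (12663 / 10000) * dec (z k)"]) auto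
  fix k
  define p where "p = 2 * (l k)\<^sup>2 + 4 * l k + 3"
  have l2: "(l k)\<^sup>2 \<le> (2663 / 10000)\<^sup>2" using l_nonneg[of k] l_bounds(2)[of k] by (intro power_mono)
  then have p: "0 \<le> p" "p \<le> 5" using l_nonneg[of k] l_bounds(2)[of k]
    by (auto simp: p_def power2_eq_square)
  have "(l k)\<^sup>2 * p \<le> (2663 / 10000)\<^sup>2 * 5" using l2 p by (intro mult_mono) auto
  then have lp: "(l k)\<^sup>2 * p \<le> 4 / 10" by (simp add: power2_eq_square)
  have "l (Suc k) \<le> p / (1 - (l k)\<^sup>2 * p) * (l k)\<^sup>2"
    unfolding p_def by (rule l_Suc_adaptive) (use lp in \<open>simp add: p_def\<close>)
  also have "p / (1 - (l k)\<^sup>2 * p) \<le> 9"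
    using p lp by (simp add: divide_le_eq)
  then have "p / (1 - (l k)\<^sup>2 * p) * (l k)\<^sup>2 \<le> 9 * (l k)\<^sup>2" by (intro mult_right_mono) auto
  finally show "\<bar>l (Suc k)\<bar> \<le> 9 * (l k)\<^sup>2" using l_nonneg by simp
qed

end

end

text \<open>The inexact Newton point carries the element \<open>t (c - g - H d)\<close> of \<open>A\<close>. Its dual norm at \<open>z\<close> is at most
  \<open>t (\<delta> + \<surd>\<nu> + l)\<close>, and passing to the norm at the inexact Newton point costs the factor \<open>1 / (1 - l)\<close>. The
  value of \<open>t\<close> compensates for this when \<open>l\<close> and \<open>\<delta>\<close> are at most \<open>e / 10\<close>.\<close>

lemma (in dgn_run) eps_solution_if_small:
  assumes S: "S = interior Z" and nu: "\<And>x u. x \<in> S \<Longrightarrow> 2 * (g x \<bullet> u) - (local_norm F x u)\<^sup>2 \<le> \<nu>"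
    and e: "0 < e" "e < 1 / 4" and eps: "0 < \<epsilon>"
    and t_def: "t = (1 - 2 * e\<^sup>2) * inverse (sqrt \<nu> * (1 + e) + e + 3 * e\<^sup>2) * \<epsilon>"
    and small: "l k \<le> e / 10" "\<delta> k \<le> e / 10"
  shows "eps_solution Z F A \<epsilon> (zt (Suc k))"
proof -
  note zS = iterate_in_S[of k]
  note pd = H_pd[OF zS]
  define d where "d = zt (Suc k) - z k"
  have zt: "zt (Suc k) = z k + d" by (simp add: d_def)
  have ld: "l k = qnorm (H (z k)) d" by (simp add: l_qnorm d_def)
  obtain c where c: "dnorm (H (z k)) c \<le> \<delta> k" "t *\<^sub>R (c - g (z k) - H (z k) *v d) \<in> A (zt (Suc k))"
    using residual[OF zS] unfolding d_def by auto
  have l1: "qnorm (H (z k)) d < 1" using small e unfolding ld by simp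
  have ztS: "zt (Suc k) \<in> S" unfolding zt by (rule Dikin_ellipsoid[OF zS l1])
  let ?u = "matrix_inv (H (z k)) *v g (z k)"
  have "(dnorm (H (z k)) (g (z k)))\<^sup>2 \<le> \<nu>"
    using nu[OF zS, of ?u] dnorm_sq[OF pd, of "g (z k)"] dnorm_eq_qnorm[OF pd, of "g (z k)"]
    unfolding local_norm_qnorm by simp
  then have gnu: "dnorm (H (z k)) (g (z k)) \<le> sqrt \<nu>" by (rule real_le_rsqrt)
  have nu0: "0 \<le> sqrt \<nu>" using gnu dnorm_nonneg[OF pd, of "g (z k)"] by linarith
  define a where "a = t *\<^sub>R (c - g (z k) - H (z k) *v d)"
  have "dnorm (H (z k)) a = t * dnorm (H (z k)) (c - g (z k) - H (z k) *v d)"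
    using t by (simp add: a_def dnorm_scaleR[OF pd])
  also have "dnorm (H (z k)) (c - g (z k) - H (z k) *v d)
      \<le> dnorm (H (z k)) c + dnorm (H (z k)) (g (z k)) + dnorm (H (z k)) (H (z k) *v d)"
    using dnorm_triangle_diff[OF pd, of "c - g (z k)" "H (z k) *v d"] dnorm_triangle_diff[OF pd, of c "g (z k)"]
    by linarith
  also have "\<dots> \<le> sqrt \<nu> + e / 5"
    using c(1) gnu small unfolding dnorm_image[OF pd] ld[symmetric] by simp
  finally have na: "dnorm (H (z k)) a \<le> t * (sqrt \<nu> + e / 5)" using t by (simp add: mult_left_mono)
  define D where "D = sqrt \<nu> * (1 + e) + e + 3 * e\<^sup>2"
  have D: "0 < D" unfolding D_def using nu0 e by (intro add_nonneg_pos add_nonneg_pos[THEN less_imp_le]) auto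
  have "dnorm (H (zt (Suc k))) a \<le> dnorm (H (z k)) a / (1 - l k)"
    unfolding zt ld by (rule dual_norm_comparison[OF zS l1])
  also have "\<dots> \<le> t * (sqrt \<nu> + e / 5) / (1 - e / 10)"
    using na small e t nu0 dnorm_nonneg[OF pd, of a] by (intro frac_le) auto
  also have "\<dots> \<le> t * D"
  proof -
    have "e / 5 \<le> e * (1 - e / 10)" using e by (simp add: field_simps)
    moreover have "1 \<le> (1 + e) * (1 - e / 10)" using e by (simp add: field_simps)
    then have "sqrt \<nu> * 1 \<le> sqrt \<nu> * ((1 + e) * (1 - e / 10))" using nu0 by (intro mult_left_mono)
    moreover have "0 \<le> 3 * e\<^sup>2 * (1 - e / 10)" using e by simp
    ultimately have "sqrt \<nu> + e / 5 \<le> D * (1 - e / 10)" by (simp add: D_def algebra_simps)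
    then have "t * (sqrt \<nu> + e / 5) \<le> t * (D * (1 - e / 10))" using t by (intro mult_left_mono) auto
    then show ?thesis using e by (simp add: pos_divide_le_eq mult.assoc)
  qed
  also have "\<dots> = (1 - 2 * e\<^sup>2) * \<epsilon>" using D unfolding t_def D_def[symmetric] by simp
  also have "\<dots> \<le> \<epsilon>" using eps e by (simp add: algebra_simps)
  finally have "dnorm (H (zt (Suc k))) a \<le> \<epsilon>" .
  then have "local_dist F (zt (Suc k)) (A (zt (Suc k))) \<le> ereal \<epsilon>"
    unfolding local_dist_def dual_local_norm_dnorm
    using c(2) by (intro INF_lower2[of a]) (auto simp: a_def)
  then show ?thesis using ztS by (simp add: eps_solution_def S)
qed

text \<open>The derivatives in the definition of self-concordance are given along lines; they are identified here with
  the forms of the gradient and the Hessian, whose values on the line determine them.\<close>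

lemma self_concordant_of_barrier:
  fixes Z :: "(real^'n) set"
  assumes Z: "convex Z"
    and barrier: "self_concordant_barrier Z \<nu> F"
    and hess: "\<forall>z\<in>interior Z. F differentiable (at z) \<and> gradient F differentiable (at z)
                 \<and> positive_definite (hessian F z)"
  shows "self_concordant (interior Z) F (gradient F) (hessian F)"
proof
  show "open (interior Z)" "convex (interior Z)" using Z by (auto intro: convex_interior)
  fix x assume x: "x \<in> interior Z"
  show "(F has_derivative (\<lambda>h. gradient F x \<bullet> h)) (at x)" using hess x by (intro has_derivative_gradient) auto
  show "(gradient F has_derivative (\<lambda>h. hessian F x *v h)) (at x)" using hess x by (intro has_derivative_hessian) auto
  show pd: "positive_definite (hessian F x)" using hess x by auto
  fix v
  define I where "I = {\<tau>. x + \<tau> *\<^sub>R v \<in> interior Z}"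
  obtain \<phi>1 \<phi>2 \<phi>3 where phi: "\<And>\<tau>. \<tau> \<in> I \<Longrightarrow> ((\<lambda>\<tau>. F (x + \<tau> *\<^sub>R v)) has_real_derivative \<phi>1 \<tau>) (at \<tau>)
      \<and> (\<phi>1 has_real_derivative \<phi>2 \<tau>) (at \<tau>) \<and> (\<phi>2 has_real_derivative \<phi>3 \<tau>) (at \<tau>)
      \<and> \<bar>\<phi>3 \<tau>\<bar> \<le> 2 * \<phi>2 \<tau> powr (3/2)"
    using barrier x unfolding self_concordant_barrier_def standard_self_concordant_on_def Let_def I_def by meson
  have openI: "open I"
  proof -
    have "open ((\<lambda>\<tau>. x + \<tau> *\<^sub>R v) -` interior Z)" by (intro open_vimage continuous_intros) auto
    then show ?thesis by (simp add: I_def vimage_def)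
  qed
  have zI: "0 \<in> I" using x by (simp add: I_def)
  have p1: "\<phi>1 \<tau> = gradient F (x + \<tau> *\<^sub>R v) \<bullet> v" if "\<tau> \<in> I" for \<tau>
  proof (rule DERIV_unique)
    show "((\<lambda>\<tau>. F (x + \<tau> *\<^sub>R v)) has_real_derivative gradient F (x + \<tau> *\<^sub>R v) \<bullet> v) (at \<tau>)"
      using hess that by (intro has_derivative_along_line has_derivative_gradient) (auto simp: I_def)
  qed (use phi[OF that] in blast)
  have p2: "\<phi>2 \<tau> = (hessian F (x + \<tau> *\<^sub>R v) *v v) \<bullet> v" if "\<tau> \<in> I" for \<tau>
  proof (rule DERIV_unique)
    have "((\<lambda>\<tau>. gradient F (x + \<tau> *\<^sub>R v) \<bullet> v) has_real_derivative (hessian F (x + \<tau> *\<^sub>R v) *v v) \<bullet> v) (at \<tau>)"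
      using hess that
      by (intro has_derivative_along_line[OF has_derivative_inner_left[OF has_derivative_hessian]])
         (auto simp: I_def)
    then show "(\<phi>1 has_real_derivative (hessian F (x + \<tau> *\<^sub>R v) *v v) \<bullet> v) (at \<tau>)"
      by (rule has_field_derivative_transform_within_open[OF _ openI that]) (simp add: p1)
  qed (use phi[OF that] in blast)
  have "((\<lambda>\<tau>. (hessian F (x + \<tau> *\<^sub>R v) *v v) \<bullet> v) has_real_derivative \<phi>3 0) (at 0)"
    by (rule has_field_derivative_transform_within_open[OF _ openI zI, of \<phi>2]) (use phi[OF zI] p2 in auto)
  moreover have "\<phi>2 0 powr (3/2) = qnorm (hessian F x) v ^ 3"
  proof (cases "\<phi>2 0 = 0")
    case False
    then have pos: "\<phi>2 0 > 0" using p2[OF zI] pd_nonneg[OF pd, of v] by simp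
    have "\<phi>2 0 powr (3/2) = (\<phi>2 0 powr (1/2)) ^ 3" using pos by (simp flip: powr_numeral add: powr_powr)
    also have "\<phi>2 0 powr (1/2) = qnorm (hessian F x) v"
      using pos p2[OF zI] by (simp add: qnorm_def powr_half_sqrt)
    finally show ?thesis .
  qed (use p2[OF zI] in \<open>simp add: qnorm_def\<close>)
  ultimately show "\<exists>T. ((\<lambda>\<tau>. (hessian F (x + \<tau> *\<^sub>R v) *v v) \<bullet> v) has_real_derivative T) (at 0)
      \<and> \<bar>T\<bar> \<le> 2 * qnorm (hessian F x) v ^ 3"
    using phi[OF zI] by metis
next
  fix x assume x: "x \<in> closure (interior Z)" "x \<notin> interior Z"
  then have "x \<in> frontier Z" using closure_mono[OF interior_subset[of Z]] by (auto simp: frontier_def)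
  then show "filterlim F at_top (at x within interior Z)"
    using barrier by (simp add: self_concordant_barrier_def)
qed

theorem theorem3:
  fixes Z :: "(real^'n) set" and F :: "real^'n \<Rightarrow> real" and \<nu> :: real
    and A :: "real^'n \<Rightarrow> (real^'n) set"
  assumes Z: "Z \<noteq> {}" "closed Z" "convex Z"
    and barrier: "self_concordant_barrier Z \<nu> F"
    and hess: "\<forall>z\<in>interior Z. F differentiable (at z) \<and> gradient F differentiable (at z)
                 \<and> positive_definite (hessian F z)"
    and A: "maximally_monotone A"
    and dom_int: "interior Z \<inter> op_dom A \<noteq> {}"
    and dom_oc: "open (op_dom A) \<or> closed (op_dom A)"
    and sol: "inclusion_solutions Z A \<noteq> {}"
    and horizon: "\<forall>\<omega>\<in>horizon_cone (interior Z \<inter> op_dom A). \<omega> \<noteq> 0 \<longrightarrow>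
                    (\<exists>zh\<in>interior Z \<inter> op_dom A. \<exists>ah\<in>A zh. ah \<bullet> \<omega> > 0)"
  shows
    "(\<forall>t>0.
        (\<forall>\<delta> z zt. dgn_sequence Z F A t \<delta> z zt \<and> adaptive_tolerance F \<delta> z zt \<longrightarrow>
           (\<forall>k. let l = inexact_decrement F z zt k in
                  l\<^sup>2 * (2 * l\<^sup>2 + 4 * l + 3) < 1 \<longrightarrow>
                  inexact_decrement F z zt (Suc k)
                    \<le> (2 * l\<^sup>2 + 4 * l + 3) / (1 - l\<^sup>2 * (2 * l\<^sup>2 + 4 * l + 3)) * l\<^sup>2) \<and>
           (\<forall>\<beta>. 0 < \<beta> \<and> \<beta> \<le> 0.21027 \<and> z 0 \<in> newton_neighborhood Z F A t \<beta> \<longrightarrow>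
                  (\<forall>k. z k \<in> newton_neighborhood Z F A t \<beta>))))
   \<and> (\<forall>t>0. \<forall>\<beta>. 0 < \<beta> \<and> \<beta> \<le> 0.21027 \<longrightarrow>
        quadratic_convergence_region
          {z. \<exists>\<delta> zt. dgn_sequence Z F A t \<delta> z zt \<and> adaptive_tolerance F \<delta> z zt}
          (newton_decrement F A t) (newton_neighborhood Z F A t \<beta>) \<and>
        (\<forall>\<delta> z zt. dgn_sequence Z F A t \<delta> z zt \<and> adaptive_tolerance F \<delta> z zt
             \<and> z 0 \<in> newton_neighborhood Z F A t \<beta> \<longrightarrow>
           converges_quadratically (inexact_decrement F z zt)))
   \<and> (\<forall>\<beta>. 0 < \<beta> \<and> \<beta> \<le> 0.21027 \<longrightarrow>
        (\<exists>K :: real \<Rightarrow> nat.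
           (\<lambda>e. real (K e)) \<in> O[at_right 0](\<lambda>e. ln (ln (1 / e))) \<and>
           (\<exists>e0>0. \<forall>e \<epsilon> t cbar. \<forall>\<beta>s \<delta> :: nat \<Rightarrow> real. \<forall>z zt.
              0 < e \<and> e < \<beta> \<and> e < e0 \<and> \<epsilon> > 0
              \<and> t = (1 - 2 * e\<^sup>2) * inverse (sqrt \<nu> * (1 + e) + e + 3 * e\<^sup>2) * \<epsilon>
              \<and> cbar = (2 * \<beta>\<^sup>2 + 4 * \<beta> + 3) / (1 - \<beta>\<^sup>2 * (2 * \<beta>\<^sup>2 + 4 * \<beta> + 3))
              \<and> (\<forall>k. \<beta>s k = cbar ^ (2 ^ k - 1) * \<beta> ^ (2 ^ k))
              \<and> (\<forall>k. \<delta> k = inverse (1 + \<beta>s k) * (\<beta>s k)\<^sup>2)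
              \<and> dgn_sequence Z F A t \<delta> z zt
              \<and> z 0 \<in> newton_neighborhood Z F A t \<beta> \<longrightarrow>
              (\<forall>k\<ge>K e. eps_solution Z F A \<epsilon> (zt k)))))"
proof -
  note sc = self_concordant_of_barrier[OF Z(3) barrier hess]
  have run: "dgn_run (interior Z) F A t \<delta> z zt"
    if "0 < t" "dgn_sequence Z F A t \<delta> z zt" for t \<delta> z zt
    using that sc A unfolding dgn_sequence_def Let_def
    by (intro dgn_run.intro barrier_inclusion.intro barrier_inclusion_axioms.intro dgn_run_axioms.intro) auto
  have adaptive: "adaptive_dgn_run (interior Z) F A t \<delta> z zt"
    if "0 < t" "dgn_sequence Z F A t \<delta> z zt \<and> adaptive_tolerance F \<delta> z zt" for t \<delta> z zt
    using run[of t \<delta> z zt] that unfolding adaptive_tolerance_def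
    by (intro adaptive_dgn_run.intro adaptive_dgn_run_axioms.intro) auto
  have neighborhood: "(\<forall>k. z k \<in> newton_neighborhood Z F A t \<beta>)
       \<and> converges_quadratically (\<lambda>k. newton_decrement F A t (z k))
       \<and> converges_quadratically (inexact_decrement F z zt)"
    if t: "0 < t" and seq: "dgn_sequence Z F A t \<delta> z zt \<and> adaptive_tolerance F \<delta> z zt"
      and \<beta>: "\<beta> \<le> 0.21027" and init: "z 0 \<in> newton_neighborhood Z F A t \<beta>" for t \<beta> \<delta> z zt
  proof -
    interpret adaptive_dgn_run "interior Z" F A t \<delta> z zt by (rule adaptive[OF t seq])
    have start: "newton_decrement F A t (z 0) \<le> \<beta>" using init by (simp add: newton_neighborhood_def)
    show ?thesis
      using dec_geometric[OF \<beta> start] iterate_in_S dec_quadratic[OF \<beta> start] inexact_quadratic[OF \<beta> start]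
      by (auto simp: newton_neighborhood_def)
  qed
  have a: "let l = inexact_decrement F z zt k in
        l\<^sup>2 * (2 * l\<^sup>2 + 4 * l + 3) < 1 \<longrightarrow>
        inexact_decrement F z zt (Suc k)
          \<le> (2 * l\<^sup>2 + 4 * l + 3) / (1 - l\<^sup>2 * (2 * l\<^sup>2 + 4 * l + 3)) * l\<^sup>2"
    if t: "0 < t" and seq: "dgn_sequence Z F A t \<delta> z zt \<and> adaptive_tolerance F \<delta> z zt" for t \<delta> z zt k
  proof -
    interpret adaptive_dgn_run "interior Z" F A t \<delta> z zt by (rule adaptive[OF t seq])
    show ?thesis using l_Suc_adaptive[of k] by (simp add: Let_def)
  qed
  have c: "\<exists>K :: real \<Rightarrow> nat.
           (\<lambda>e. real (K e)) \<in> O[at_right 0](\<lambda>e. ln (ln (1 / e))) \<and>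
           (\<exists>e0>0. \<forall>e \<epsilon> t cbar. \<forall>\<beta>s \<delta> :: nat \<Rightarrow> real. \<forall>z zt.
              0 < e \<and> e < \<beta> \<and> e < e0 \<and> \<epsilon> > 0
              \<and> t = (1 - 2 * e\<^sup>2) * inverse (sqrt \<nu> * (1 + e) + e + 3 * e\<^sup>2) * \<epsilon>
              \<and> cbar = (2 * \<beta>\<^sup>2 + 4 * \<beta> + 3) / (1 - \<beta>\<^sup>2 * (2 * \<beta>\<^sup>2 + 4 * \<beta> + 3))
              \<and> (\<forall>k. \<beta>s k = cbar ^ (2 ^ k - 1) * \<beta> ^ (2 ^ k))
              \<and> (\<forall>k. \<delta> k = inverse (1 + \<beta>s k) * (\<beta>s k)\<^sup>2)
              \<and> dgn_sequence Z F A t \<delta> z zt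
              \<and> z 0 \<in> newton_neighborhood Z F A t \<beta> \<longrightarrow>
              (\<forall>k\<ge>K e. eps_solution Z F A \<epsilon> (zt k)))"
    if \<beta>: "0 < \<beta> \<and> \<beta> \<le> 0.21027" for \<beta>
  proof -
    define c where "c = (2 * \<beta>\<^sup>2 + 4 * \<beta> + 3) / (1 - \<beta>\<^sup>2 * (2 * \<beta>\<^sup>2 + 4 * \<beta> + 3))"
    have b: "0 < \<beta>" "\<beta> \<le> 21027 / 100000" using \<beta> by auto
    have cb: "0 < c" "c * \<beta> < 1" "c \<le> 5" unfolding c_def by (rule schedule_ratio_less_1[OF b])+
    obtain k0 where k0: "\<And>\<beta>s lam l \<delta> :: nat \<Rightarrow> real. \<And>j.
       \<beta>s 0 = \<beta> \<Longrightarrow> \<forall>k. \<beta>s (Suc k) = c * (\<beta>s k)\<^sup>2 \<Longrightarrow> \<forall>k. \<delta> k = (\<beta>s k)\<^sup>2 / (1 + \<beta>s k) \<Longrightarrow>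
       \<forall>k. 0 \<le> l k \<and> 0 \<le> lam k \<Longrightarrow> lam 0 \<le> \<beta> \<Longrightarrow> \<forall>k. l k \<le> lam k + \<delta> k \<Longrightarrow>
       \<forall>k. lam (Suc k) \<le> (l k)\<^sup>2 * (2 + 2 * l k + (l k)\<^sup>2) + (1 + l k) * \<delta> k \<Longrightarrow>
       10 * (lam (k0 + j) + \<beta>s (k0 + j)) \<le> (1 / 2) ^ (2 ^ j)"
      using scheduled_decrements_vanish[OF b cb] by meson
    define K where "K e = k0 + 1 + nat \<lceil>log 2 (log 2 (1 / e))\<rceil>" for e :: real
    show ?thesis
    proof (rule exI[of _ K], intro conjI exI[of _ "1 / 4"] allI impI; (elim conjE)?)
      show "(\<lambda>e. real (K e)) \<in> O[at_right 0](\<lambda>e. ln (ln (1 / e)))"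
        unfolding K_def by (rule log_log_bigo)
    next
      fix e \<epsilon> t cbar :: real and \<beta>s \<delta> :: "nat \<Rightarrow> real" and z zt :: "nat \<Rightarrow> real^'n" and k
      assume e: "0 < e" "e < \<beta>" "e < 1 / 4" and eps: "0 < \<epsilon>"
        and tdef: "t = (1 - 2 * e\<^sup>2) * inverse (sqrt \<nu> * (1 + e) + e + 3 * e\<^sup>2) * \<epsilon>"
        and cbar: "cbar = (2 * \<beta>\<^sup>2 + 4 * \<beta> + 3) / (1 - \<beta>\<^sup>2 * (2 * \<beta>\<^sup>2 + 4 * \<beta> + 3))"
        and bs: "\<forall>k. \<beta>s k = cbar ^ (2 ^ k - 1) * \<beta> ^ (2 ^ k)"
        and del: "\<forall>k. \<delta> k = inverse (1 + \<beta>s k) * (\<beta>s k)\<^sup>2"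
        and seq: "dgn_sequence Z F A t \<delta> z zt"
        and init: "z 0 \<in> newton_neighborhood Z F A t \<beta>" and k: "K e \<le> k"
      have nu: "2 * (gradient F x \<bullet> u) - (local_norm F x u)\<^sup>2 \<le> \<nu>" if "x \<in> interior Z" for x u
        using barrier that by (simp add: self_concordant_barrier_def)
      have "0 \<le> \<nu>" using nu[of _ 0] dom_int by (auto simp: local_norm_def)
      then have "0 \<le> sqrt \<nu> * (1 + e)" using e by simp
      then have "0 < sqrt \<nu> * (1 + e) + e + 3 * e\<^sup>2" using e zero_le_power2[of e] by linarith
      moreover have "e\<^sup>2 < 1 / 16" using e power_strict_mono[of e "1 / 4" 2] by (simp add: power2_eq_square)
      ultimately have tpos: "0 < t"
        unfolding tdef using eps by (intro mult_pos_pos positive_imp_inverse_positive) auto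
      interpret dgn_run "interior Z" F A t \<delta> z zt by (rule run[OF tpos seq])
      have cc: "cbar = c" using cbar by (simp add: c_def)
      note rec = schedule_recursion[OF cb(1) b(1) bs[rule_format, unfolded cc]]
      \<comment> \<open>the inexact Newton point \<open>zt k\<close> belongs to step \<open>k - 1\<close>, and \<open>K e > 0\<close>\<close>
      define m where "m = k - 1"
      define j where "j = m - k0"
      define N where "N = nat \<lceil>log 2 (log 2 (1 / e))\<rceil>"
      have "k0 + 1 + N \<le> k" using k by (simp only: K_def N_def)
      then have kS: "k = Suc m" and mj: "m = k0 + j" and j: "N \<le> j"
        by (auto simp: m_def j_def)
      have "10 * (dec (z (k0 + j)) + \<beta>s (k0 + j)) \<le> (1 / 2) ^ (2 ^ j)"
      proof (rule k0[of \<beta>s \<delta> l "\<lambda>k. dec (z k)"])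
        show "\<forall>k. \<delta> k = (\<beta>s k)\<^sup>2 / (1 + \<beta>s k)" using del by (simp add: divide_inverse mult.commute)
        show "dec (z 0) \<le> \<beta>" using init by (simp add: newton_neighborhood_def)
      qed (use rec l_nonneg dec_nonneg l_le dec_Suc in auto)
      also have "\<dots> \<le> e" by (rule log_log_iterations) (use e j in \<open>auto simp only: N_def\<close>)
      finally have small: "dec (z m) + \<beta>s m \<le> e / 10" by (simp add: mj)
      have bm: "0 < \<beta>s m" "\<beta>s m \<le> 1" using rec(3) small e dec_nonneg[of m] by auto
      have dm: "\<delta> m \<le> \<beta>s m"
      proof -
        have "(\<beta>s m)\<^sup>2 \<le> \<beta>s m * (1 + \<beta>s m)" using bm by (simp add: power2_eq_square distrib_left)
        then show ?thesis using del bm by (simp add: divide_inverse[symmetric] mult.commute[of "inverse _"] divide_le_eq)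
      qed
      show "eps_solution Z F A \<epsilon> (zt k)"
        unfolding kS
      proof (rule eps_solution_if_small[OF refl nu e(1,3) eps tdef])
        show "l m \<le> e / 10" using l_le[of m] dm small by linarith
        show "\<delta> m \<le> e / 10" using dm small dec_nonneg[of m] by linarith
      qed
    qed simp
  qed
  show ?thesis
    unfolding quadratic_convergence_region_def
    using a neighborhood c by (intro conjI allI impI; (elim conjE CollectE exE)?) blast+
qed

end
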